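(* The functor of global sections $\Gamma:\overline{s\mathbb G}\to s\mathcal L^{op}$, $(X,\mathcal O_{\bullet,X})\mapsto\Gamma(X,\mathcal O_{\bullet,X})$, maps local weak equivalences to weak equivalences.
   Context: Let $\mathcal C^\infty$ be the category with objects $\mathbb R^n$, $n\ge 0$, and smooth maps. A $C^\infty$-ring is a product preserving functor $A:\mathcal C^\infty\to Set$, identified with the set $A(\mathbb R)$ with its operations; it is in particular a commutative $\mathbb R$-algebra. It is finitely generated if it is a quotient of some $C^\infty(\mathbb R^n)$, $n<\infty$, and local if it has a unique maximal ideal $\mathfrak m$ and $A/\mathfrak m\cong\mathbb R$. A weak equivalence of simplicial $C^\infty$-rings is a map that is a weak equivalence of underlying simplicial sets. For a simplicial $C^\infty$-ring $A_\bullet$, $\pi_0(A_\bullet)$ is a $C^\infty$-ring and $\pi_k(A_\bullet)$ (based at $0$) is a $\pi_0(A_\bullet)$-module. $s\mathcal L$ is the full subcategory of simplicial $C^\infty$-rings $A_\bullet$ with $\pi_0(A_\bullet)$ finitely generated. For a sheaf $\mathcal O_{\bullet,X}=\{\mathcal O_{k,X}\}_{k\ge0}$ of simplicial $C^\infty$-rings on a space $X$, $\pi_k(\mathcal O_{\bullet,X})$ is the sheaf associated to $U\mapsto\pi_k(\Gamma(U,\mathcal O_{\bullet,X}))$. A simplicial $C^\infty$-space is a pair $(X,\mathcal O_{\bullet,X})$ with $X$ a Hausdorff topological space and $\mathcal O_{\bullet,X}$ a sheaf of simplicial $C^\infty$-rings on $X$ such that $\pi_0(\mathcal O_{\bullet,X})$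 is a soft sheaf of finitely generated $C^\infty$-rings whose stalks are local $C^\infty$-rings. A morphism $(X,\mathcal O_{\bullet,X})\to(Y,\mathcal O_{\bullet,Y})$ is a pair $(\phi,\phi_\bullet^\sharp)$ with $\phi:X\to Y$ continuous and $\phi_\bullet^\sharp:\mathcal O_{\bullet,Y}\to\phi_*(\mathcal O_{\bullet,X})$ a morphism of sheaves of simplicial $C^\infty$-rings. It is a local weak equivalence if $\phi$ is a homeomorphism and the induced maps $\pi_k(\mathcal O_{\bullet,Y})\to\phi_*(\pi_k(\mathcal O_{\bullet,X}))$ are isomorphisms for all $k\ge0$. A simplicial $C^\infty$-space is localized if the stalks of $\mathcal O_{0,X}$ are local $C^\infty$-rings; $\overline{s\mathbb G}$ is the full subcategory of localized simplicial $C^\infty$-spaces. *)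

theory Defs
  imports "HOL-Analysis.Analysis" "HOL-Algebra.QuotRing"
begin

section \<open>Smooth functions on \<open>\<real>\<^sup>n\<close>\<close>

text \<open>
  The space \<open>\<real>\<^sup>n\<close> is \<open>Euclidean_space n\<close>, whose points are the
  sequences vanishing from index \<open>n\<close> on.
\<close>

type_synonym rfun = "(nat \<Rightarrow> real) \<Rightarrow> real"

abbreviation Rn :: "nat \<Rightarrow> (nat \<Rightarrow> real) set"
  where "Rn n \<equiv> topspace (Euclidean_space n)"

primrec C_diff :: "nat \<Rightarrow> nat \<Rightarrow> rfun \<Rightarrow> bool" where
  "C_diff n 0 f \<longleftrightarrow> continuous_map (Euclidean_space n) euclideanreal f"
| "C_diff n (Suc k) f \<longleftrightarrow>
     continuous_map (Euclidean_space n) euclideanreal f \<and>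
     (\<forall>i<n. \<exists>D. C_diff n k D \<and>
        (\<forall>x\<in>Rn n. ((\<lambda>t. f (x(i := t))) has_real_derivative D x) (at (x i))))"

definition Cinf :: "nat \<Rightarrow> rfun set"
  where "Cinf n = {f \<in> extensional (Rn n). \<forall>k. C_diff n k f}"

text \<open>The composite \<open>f \<circ> (g\<^sub>0, \<dots>, g\<^bsub>m-1\<^esub>) : \<real>\<^sup>n \<rightarrow> \<real>\<close>.\<close>

definition scomp :: "nat \<Rightarrow> nat \<Rightarrow> rfun \<Rightarrow> (nat \<Rightarrow> rfun) \<Rightarrow> rfun"
  where "scomp n m f g = (\<lambda>x\<in>Rn n. f (\<lambda>j. if j < m then g j x else 0))"


section \<open>\<open>C\<^sup>\<infinity>\<close>-rings\<close>

text \<open>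
  A product preserving functor \<open>A\<close> on the category of the \<open>\<real>\<^sup>n\<close> and smooth maps is given by
  the set \<open>A(\<real>)\<close> with one operation \<open>A(\<real>)\<^sup>n \<rightarrow> A(\<real>)\<close> for every smooth \<open>f : \<real>\<^sup>n \<rightarrow> \<real>\<close>, such that
  projections act as projections and composites as composites.
\<close>

record 'a cring_inf = "'a partial_object" +
  cop :: "nat \<Rightarrow> rfun \<Rightarrow> (nat \<Rightarrow> 'a) \<Rightarrow> 'a"

definition Cinf_ring :: "('a, 'm) cring_inf_scheme \<Rightarrow> bool" where
  "Cinf_ring A \<longleftrightarrow>
     (\<forall>n. \<forall>f\<in>Cinf n. cop A n f \<in> ({..<n} \<rightarrow>\<^sub>E carrier A) \<rightarrow> carrier A) \<and>
     (\<forall>n. \<forall>i<n. \<forall>a\<in>{..<n} \<rightarrow>\<^sub>E carrier A. cop A n (\<lambda>x\<in>Rn n. x i) a = a i) \<and>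
     (\<forall>n m. \<forall>f\<in>Cinf m. \<forall>g\<in>{..<m} \<rightarrow> Cinf n. \<forall>a\<in>{..<n} \<rightarrow>\<^sub>E carrier A.
        cop A n (scomp n m f g) a = cop A m f (\<lambda>j\<in>{..<m}. cop A n (g j) a))"

definition Cinf_hom ::
  "('a, 'm) cring_inf_scheme \<Rightarrow> ('b, 'k) cring_inf_scheme \<Rightarrow> ('a \<Rightarrow> 'b) set" where
  "Cinf_hom A B = {h \<in> carrier A \<rightarrow> carrier B.
     \<forall>n. \<forall>f\<in>Cinf n. \<forall>a\<in>{..<n} \<rightarrow>\<^sub>E carrier A. h (cop A n f a) = cop B n f (\<lambda>i\<in>{..<n}. h (a i))}"

definition Cinf_isomorphic ::
  "('a, 'm) cring_inf_scheme \<Rightarrow> ('b, 'k) cring_inf_scheme \<Rightarrow> bool" where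
  "Cinf_isomorphic A B \<longleftrightarrow> (\<exists>h\<in>Cinf_hom A B. bij_betw h (carrier A) (carrier B))"

definition real_Cinf :: "real cring_inf"
  where "real_Cinf = \<lparr>carrier = UNIV, cop = (\<lambda>n f a. f (\<lambda>i. if i < n then a i else 0))\<rparr>"

definition free_Cinf :: "nat \<Rightarrow> rfun cring_inf"
  where "free_Cinf n = \<lparr>carrier = Cinf n, cop = (\<lambda>m f g. scomp n m f g)\<rparr>"

definition finitely_generated :: "('a, 'm) cring_inf_scheme \<Rightarrow> bool" where
  "finitely_generated A \<longleftrightarrow> (\<exists>n. \<exists>h\<in>Cinf_hom (free_Cinf n) A. h ` Cinf n = carrier A)"

definition pair_fun :: "'a \<Rightarrow> 'a \<Rightarrow> nat \<Rightarrow> 'a"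
  where "pair_fun a b = (\<lambda>i\<in>{..<2}. if i = 0 then a else b)"

definition const_elt :: "('a, 'm) cring_inf_scheme \<Rightarrow> real \<Rightarrow> 'a"
  where "const_elt A c = cop A 0 (\<lambda>x\<in>Rn 0. c) (\<lambda>i\<in>{}. undefined)"

definition underlying_ring :: "('a, 'm) cring_inf_scheme \<Rightarrow> 'a ring" where
  "underlying_ring A =
     \<lparr>carrier = carrier A,
      mult = (\<lambda>a b. cop A 2 (\<lambda>x\<in>Rn 2. x 0 * x 1) (pair_fun a b)),
      one = const_elt A 1,
      zero = const_elt A 0,
      add = (\<lambda>a b. cop A 2 (\<lambda>x\<in>Rn 2. x 0 + x 1) (pair_fun a b))\<rparr>"

text \<open>
  Operations on the quotient by an ideal are computed on representatives; the choice is
  irrelevant because, by Hadamard's lemma, every ideal is a congruence for all smooth operations.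
\<close>

definition quot_Cinf :: "('a, 'm) cring_inf_scheme \<Rightarrow> 'a set \<Rightarrow> 'a set cring_inf" where
  "quot_Cinf A I =
     \<lparr>carrier = a_rcosets\<^bsub>underlying_ring A\<^esub> I,
      cop = (\<lambda>n f c. I +>\<^bsub>underlying_ring A\<^esub> cop A n f (\<lambda>i\<in>{..<n}. SOME a. a \<in> c i))\<rparr>"

definition local_Cinf :: "('a, 'm) cring_inf_scheme \<Rightarrow> bool" where
  "local_Cinf A \<longleftrightarrow>
     (\<exists>M. maximalideal M (underlying_ring A) \<and>
          (\<forall>M'. maximalideal M' (underlying_ring A) \<longrightarrow> M' = M) \<and>
          Cinf_isomorphic (quot_Cinf A M) real_Cinf)"


section \<open>Simplicial sets and their homotopy groups\<close>

definition simplex_maps :: "nat \<Rightarrow> nat \<Rightarrow> (nat \<Rightarrow> nat) set"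
  where "simplex_maps m n = {\<theta> \<in> {..m} \<rightarrow>\<^sub>E {..n}. mono_on {..m} \<theta>}"

record 'a sset =
  spx :: "nat \<Rightarrow> 'a set"
  sact :: "nat \<Rightarrow> nat \<Rightarrow> (nat \<Rightarrow> nat) \<Rightarrow> 'a \<Rightarrow> 'a"

text \<open>For \<open>\<theta> : [m] \<rightarrow> [n]\<close>, the function \<open>sact S m n \<theta>\<close> maps \<open>n\<close>-simplices to \<open>m\<close>-simplices.\<close>

definition simplicial_set :: "('a, 'm) sset_scheme \<Rightarrow> bool" where
  "simplicial_set S \<longleftrightarrow>
     (\<forall>m n. \<forall>\<theta>\<in>simplex_maps m n. sact S m n \<theta> \<in> spx S n \<rightarrow> spx S m) \<and>
     (\<forall>n. \<forall>s\<in>spx S n. sact S n n (\<lambda>j\<in>{..n}. j) s = s) \<and>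
     (\<forall>l m n. \<forall>\<theta>\<in>simplex_maps l m. \<forall>\<eta>\<in>simplex_maps m n. \<forall>s\<in>spx S n.
        sact S l n (compose {..l} \<eta> \<theta>) s = sact S l m \<theta> (sact S m n \<eta> s))"

definition coface :: "nat \<Rightarrow> nat \<Rightarrow> nat \<Rightarrow> nat"
  where "coface k i = (\<lambda>j\<in>{..k}. if j < i then j else Suc j)"

definition face :: "('a, 'm) sset_scheme \<Rightarrow> nat \<Rightarrow> nat \<Rightarrow> 'a \<Rightarrow> 'a"
  where "face S k i = sact S k (Suc k) (coface k i)"

definition base :: "('a, 'm) sset_scheme \<Rightarrow> nat \<Rightarrow> 'a \<Rightarrow> 'a"
  where "base S k v = sact S k 0 (\<lambda>j\<in>{..k}. 0) v"

definition spheres :: "('a, 'm) sset_scheme \<Rightarrow> nat \<Rightarrow> 'a \<Rightarrow> 'a set" where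
  "spheres S k v = {s \<in> spx S k. \<forall>j. k = Suc j \<longrightarrow> (\<forall>i\<le>k. face S j i s = base S j v)}"

definition homot :: "('a, 'm) sset_scheme \<Rightarrow> nat \<Rightarrow> 'a \<Rightarrow> ('a \<times> 'a) set" where
  "homot S k v = {(s, t). s \<in> spheres S k v \<and> t \<in> spheres S k v \<and>
     (\<exists>w\<in>spx S (Suc k). (\<forall>i<k. face S k i w = base S k v) \<and>
        face S k k w = s \<and> face S k (Suc k) w = t)}"

text \<open>
  The combinatorial homotopy groups \<open>\<pi>\<^sub>k(S, v)\<close> of a Kan complex, on which \<open>homot\<close> is an
  equivalence relation.  The simplicial sets considered here underlie simplicial abelian groups,
  hence are Kan complexes.  For \<open>k = 0\<close> the vertex \<open>v\<close> plays no role.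
\<close>

definition pi_set :: "('a, 'm) sset_scheme \<Rightarrow> nat \<Rightarrow> 'a \<Rightarrow> 'a set set"
  where "pi_set S k v = spheres S k v // homot S k v"

definition pi_map ::
  "('b, 'm) sset_scheme \<Rightarrow> nat \<Rightarrow> 'b \<Rightarrow> (nat \<Rightarrow> 'a \<Rightarrow> 'b) \<Rightarrow> 'a set \<Rightarrow> 'b set"
  where "pi_map T k w h c = homot T k w `` (h k ` c)"

definition kan_weak_equivalence ::
  "('a, 'm) sset_scheme \<Rightarrow> ('b, 'k) sset_scheme \<Rightarrow> (nat \<Rightarrow> 'a \<Rightarrow> 'b) \<Rightarrow> bool" where
  "kan_weak_equivalence S T h \<longleftrightarrow>
     (spx S 0 = {} \<longrightarrow> spx T 0 = {}) \<and>
     (\<forall>v\<in>spx S 0. \<forall>k. bij_betw (pi_map T k (h 0 v) h) (pi_set S k v) (pi_set T k (h 0 v)))"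


section \<open>Simplicial \<open>C\<^sup>\<infinity>\<close>-rings\<close>

record 'a scring = "'a sset" +
  sop :: "nat \<Rightarrow> nat \<Rightarrow> rfun \<Rightarrow> (nat \<Rightarrow> 'a) \<Rightarrow> 'a"

definition level :: "('a, 'm) scring_scheme \<Rightarrow> nat \<Rightarrow> 'a cring_inf"
  where "level A k = \<lparr>carrier = spx A k, cop = sop A k\<rparr>"

definition simplicial_Cinf :: "('a, 'm) scring_scheme \<Rightarrow> bool" where
  "simplicial_Cinf A \<longleftrightarrow>
     simplicial_set A \<and>
     (\<forall>k. Cinf_ring (level A k)) \<and>
     (\<forall>m n. \<forall>\<theta>\<in>simplex_maps m n. sact A m n \<theta> \<in> Cinf_hom (level A n) (level A m))"

definition scring_hom ::
  "('a, 'm) scring_scheme \<Rightarrow> ('b, 'k) scring_scheme \<Rightarrow> (nat \<Rightarrow> 'a \<Rightarrow> 'b) set" where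
  "scring_hom A B = {h.
     (\<forall>k. h k \<in> Cinf_hom (level A k) (level B k)) \<and>
     (\<forall>m n. \<forall>\<theta>\<in>simplex_maps m n. \<forall>a\<in>spx A n. h m (sact A m n \<theta> a) = sact B m n \<theta> (h n a))}"

definition weak_equivalence ::
  "('a, 'm) scring_scheme \<Rightarrow> ('b, 'k) scring_scheme \<Rightarrow> (nat \<Rightarrow> 'a \<Rightarrow> 'b) \<Rightarrow> bool"
  where "weak_equivalence A B h \<longleftrightarrow> h \<in> scring_hom A B \<and> kan_weak_equivalence A B h"

definition szero :: "('a, 'm) scring_scheme \<Rightarrow> 'a"
  where "szero A = zero (underlying_ring (level A 0))"

abbreviation pi_ring :: "('a, 'm) scring_scheme \<Rightarrow> nat \<Rightarrow> 'a set set"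
  where "pi_ring A k \<equiv> pi_set A k (szero A)"

definition pi0_op ::
  "('a, 'm) scring_scheme \<Rightarrow> nat \<Rightarrow> rfun \<Rightarrow> (nat \<Rightarrow> 'a set) \<Rightarrow> 'a set" where
  "pi0_op A n f c = homot A 0 (szero A) `` {sop A 0 n f (\<lambda>i\<in>{..<n}. SOME a. a \<in> c i)}"

definition pi0_Cinf :: "('a, 'm) scring_scheme \<Rightarrow> 'a set cring_inf"
  where "pi0_Cinf A = \<lparr>carrier = pi_ring A 0, cop = pi0_op A\<rparr>"

text \<open>The objects of \<open>s\<L>\<close>.\<close>

definition in_sL :: "('a, 'm) scring_scheme \<Rightarrow> bool"
  where "in_sL A \<longleftrightarrow> simplicial_Cinf A \<and> finitely_generated (pi0_Cinf A)"


section \<open>Presheaves, stalks and associated sheaves\<close>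

record ('x, 'a) psh =
  sec :: "'x set \<Rightarrow> 'a set"
  rst :: "'x set \<Rightarrow> 'x set \<Rightarrow> 'a \<Rightarrow> 'a"

record ('x, 'a) cpsh = "('x, 'a) psh" +
  pop :: "'x set \<Rightarrow> nat \<Rightarrow> rfun \<Rightarrow> (nat \<Rightarrow> 'a) \<Rightarrow> 'a"

definition sections_Cinf :: "('x, 'a, 'm) cpsh_scheme \<Rightarrow> 'x set \<Rightarrow> 'a cring_inf"
  where "sections_Cinf F U = \<lparr>carrier = sec F U, cop = pop F U\<rparr>"

definition presheaf :: "'x topology \<Rightarrow> ('x, 'a, 'm) psh_scheme \<Rightarrow> bool" where
  "presheaf X F \<longleftrightarrow>
     (\<forall>U V. openin X U \<longrightarrow> openin X V \<longrightarrow> V \<subseteq> U \<longrightarrow> rst F U V \<in> sec F U \<rightarrow> sec F V) \<and>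
     (\<forall>U. openin X U \<longrightarrow> (\<forall>s\<in>sec F U. rst F U U s = s)) \<and>
     (\<forall>U V W. openin X U \<longrightarrow> openin X V \<longrightarrow> openin X W \<longrightarrow> W \<subseteq> V \<longrightarrow> V \<subseteq> U \<longrightarrow>
        (\<forall>s\<in>sec F U. rst F V W (rst F U V s) = rst F U W s))"

definition sheaf :: "'x topology \<Rightarrow> ('x, 'a, 'm) psh_scheme \<Rightarrow> bool" where
  "sheaf X F \<longleftrightarrow> presheaf X F \<and>
     (\<forall>\<U> s. (\<forall>U\<in>\<U>. openin X U \<and> s U \<in> sec F U) \<longrightarrow>
        (\<forall>U\<in>\<U>. \<forall>V\<in>\<U>. rst F U (U \<inter> V) (s U) = rst F V (U \<inter> V) (s V)) \<longrightarrow>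
        (\<exists>!t. t \<in> sec F (\<Union>\<U>) \<and> (\<forall>U\<in>\<U>. rst F (\<Union>\<U>) U t = s U)))"

type_synonym ('x, 'a) germ = "('x set \<times> 'a) set"

definition germ ::
  "'x topology \<Rightarrow> ('x, 'a, 'm) psh_scheme \<Rightarrow> 'x \<Rightarrow> 'x set \<Rightarrow> 'a \<Rightarrow> ('x, 'a) germ" where
  "germ X F x U s = {(V, t). openin X V \<and> x \<in> V \<and> t \<in> sec F V \<and>
     (\<exists>W. openin X W \<and> x \<in> W \<and> W \<subseteq> U \<inter> V \<and> rst F U W s = rst F V W t)}"

definition stalk :: "'x topology \<Rightarrow> ('x, 'a, 'm) psh_scheme \<Rightarrow> 'x \<Rightarrow> ('x, 'a) germ set" where
  "stalk X F x = {germ X F x U s |U s. openin X U \<and> x \<in> U \<and> s \<in> sec F U}"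

definition stalk_op ::
  "'x topology \<Rightarrow> ('x, 'a, 'm) cpsh_scheme \<Rightarrow> 'x \<Rightarrow> nat \<Rightarrow> rfun \<Rightarrow> (nat \<Rightarrow> ('x, 'a) germ) \<Rightarrow>
     ('x, 'a) germ" where
  "stalk_op X F x n f g = (THE c. \<exists>U s. openin X U \<and> x \<in> U \<and> s \<in> {..<n} \<rightarrow>\<^sub>E sec F U \<and>
     (\<forall>i<n. g i = germ X F x U (s i)) \<and> c = germ X F x U (pop F U n f s))"

definition stalk_Cinf ::
  "'x topology \<Rightarrow> ('x, 'a, 'm) cpsh_scheme \<Rightarrow> 'x \<Rightarrow> ('x, 'a) germ cring_inf"
  where "stalk_Cinf X F x = \<lparr>carrier = stalk X F x, cop = stalk_op X F x\<rparr>"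

text \<open>
  Sections of the associated sheaf over an arbitrary subset \<open>Z\<close> are the continuous sections of the
  space of germs over \<open>Z\<close>; for \<open>Z\<close> not open these are the global sections of the inverse image
  of the sheaf on \<open>Z\<close>.
\<close>

definition germ_sections ::
  "'x topology \<Rightarrow> ('x, 'a, 'm) psh_scheme \<Rightarrow> 'x set \<Rightarrow> ('x \<Rightarrow> ('x, 'a) germ) set" where
  "germ_sections X F Z = {\<sigma> \<in> (\<Pi>\<^sub>E z\<in>Z. stalk X F z).
     \<forall>z\<in>Z. \<exists>V. openin X V \<and> z \<in> V \<and> (\<exists>s\<in>sec F V. \<forall>y\<in>Z \<inter> V. \<sigma> y = germ X F y V s)}"

definition sheafify ::
  "'x topology \<Rightarrow> ('x, 'a, 'm) psh_scheme \<Rightarrow> ('x, 'x \<Rightarrow> ('x, 'a) germ) psh" where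
  "sheafify X F = \<lparr>sec = germ_sections X F, rst = (\<lambda>U V \<sigma>. restrict \<sigma> V)\<rparr>"

definition sheafify_Cinf ::
  "'x topology \<Rightarrow> ('x, 'a, 'm) cpsh_scheme \<Rightarrow> ('x, 'x \<Rightarrow> ('x, 'a) germ) cpsh" where
  "sheafify_Cinf X F =
     \<lparr>sec = germ_sections X F, rst = (\<lambda>U V \<sigma>. restrict \<sigma> V),
      pop = (\<lambda>U n f \<sigma>. \<lambda>x\<in>U. stalk_op X F x n f (\<lambda>i\<in>{..<n}. \<sigma> i x))\<rparr>"

definition soft :: "'x topology \<Rightarrow> ('x, 'a, 'm) psh_scheme \<Rightarrow> bool" where
  "soft X F \<longleftrightarrow>
     (\<forall>Z. closedin X Z \<longrightarrow> (\<forall>\<tau>\<in>germ_sections X F Z.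
        \<exists>s\<in>sec F (topspace X). \<forall>z\<in>Z. germ X F z (topspace X) s = \<tau> z))"

definition preim :: "'x topology \<Rightarrow> ('x \<Rightarrow> 'y) \<Rightarrow> 'y set \<Rightarrow> 'x set"
  where "preim X \<phi> V = {x \<in> topspace X. \<phi> x \<in> V}"

text \<open>
  A morphism \<open>\<psi> : Q \<rightarrow> \<phi>\<^sub>* P\<close> of presheaves induces maps of stalks \<open>Q\<^bsub>\<phi> x\<^esub> \<rightarrow> P\<^bsub>x\<^esub>\<close>, and from
  these the morphism from the sheaf associated to \<open>Q\<close> to the direct image of the sheaf associated
  to \<open>P\<close>.  All germs in the union below are equal.
\<close>

definition germ_map ::
  "'x topology \<Rightarrow> ('x, 'a, 'm) psh_scheme \<Rightarrow> ('x \<Rightarrow> 'y) \<Rightarrow> ('y set \<Rightarrow> 'b \<Rightarrow> 'a) \<Rightarrow> 'x \<Rightarrow>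
     ('y, 'b) germ \<Rightarrow> ('x, 'a) germ" where
  "germ_map X P \<phi> \<psi> x c = (\<Union>(V, t)\<in>c. germ X P x (preim X \<phi> V) (\<psi> V t))"

definition sheafify_map ::
  "'x topology \<Rightarrow> ('x, 'a, 'm) psh_scheme \<Rightarrow> ('x \<Rightarrow> 'y) \<Rightarrow> ('y set \<Rightarrow> 'b \<Rightarrow> 'a) \<Rightarrow> 'y set \<Rightarrow>
     ('y \<Rightarrow> ('y, 'b) germ) \<Rightarrow> ('x \<Rightarrow> ('x, 'a) germ)" where
  "sheafify_map X P \<phi> \<psi> U \<sigma> = (\<lambda>x\<in>preim X \<phi> U. germ_map X P \<phi> \<psi> x (\<sigma> (\<phi> x)))"


section \<open>Simplicial \<open>C\<^sup>\<infinity>\<close>-spaces\<close>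

record ('x, 'a) ssheaf =
  ssec :: "'x set \<Rightarrow> 'a scring"
  srst :: "'x set \<Rightarrow> 'x set \<Rightarrow> nat \<Rightarrow> 'a \<Rightarrow> 'a"

definition level_psh :: "('x, 'a, 'm) ssheaf_scheme \<Rightarrow> nat \<Rightarrow> ('x, 'a) cpsh" where
  "level_psh \<O> k =
     \<lparr>sec = (\<lambda>U. spx (ssec \<O> U) k), rst = (\<lambda>U V. srst \<O> U V k), pop = (\<lambda>U. sop (ssec \<O> U) k)\<rparr>"

definition simplicial_sheaf :: "'x topology \<Rightarrow> ('x, 'a, 'm) ssheaf_scheme \<Rightarrow> bool" where
  "simplicial_sheaf X \<O> \<longleftrightarrow>
     (\<forall>U. openin X U \<longrightarrow> simplicial_Cinf (ssec \<O> U)) \<and>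
     (\<forall>U V. openin X U \<longrightarrow> openin X V \<longrightarrow> V \<subseteq> U \<longrightarrow>
        srst \<O> U V \<in> scring_hom (ssec \<O> U) (ssec \<O> V)) \<and>
     (\<forall>k. sheaf X (level_psh \<O> k))"

definition pi_psh :: "('x, 'a, 'm) ssheaf_scheme \<Rightarrow> nat \<Rightarrow> ('x, 'a set) psh" where
  "pi_psh \<O> k =
     \<lparr>sec = (\<lambda>U. pi_ring (ssec \<O> U) k),
      rst = (\<lambda>U V. pi_map (ssec \<O> V) k (szero (ssec \<O> V)) (srst \<O> U V))\<rparr>"

definition pi0_psh :: "('x, 'a, 'm) ssheaf_scheme \<Rightarrow> ('x, 'a set) cpsh" where
  "pi0_psh \<O> =
     \<lparr>sec = sec (pi_psh \<O> 0), rst = rst (pi_psh \<O> 0), pop = (\<lambda>U. pi0_op (ssec \<O> U))\<rparr>"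

definition pi_sheaf ::
  "'x topology \<Rightarrow> ('x, 'a, 'm) ssheaf_scheme \<Rightarrow> nat \<Rightarrow> ('x, 'x \<Rightarrow> ('x, 'a set) germ) psh"
  where "pi_sheaf X \<O> k = sheafify X (pi_psh \<O> k)"

definition pi0_sheaf ::
  "'x topology \<Rightarrow> ('x, 'a, 'm) ssheaf_scheme \<Rightarrow> ('x, 'x \<Rightarrow> ('x, 'a set) germ) cpsh"
  where "pi0_sheaf X \<O> = sheafify_Cinf X (pi0_psh \<O>)"

definition simplicial_Cinf_space :: "'x topology \<Rightarrow> ('x, 'a, 'm) ssheaf_scheme \<Rightarrow> bool" where
  "simplicial_Cinf_space X \<O> \<longleftrightarrow>
     Hausdorff_space X \<and>
     simplicial_sheaf X \<O> \<and>
     soft X (pi0_sheaf X \<O>) \<and>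
     (\<forall>U. openin X U \<longrightarrow> finitely_generated (sections_Cinf (pi0_sheaf X \<O>) U)) \<and>
     (\<forall>x\<in>topspace X. local_Cinf (stalk_Cinf X (pi0_sheaf X \<O>) x))"

text \<open>The objects of \<open>s\<G>\<close>-bar.\<close>

definition localized_space :: "'x topology \<Rightarrow> ('x, 'a, 'm) ssheaf_scheme \<Rightarrow> bool" where
  "localized_space X \<O> \<longleftrightarrow>
     simplicial_Cinf_space X \<O> \<and>
     (\<forall>x\<in>topspace X. local_Cinf (stalk_Cinf X (level_psh \<O> 0) x))"

definition space_morphism ::
  "'x topology \<Rightarrow> ('x, 'a, 'm) ssheaf_scheme \<Rightarrow> 'y topology \<Rightarrow> ('y, 'b, 'k) ssheaf_scheme \<Rightarrow>
     ('x \<Rightarrow> 'y) \<Rightarrow> ('y set \<Rightarrow> nat \<Rightarrow> 'b \<Rightarrow> 'a) \<Rightarrow> bool" where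
  "space_morphism X \<O>X Y \<O>Y \<phi> \<phi>s \<longleftrightarrow>
     continuous_map X Y \<phi> \<and>
     (\<forall>V. openin Y V \<longrightarrow> \<phi>s V \<in> scring_hom (ssec \<O>Y V) (ssec \<O>X (preim X \<phi> V))) \<and>
     (\<forall>V W. openin Y V \<longrightarrow> openin Y W \<longrightarrow> W \<subseteq> V \<longrightarrow>
        (\<forall>k. \<forall>s\<in>spx (ssec \<O>Y V) k.
           \<phi>s W k (srst \<O>Y V W k s) = srst \<O>X (preim X \<phi> V) (preim X \<phi> W) k (\<phi>s V k s)))"

definition pi_sheaf_map ::
  "'x topology \<Rightarrow> ('x, 'a, 'm) ssheaf_scheme \<Rightarrow> ('x \<Rightarrow> 'y) \<Rightarrow> ('y set \<Rightarrow> nat \<Rightarrow> 'b \<Rightarrow> 'a) \<Rightarrow>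
     nat \<Rightarrow> 'y set \<Rightarrow> ('y \<Rightarrow> ('y, 'b set) germ) \<Rightarrow> ('x \<Rightarrow> ('x, 'a set) germ)" where
  "pi_sheaf_map X \<O>X \<phi> \<phi>s k =
     sheafify_map X (pi_psh \<O>X k) \<phi>
       (\<lambda>V. pi_map (ssec \<O>X (preim X \<phi> V)) k (szero (ssec \<O>X (preim X \<phi> V))) (\<phi>s V))"

text \<open>
  The maps induced on homotopy sheaves preserve all algebraic structure, so they are isomorphisms
  of sheaves as soon as they are bijective on sections over every open set.
\<close>

definition local_weak_equivalence ::
  "'x topology \<Rightarrow> ('x, 'a, 'm) ssheaf_scheme \<Rightarrow> 'y topology \<Rightarrow> ('y, 'b, 'k) ssheaf_scheme \<Rightarrow>
     ('x \<Rightarrow> 'y) \<Rightarrow> ('y set \<Rightarrow> nat \<Rightarrow> 'b \<Rightarrow> 'a) \<Rightarrow> bool" where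
  "local_weak_equivalence X \<O>X Y \<O>Y \<phi> \<phi>s \<longleftrightarrow>
     space_morphism X \<O>X Y \<O>Y \<phi> \<phi>s \<and>
     homeomorphic_map X Y \<phi> \<and>
     (\<forall>k V. openin Y V \<longrightarrow>
        bij_betw (pi_sheaf_map X \<O>X \<phi> \<phi>s k V)
          (sec (pi_sheaf Y \<O>Y k) V) (sec (pi_sheaf X \<O>X k) (preim X \<phi> V)))"


section \<open>Global sections\<close>

definition global_sections :: "'x topology \<Rightarrow> ('x, 'a, 'm) ssheaf_scheme \<Rightarrow> 'a scring"
  where "global_sections X \<O> = ssec \<O> (topspace X)"

definition global_sections_map :: "'y topology \<Rightarrow> ('y set \<Rightarrow> nat \<Rightarrow> 'b \<Rightarrow> 'a) \<Rightarrow> nat \<Rightarrow> 'b \<Rightarrow> 'a"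
  where "global_sections_map Y \<phi>s = \<phi>s (topspace Y)"

lemma preim_topspace: "continuous_map X Y \<phi> \<Longrightarrow> preim X \<phi> (topspace Y) = topspace X"
  by (auto simp: preim_def continuous_map_def)

lemma global_sections_map_hom:
  assumes "space_morphism X \<O>X Y \<O>Y \<phi> \<phi>s"
  shows "global_sections_map Y \<phi>s \<in> scring_hom (global_sections Y \<O>Y) (global_sections X \<O>X)"
proof -
  have "preim X \<phi> (topspace Y) = topspace X"
    using assms by (simp add: space_morphism_def preim_topspace)
  moreover have "\<phi>s (topspace Y) \<in> scring_hom (ssec \<O>Y (topspace Y)) (ssec \<O>X (preim X \<phi> (topspace Y)))"
    using assms by (simp add: space_morphism_def)
  ultimately show ?thesis
    by (simp add: global_sections_map_def global_sections_def)
qed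

lemma Cinf_hom_comp:
  assumes "h \<in> Cinf_hom A B" "g \<in> Cinf_hom B C"
  shows "g \<circ> h \<in> Cinf_hom A C"
proof -
  have "(g \<circ> h) (cop A n f a) = cop C n f (\<lambda>i\<in>{..<n}. (g \<circ> h) (a i))"
    if f: "f \<in> Cinf n" and a: "a \<in> {..<n} \<rightarrow>\<^sub>E carrier A" for n f a
  proof -
    let ?b = "\<lambda>i\<in>{..<n}. h (a i)"
    have b: "?b \<in> {..<n} \<rightarrow>\<^sub>E carrier B"
      using a assms(1) by (auto simp: Cinf_hom_def PiE_def Pi_def)
    have "g (h (cop A n f a)) = cop C n f (\<lambda>i\<in>{..<n}. g (?b i))"
      using assms f a b by (simp add: Cinf_hom_def)
    also have "(\<lambda>i\<in>{..<n}. g (?b i)) = (\<lambda>i\<in>{..<n}. (g \<circ> h) (a i))"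
      by (auto simp: restrict_def)
    finally show ?thesis by (simp only: o_apply)
  qed
  then show ?thesis
    using assms by (auto simp: Cinf_hom_def)
qed

lemma scring_hom_comp:
  assumes h: "h \<in> scring_hom A B" and g: "g \<in> scring_hom B C"
  shows "(\<lambda>k. g k \<circ> h k) \<in> scring_hom A C"
proof -
  have mem: "h k a \<in> spx B k" if "a \<in> spx A k" for k a
    using h that by (auto simp: scring_hom_def Cinf_hom_def level_def)
  show ?thesis
    using h g mem by (auto simp: scring_hom_def intro: Cinf_hom_comp)
qed

lemma space_morphism_comp:
  assumes 1: "space_morphism X \<O>X Y \<O>Y \<phi> \<phi>s" and 2: "space_morphism Y \<O>Y Z \<O>Z \<psi> \<psi>s"
  shows "space_morphism X \<O>X Z \<O>Z (\<psi> \<circ> \<phi>) (\<lambda>W k. \<phi>s (preim Y \<psi> W) k \<circ> \<psi>s W k)"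
proof -
  have c: "continuous_map X Y \<phi>" "continuous_map Y Z \<psi>"
    using 1 2 by (auto simp: space_morphism_def)
  have pre: "preim X (\<psi> \<circ> \<phi>) W = preim X \<phi> (preim Y \<psi> W)" for W
    using c(1) by (auto simp: preim_def continuous_map_def)
  have op: "openin Y (preim Y \<psi> W)" if "openin Z W" for W
    using c(2) that by (simp add: preim_def continuous_map_def)
  have sub: "preim Y \<psi> W \<subseteq> preim Y \<psi> V" if "W \<subseteq> V" for V W
    using that by (auto simp: preim_def)
  have mem: "\<psi>s V k s \<in> spx (ssec \<O>Y (preim Y \<psi> V)) k"
    if "openin Z V" "s \<in> spx (ssec \<O>Z V) k" for V k s
    using 2 that by (auto simp: space_morphism_def scring_hom_def Cinf_hom_def level_def)
  show ?thesis
    unfolding space_morphism_def pre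
  proof (intro conjI allI impI ballI)
    show "continuous_map X Z (\<psi> \<circ> \<phi>)"
      using c by (rule continuous_map_compose)
  next
    fix W assume "openin Z W"
    then show "(\<lambda>k. \<phi>s (preim Y \<psi> W) k \<circ> \<psi>s W k)
        \<in> scring_hom (ssec \<O>Z W) (ssec \<O>X (preim X \<phi> (preim Y \<psi> W)))"
      using 1 2 op by (intro scring_hom_comp) (auto simp: space_morphism_def)
  next
    fix V W k s
    assume "openin Z V" "openin Z W" "W \<subseteq> V" "s \<in> spx (ssec \<O>Z V) k"
    then show "(\<phi>s (preim Y \<psi> W) k \<circ> \<psi>s W k) (srst \<O>Z V W k s) =
        srst \<O>X (preim X \<phi> (preim Y \<psi> V)) (preim X \<phi> (preim Y \<psi> W)) k
          ((\<phi>s (preim Y \<psi> V) k \<circ> \<psi>s V k) s)"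
      using 1 2 op sub mem by (simp add: space_morphism_def)
  qed
qed

lemma space_morphism_ident:
  fixes X :: "'x topology" and \<O> :: "('x, 'a) ssheaf"
  assumes "simplicial_sheaf X \<O>"
  shows "space_morphism X \<O> X \<O> id (\<lambda>V k s. s)"
proof -
  have pre: "preim X id V = V" if "openin X V" for V
    using openin_subset [OF that] by (auto simp: preim_def)
  have idh: "(\<lambda>s. s) \<in> Cinf_hom A A" for A :: "'a cring_inf"
  proof -
    have "(\<lambda>i\<in>{..<n}. a i) = a" if "a \<in> {..<n} \<rightarrow>\<^sub>E carrier A" for n a
      using that by auto
    then show ?thesis by (auto simp: Cinf_hom_def)
  qed
  then have "(\<lambda>k s. s) \<in> scring_hom (ssec \<O> V) (ssec \<O> V)" for V
    by (simp add: scring_hom_def)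
  then show ?thesis
    using pre by (simp add: space_morphism_def id_def)
qed

lemma global_sections_map_ident: "global_sections_map X (\<lambda>V k s. s) = (\<lambda>k s. s)"
  by (simp add: global_sections_map_def)

lemma global_sections_map_comp:
  assumes "continuous_map Y Z \<psi>"
  shows "global_sections_map Z (\<lambda>W k. \<phi>s (preim Y \<psi> W) k \<circ> \<psi>s W k) =
         (\<lambda>k. global_sections_map Y \<phi>s k \<circ> global_sections_map Z \<psi>s k)"
  by (simp add: global_sections_map_def preim_topspace [OF assms] fun_eq_iff)

end

theory Submission
  imports Defs "HOL-Algebra.Ring_Divisibility"
begin

text \<open>
  The theorem reduces to one fact about a localized space \<open>(X, \<O>)\<close>: the homotopy groups of the
  simplicial ring of global sections are the global sections of the homotopy sheaves
  (\<open>pi_global_sections\<close>).  Then \<open>\<pi>\<^sub>0\<close> of the global sections is finitely generated, since the ring of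
  sections of \<open>\<pi>\<^sub>0(\<O>)\<close> over \<open>X\<close> is; and a local weak equivalence, which is an isomorphism on global
  sections of all homotopy sheaves, induces isomorphisms of all homotopy groups based at \<open>0\<close>, hence at
  every vertex by translation (\<open>pi_map_bij_base_change\<close>).

  That fact holds because every \<open>\<O>\<^sub>k\<close> behaves like a fine sheaf.  Choosing a homotopy between two
  spheres, or a sphere representing a given section of a homotopy sheaf, is a local problem whose
  solutions are closed under the affine combinations \<open>\<rho> s + (1 - \<rho>) t\<close> with \<open>\<rho>\<close> in \<open>\<O>\<^sub>0\<close>.  Such
  problems have global solutions as soon as they have local ones
  (\<open>glue_affine_solutions\<close>, \<open>localized_space_global_solution\<close>), provided that \<open>\<O>\<^sub>0\<close> has bump
  functions and that countably many of them suffice.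

  Both provisos come from the values of sections.  A section of a sheaf with local stalks has at each
  point a value in the residue field \<open>\<real>\<close>, smooth operations act on values by evaluation
  (\<open>residue_smooth_op\<close>), and values are continuous (\<open>section_value_continuous\<close>).  For the soft sheaf
  \<open>\<pi>\<^sub>0(\<O>)\<close> the values of finitely many generators embed \<open>X\<close> into some \<open>\<real>\<^sup>n\<close>, so \<open>X\<close> is second countable
  (\<open>soft_finitely_generated_second_countable\<close>).  For bump functions (\<open>bump_section\<close>), lift the
  generators to \<open>\<O>\<^sub>0\<close> near a point, take the smooth function of them that lifts a separating section of
  \<open>\<pi>\<^sub>0(\<O>)\<close>, and cut it off by a smooth step.  The result vanishes near the boundary because the stalks
  of \<open>\<O>\<^sub>0\<close> are local: \<open>f(a) = 0\<close> in a local ring if \<open>f\<close> vanishes near the residue of \<open>a\<close>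
  (\<open>smooth_op_eq_zero\<close>).
\<close>

section \<open>Smooth functions\<close>

lemma Rn_iff: "x \<in> Rn n \<longleftrightarrow> (\<forall>i\<ge>n. x i = 0)"
  by (simp add: topspace_Euclidean_space)

lemma Rn_upd: "x \<in> Rn n \<Longrightarrow> i < n \<Longrightarrow> x(i := t) \<in> Rn n"
  by (auto simp: Rn_iff)

lemma C_diff_continuous: "C_diff n k f \<Longrightarrow> continuous_map (Euclidean_space n) euclideanreal f"
  by (cases k) auto

lemma C_diff_SucI:
  assumes "continuous_map (Euclidean_space n) euclideanreal f"
    and "\<And>i. i < n \<Longrightarrow> \<exists>D. C_diff n k D \<and>
          (\<forall>x\<in>Rn n. ((\<lambda>t. f (x(i := t))) has_real_derivative D x) (at (x i)))"
  shows "C_diff n (Suc k) f"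
  using assms by auto

lemma C_diff_SucE:
  assumes "C_diff n (Suc k) f" "i < n"
  obtains D where "C_diff n k D"
    "\<forall>x\<in>Rn n. ((\<lambda>t. f (x(i := t))) has_real_derivative D x) (at (x i))"
  using assms by auto

lemma C_diff_cong:
  assumes "C_diff n k f" and eq: "\<And>x. x \<in> Rn n \<Longrightarrow> f x = g x"
  shows "C_diff n k g"
proof -
  have c: "continuous_map (Euclidean_space n) euclideanreal g"
    using C_diff_continuous [OF assms(1)] eq by (metis continuous_map_eq)
  show ?thesis
  proof (cases k)
    case 0
    with c show ?thesis by simp
  next
    case (Suc l)
    show ?thesis unfolding Suc
    proof (rule C_diff_SucI [OF c])
      fix i assume i: "i < n"
      obtain D where D: "C_diff n l D"
        "\<forall>x\<in>Rn n. ((\<lambda>t. f (x(i := t))) has_real_derivative D x) (at (x i))"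
        using assms(1) i unfolding Suc by (rule C_diff_SucE)
      have "(\<lambda>t. f (x(i := t))) = (\<lambda>t. g (x(i := t)))" if "x \<in> Rn n" for x
        using eq Rn_upd [OF that i] by auto
      then show "\<exists>D. C_diff n l D \<and>
          (\<forall>x\<in>Rn n. ((\<lambda>t. g (x(i := t))) has_real_derivative D x) (at (x i)))"
        using D by (intro exI [of _ D]) auto
    qed
  qed
qed

lemma C_diff_Suc_imp: "C_diff n (Suc k) f \<Longrightarrow> C_diff n k f"
proof (induction k arbitrary: f)
  case (Suc k)
  show ?case
  proof (rule C_diff_SucI)
    fix i assume "i < n"
    with Suc.prems obtain D where "C_diff n (Suc k) D"
        "\<forall>x\<in>Rn n. ((\<lambda>t. f (x(i := t))) has_real_derivative D x) (at (x i))"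
      by (rule C_diff_SucE)
    then show "\<exists>D. C_diff n k D \<and>
          (\<forall>x\<in>Rn n. ((\<lambda>t. f (x(i := t))) has_real_derivative D x) (at (x i)))"
      using Suc.IH by blast
  qed (use Suc.prems in auto)
qed auto

lemma C_diff_const: "C_diff n k (\<lambda>x. c)"
proof (induction k arbitrary: c)
  case (Suc k)
  show ?case
    by (rule C_diff_SucI) (auto intro!: exI [of _ "\<lambda>x. 0"] Suc)
qed auto

lemma C_diff_proj: "C_diff n k (\<lambda>x. x i)"
proof -
  have c: "continuous_map (Euclidean_space n) euclideanreal (\<lambda>x. x i)"
    unfolding Euclidean_space_def
    by (rule continuous_map_from_subtopology) (rule continuous_map_product_projection [OF UNIV_I])
  show ?thesis
  proof (cases k)
    case (Suc l)
    show ?thesis unfolding Suc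
    proof (rule C_diff_SucI [OF c])
      fix j
      have "((\<lambda>t. (x(j := t)) i) has_real_derivative (if i = j then 1 else 0)) (at (x j))"
        for x :: "nat \<Rightarrow> real"
        by (cases "i = j") auto
      then show "\<exists>D. C_diff n l D \<and>
          (\<forall>x\<in>Rn n. ((\<lambda>t. (x(j := t)) i) has_real_derivative D x) (at (x j)))"
        by (intro exI [of _ "\<lambda>x. if i = j then 1 else 0"] conjI C_diff_const) auto
    qed
  qed (use c in auto)
qed

lemma C_diff_add: "C_diff n k f \<Longrightarrow> C_diff n k g \<Longrightarrow> C_diff n k (\<lambda>x. f x + g x)"
proof (induction k arbitrary: f g)
  case 0
  then show ?case by (simp add: continuous_map_add)
next
  case (Suc k)
  show ?case
  proof (rule C_diff_SucI)
    show "continuous_map (Euclidean_space n) euclideanreal (\<lambda>x. f x + g x)"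
      using Suc.prems by (simp add: continuous_map_add)
    fix i assume i: "i < n"
    from Suc.prems(1) i obtain D where D: "C_diff n k D"
      "\<forall>x\<in>Rn n. ((\<lambda>t. f (x(i := t))) has_real_derivative D x) (at (x i))"
      by (rule C_diff_SucE)
    from Suc.prems(2) i obtain E where E: "C_diff n k E"
      "\<forall>x\<in>Rn n. ((\<lambda>t. g (x(i := t))) has_real_derivative E x) (at (x i))"
      by (rule C_diff_SucE)
    show "\<exists>D. C_diff n k D \<and>
          (\<forall>x\<in>Rn n. ((\<lambda>t. f (x(i := t)) + g (x(i := t))) has_real_derivative D x) (at (x i)))"
      using D E by (intro exI [of _ "\<lambda>x. D x + E x"] conjI Suc.IH ballI DERIV_add) auto
  qed
qed

lemma C_diff_mult: "C_diff n k f \<Longrightarrow> C_diff n k g \<Longrightarrow> C_diff n k (\<lambda>x. f x * g x)"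
proof (induction k arbitrary: f g)
  case 0
  then show ?case by (simp add: continuous_map_real_mult)
next
  case (Suc k)
  show ?case
  proof (rule C_diff_SucI)
    show "continuous_map (Euclidean_space n) euclideanreal (\<lambda>x. f x * g x)"
      using Suc.prems by (simp add: continuous_map_real_mult)
    fix i assume i: "i < n"
    from Suc.prems(1) i obtain D where D: "C_diff n k D"
      "\<forall>x\<in>Rn n. ((\<lambda>t. f (x(i := t))) has_real_derivative D x) (at (x i))"
      by (rule C_diff_SucE)
    from Suc.prems(2) i obtain E where E: "C_diff n k E"
      "\<forall>x\<in>Rn n. ((\<lambda>t. g (x(i := t))) has_real_derivative E x) (at (x i))"
      by (rule C_diff_SucE)
    have "((\<lambda>t. f (x(i := t)) * g (x(i := t))) has_real_derivative D x * g x + E x * f x)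
           (at (x i))" if "x \<in> Rn n" for x
      using DERIV_mult [OF bspec [OF D(2) that] bspec [OF E(2) that]] by simp
    then show "\<exists>D. C_diff n k D \<and>
          (\<forall>x\<in>Rn n. ((\<lambda>t. f (x(i := t)) * g (x(i := t))) has_real_derivative D x) (at (x i)))"
      using D E Suc.prems
      by (intro exI [of _ "\<lambda>x. D x * g x + E x * f x"] conjI C_diff_add Suc.IH ballI)
         (auto intro: C_diff_Suc_imp simp del: C_diff.simps)
  qed
qed

lemma C_diff_inverse:
  assumes nz: "\<And>x. x \<in> Rn n \<Longrightarrow> f x \<noteq> 0"
  shows "C_diff n k f \<Longrightarrow> C_diff n k (\<lambda>x. inverse (f x))"
proof (induction k)
  case 0
  then show ?case using nz by (simp add: continuous_map_real_inverse)
next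
  case (Suc k)
  show ?case
  proof (rule C_diff_SucI)
    show "continuous_map (Euclidean_space n) euclideanreal (\<lambda>x. inverse (f x))"
      using Suc.prems nz by (simp add: continuous_map_real_inverse)
    fix i assume i: "i < n"
    from Suc.prems i obtain D where D: "C_diff n k D"
      "\<forall>x\<in>Rn n. ((\<lambda>t. f (x(i := t))) has_real_derivative D x) (at (x i))"
      by (rule C_diff_SucE)
    have IH: "C_diff n k (\<lambda>x. inverse (f x))"
      by (rule Suc.IH [OF C_diff_Suc_imp [OF Suc.prems]])
    have "((\<lambda>t. inverse (f (x(i := t)))) has_real_derivative
             - 1 * (D x * (inverse (f x) * inverse (f x)))) (at (x i))" if "x \<in> Rn n" for x
      using DERIV_inverse_fun [OF bspec [OF D(2) that]] nz [OF that]
      by (simp add: power2_eq_square power_inverse mult.assoc)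
    then show "\<exists>D. C_diff n k D \<and>
          (\<forall>x\<in>Rn n. ((\<lambda>t. inverse (f (x(i := t)))) has_real_derivative D x) (at (x i)))"
      using D IH
      by (intro exI [of _ "\<lambda>x. - 1 * (D x * (inverse (f x) * inverse (f x)))"] conjI
            C_diff_mult C_diff_const) auto
  qed
qed

lemma C_diff_compose_real:
  assumes D: "\<And>j t. (D j has_real_derivative D (Suc j) t) (at t)"
  shows "C_diff n k f \<Longrightarrow> C_diff n k (\<lambda>x. D j (f x))"
proof (induction k arbitrary: j)
  case 0
  have "continuous_on UNIV (D j)"
    using D by (meson DERIV_isCont continuous_at_imp_continuous_on)
  then show ?case
    using 0 continuous_map_compose [of "Euclidean_space n" euclideanreal f euclideanreal "D j"]
    by (simp add: o_def)
next
  case (Suc k)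
  show ?case
  proof (rule C_diff_SucI)
    have "continuous_on UNIV (D j)"
      using D by (meson DERIV_isCont continuous_at_imp_continuous_on)
    then show "continuous_map (Euclidean_space n) euclideanreal (\<lambda>x. D j (f x))"
      using Suc.prems continuous_map_compose [of "Euclidean_space n" euclideanreal f euclideanreal "D j"]
      by (simp add: o_def)
    fix i assume i: "i < n"
    from Suc.prems i obtain E where E: "C_diff n k E"
      "\<forall>x\<in>Rn n. ((\<lambda>t. f (x(i := t))) has_real_derivative E x) (at (x i))"
      by (rule C_diff_SucE)
    have "((\<lambda>t. D j (f (x(i := t)))) has_real_derivative D (Suc j) (f x) * E x) (at (x i))"
      if "x \<in> Rn n" for x
      using DERIV_chain2 [OF D bspec [OF E(2) that], of j] by simp
    then show "\<exists>E. C_diff n k E \<and>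
          (\<forall>x\<in>Rn n. ((\<lambda>t. D j (f (x(i := t)))) has_real_derivative E x) (at (x i)))"
      using E Suc.IH [OF C_diff_Suc_imp [OF Suc.prems]]
      by (intro exI [of _ "\<lambda>x. D (Suc j) (f x) * E x"] conjI C_diff_mult) auto
  qed
qed

definition smooth :: "nat \<Rightarrow> rfun \<Rightarrow> bool"
  where "smooth n f \<longleftrightarrow> (\<forall>k. C_diff n k f)"

lemma smooth_const: "smooth n (\<lambda>x. c)"
  and smooth_proj: "smooth n (\<lambda>x. x i)"
  and smooth_add: "smooth n f \<Longrightarrow> smooth n g \<Longrightarrow> smooth n (\<lambda>x. f x + g x)"
  and smooth_mult: "smooth n f \<Longrightarrow> smooth n g \<Longrightarrow> smooth n (\<lambda>x. f x * g x)"
  and smooth_inverse: "smooth n f \<Longrightarrow> (\<And>x. x \<in> Rn n \<Longrightarrow> f x \<noteq> 0) \<Longrightarrow> smooth n (\<lambda>x. inverse (f x))"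
  by (simp_all add: smooth_def C_diff_const C_diff_proj C_diff_add C_diff_mult C_diff_inverse)

lemma smooth_diff: "smooth n f \<Longrightarrow> smooth n g \<Longrightarrow> smooth n (\<lambda>x. f x - g x)"
  using smooth_add [OF _ smooth_mult [OF smooth_const [of n "-1"]], of f g] by simp

lemma smooth_uminus: "smooth n f \<Longrightarrow> smooth n (\<lambda>x. - f x)"
  using smooth_diff [OF smooth_const [of n 0], of f] by simp

lemma smooth_power2: "smooth n f \<Longrightarrow> smooth n (\<lambda>x. (f x)\<^sup>2)"
  by (simp add: power2_eq_square smooth_mult)

lemma smooth_sum:
  "(\<And>i. i \<in> I \<Longrightarrow> smooth n (f i)) \<Longrightarrow> smooth n (\<lambda>x. \<Sum>i\<in>I. f i x)"
  by (induction I rule: infinite_finite_induct) (auto intro: smooth_const smooth_add)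

lemma restrict_Cinf: "smooth n f \<Longrightarrow> restrict f (Rn n) \<in> Cinf n"
  by (auto simp: smooth_def Cinf_def simp del: C_diff.simps intro: C_diff_cong [of n _ f])

lemma Cinf_smooth: "f \<in> Cinf n \<Longrightarrow> smooth n f"
  by (simp add: smooth_def Cinf_def)

lemma Cinf_restrict: "f \<in> Cinf n \<Longrightarrow> restrict f (Rn n) = f"
  by (auto simp: Cinf_def extensional_restrict)

text \<open>
  The functions \<open>p (1 / t) * exp (- 1 / t)\<close> on \<open>t > 0\<close>, extended by \<open>0\<close>: a family closed under
  differentiation, which contains the classical flat function \<open>exp (- 1 / t)\<close>.
\<close>

definition flat_poly :: "real poly \<Rightarrow> real \<Rightarrow> real"
  where "flat_poly p t = (if t \<le> 0 then 0 else poly p (inverse t) * exp (- inverse t))"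

lemma poly_exp_tendsto_0: "((\<lambda>x. poly p x * exp (- x)) \<longlongrightarrow> (0 :: real)) at_top"
proof -
  have "((\<lambda>x. \<Sum>i\<le>Polynomial.degree p. Polynomial.coeff p i * (x ^ i / exp x)) \<longlongrightarrow> (\<Sum>i\<le>Polynomial.degree p. Polynomial.coeff p i * 0)) at_top"
    by (intro tendsto_intros tendsto_power_div_exp_0)
  moreover have "(\<Sum>i\<le>Polynomial.degree p. Polynomial.coeff p i * (x ^ i / exp x)) = poly p x * exp (- x)" for x
    by (simp add: poly_altdef exp_minus sum_distrib_right divide_inverse mult.assoc)
  ultimately show ?thesis by simp
qed

lemma flat_poly_deriv:
  "(flat_poly p has_real_derivative flat_poly ([:0, 0, 1:] * (p - pderiv p)) t) (at t)"
proof -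
  consider "t < 0" | "t > 0" | "t = 0" by linarith
  then show ?thesis
  proof cases
    case 1
    have "\<forall>\<^sub>F s in nhds t. 0 = flat_poly p s"
      using eventually_nhds_in_open [of "{..<0}" t] 1
      by (auto elim!: eventually_mono simp: flat_poly_def)
    then have "(flat_poly p has_real_derivative 0) (at t)"
      using DERIV_const by (rule DERIV_cong_ev [OF refl _ refl, THEN iffD1])
    then show ?thesis
      using 1 by (simp add: flat_poly_def)
  next
    case 2
    have "((\<lambda>t. poly p (inverse t) * exp (- inverse t)) has_real_derivative
        (poly (pderiv p) (inverse t) * - (inverse t)\<^sup>2) * exp (- inverse t) +
         exp (- inverse t) * (inverse t)\<^sup>2 * poly p (inverse t)) (at t)"
      using 2 by (auto intro!: derivative_eq_intros DERIV_chain2 [OF poly_DERIV]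
          simp: power2_eq_square field_simps)
    moreover have "\<forall>\<^sub>F s in nhds t. poly p (inverse s) * exp (- inverse s) = flat_poly p s"
      using eventually_nhds_in_open [of "{0<..}" t] 2
      by (auto elim!: eventually_mono simp: flat_poly_def)
    ultimately have "(flat_poly p has_real_derivative
        (poly (pderiv p) (inverse t) * - (inverse t)\<^sup>2) * exp (- inverse t) +
         exp (- inverse t) * (inverse t)\<^sup>2 * poly p (inverse t)) (at t)"
      using DERIV_cong_ev [OF refl _ refl, where f = "\<lambda>s. poly p (inverse s) * exp (- inverse s)" and g = "flat_poly p" and x = t]
      by simp
    then show ?thesis
      using 2 by (simp add: flat_poly_def power2_eq_square algebra_simps)
  next
    case 3
    \<comment> \<open>The difference quotient at \<open>0\<close> has the same form, with \<open>p\<close> multiplied by the variable.\<close>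
    have "((\<lambda>t. poly (pCons 0 p) (inverse t) * exp (- inverse t)) \<longlongrightarrow> 0) (at_right 0)"
      using filterlim_compose [OF poly_exp_tendsto_0 filterlim_inverse_at_top_right] .
    then have "((\<lambda>t. flat_poly p t / t) \<longlongrightarrow> 0) (at_right 0)"
      by (rule tendsto_cong [THEN iffD1, rotated])
         (auto simp: eventually_at_filter flat_poly_def divide_inverse mult_ac)
    moreover have "((\<lambda>t. flat_poly p t / t) \<longlongrightarrow> 0) (at_left 0)"
      by (rule tendsto_cong [THEN iffD1, OF _ tendsto_const])
         (auto simp: eventually_at_filter flat_poly_def)
    ultimately have "((\<lambda>t. flat_poly p t / t) \<longlongrightarrow> 0) (at 0)"
      by (simp add: filterlim_split_at)
    then show ?thesis
      using 3 by (simp add: has_field_derivative_iff flat_poly_def)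
  qed
qed

definition flat :: "real \<Rightarrow> real"
  where "flat t = (if t \<le> 0 then 0 else exp (- inverse t))"

lemma flat_eq_0_iff: "flat t = 0 \<longleftrightarrow> t \<le> 0"
  and flat_nonneg: "flat t \<ge> 0"
  by (auto simp: flat_def)

lemma smooth_flat:
  assumes "smooth n f"
  shows "smooth n (\<lambda>x. flat (f x))"
proof -
  define D where "D = (\<lambda>j. flat_poly (((\<lambda>p. [:0, 0, 1:] * (p - pderiv p)) ^^ j) 1))"
  have "(D j has_real_derivative D (Suc j) t) (at t)" for j t
    unfolding D_def using flat_poly_deriv by simp
  moreover have "flat = D 0"
    by (auto simp: D_def flat_def flat_poly_def)
  ultimately show ?thesis
    using assms C_diff_compose_real [of D n _ f 0] by (simp add: smooth_def)
qed

section \<open>Algebra in \<open>C\<^sup>\<infinity>\<close>-rings\<close>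

text \<open>
  The elements of \<open>Cinf n\<close> are undefined outside \<open>\<real>\<^sup>n\<close>.  Restricting first lets every smooth
  \<open>\<lambda>\<close>-term act, so that operations can be combined by writing down formulas.
\<close>

definition smooth_op :: "('a, 'm) cring_inf_scheme \<Rightarrow> nat \<Rightarrow> rfun \<Rightarrow> (nat \<Rightarrow> 'a) \<Rightarrow> 'a"
  where "smooth_op A n f a = cop A n (restrict f (Rn n)) a"

lemma smooth_op_cong:
  "(\<And>x. x \<in> Rn n \<Longrightarrow> f x = g x) \<Longrightarrow> smooth_op A n f a = smooth_op A n g a"
  using restrict_ext [of "Rn n" f g] by (simp add: smooth_op_def)

lemma cop_smooth_op: "f \<in> Cinf n \<Longrightarrow> cop A n f a = smooth_op A n f a"
  by (simp add: smooth_op_def Cinf_restrict)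

lemma Cinf_ringI:
  assumes "\<And>n f a. f \<in> Cinf n \<Longrightarrow> a \<in> {..<n} \<rightarrow>\<^sub>E carrier A \<Longrightarrow> cop A n f a \<in> carrier A"
    and "\<And>n i a. i < n \<Longrightarrow> a \<in> {..<n} \<rightarrow>\<^sub>E carrier A \<Longrightarrow> cop A n (\<lambda>x\<in>Rn n. x i) a = a i"
    and "\<And>n m f g a. f \<in> Cinf m \<Longrightarrow> (\<And>j. j < m \<Longrightarrow> g j \<in> Cinf n) \<Longrightarrow> a \<in> {..<n} \<rightarrow>\<^sub>E carrier A \<Longrightarrow>
           cop A n (scomp n m f g) a = cop A m f (\<lambda>j\<in>{..<m}. cop A n (g j) a)"
  shows "Cinf_ring A"
  unfolding Cinf_ring_def using assms by (intro conjI allI ballI impI funcsetI) (auto simp: Pi_iff)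

lemma cop_closed:
  "Cinf_ring A \<Longrightarrow> f \<in> Cinf n \<Longrightarrow> a \<in> {..<n} \<rightarrow>\<^sub>E carrier A \<Longrightarrow> cop A n f a \<in> carrier A"
  by (auto simp: Cinf_ring_def)

lemma cop_scomp:
  "Cinf_ring A \<Longrightarrow> f \<in> Cinf m \<Longrightarrow> (\<And>j. j < m \<Longrightarrow> g j \<in> Cinf n) \<Longrightarrow> a \<in> {..<n} \<rightarrow>\<^sub>E carrier A \<Longrightarrow>
    cop A n (scomp n m f g) a = cop A m f (\<lambda>j\<in>{..<m}. cop A n (g j) a)"
  by (auto simp: Cinf_ring_def)

lemma smooth_op_closed:
  "Cinf_ring A \<Longrightarrow> smooth n f \<Longrightarrow> a \<in> {..<n} \<rightarrow>\<^sub>E carrier A \<Longrightarrow> smooth_op A n f a \<in> carrier A"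
  by (simp add: smooth_op_def cop_closed restrict_Cinf)

lemma smooth_op_proj:
  "Cinf_ring A \<Longrightarrow> i < n \<Longrightarrow> a \<in> {..<n} \<rightarrow>\<^sub>E carrier A \<Longrightarrow> smooth_op A n (\<lambda>x. x i) a = a i"
  by (auto simp: smooth_op_def Cinf_ring_def)

lemma smooth_op_scomp:
  assumes "Cinf_ring A" "smooth m f" "\<And>j. j < m \<Longrightarrow> smooth n (g j)" "a \<in> {..<n} \<rightarrow>\<^sub>E carrier A"
    and h: "\<And>x. x \<in> Rn n \<Longrightarrow> h x = f (\<lambda>j. if j < m then g j x else 0)"
  shows "smooth_op A m f (\<lambda>j\<in>{..<m}. smooth_op A n (g j) a) = smooth_op A n h a"
proof -
  have "scomp n m (restrict f (Rn m)) (\<lambda>j. restrict (g j) (Rn n)) = restrict h (Rn n)"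
  proof
    fix x
    have "(\<lambda>j. if j < m then g j x else 0) \<in> Rn m"
      by (auto simp: Rn_iff)
    then show "scomp n m (restrict f (Rn m)) (\<lambda>j. restrict (g j) (Rn n)) x = restrict h (Rn n) x"
      by (cases "x \<in> Rn n") (simp_all add: scomp_def h cong: if_cong)
  qed
  then show ?thesis
    using cop_scomp [of A "restrict f (Rn m)" m "\<lambda>j. restrict (g j) (Rn n)" n a] assms
    by (simp add: smooth_op_def restrict_Cinf)
qed

lemma pair_fun_simps [simp]: "pair_fun a b 0 = a" "pair_fun a b (Suc 0) = b"
  by (simp_all add: pair_fun_def)

lemma pair_fun_eq: "(\<lambda>i\<in>{..<2}. h (pair_fun a b i)) = pair_fun (h a) (h b)"
  by (auto simp: pair_fun_def)

lemma pair_fun_closed: "a \<in> S \<Longrightarrow> b \<in> S \<Longrightarrow> pair_fun a b \<in> {..<2} \<rightarrow>\<^sub>E S"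
  by (auto simp: pair_fun_def)

lemma carrier_underlying [simp]: "carrier (underlying_ring A) = carrier A"
  and one_underlying: "\<one>\<^bsub>underlying_ring A\<^esub> = const_elt A 1"
  and zero_underlying: "\<zero>\<^bsub>underlying_ring A\<^esub> = const_elt A 0"
  and mult_underlying: "a \<otimes>\<^bsub>underlying_ring A\<^esub> b = smooth_op A 2 (\<lambda>x. x 0 * x 1) (pair_fun a b)"
  and add_underlying: "a \<oplus>\<^bsub>underlying_ring A\<^esub> b = smooth_op A 2 (\<lambda>x. x 0 + x 1) (pair_fun a b)"
  by (simp_all add: underlying_ring_def smooth_op_def)

lemma pair_fun_smooth_op:
  "pair_fun (smooth_op A n f a) (smooth_op A n g a) =
    (\<lambda>j\<in>{..<2}. smooth_op A n (if j = 0 then f else g) a)"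
  by (auto simp: pair_fun_def)

lemma smooth_op_add:
  assumes "Cinf_ring A" "smooth n f" "smooth n g" "a \<in> {..<n} \<rightarrow>\<^sub>E carrier A"
  shows "smooth_op A n f a \<oplus>\<^bsub>underlying_ring A\<^esub> smooth_op A n g a = smooth_op A n (\<lambda>x. f x + g x) a"
  unfolding add_underlying pair_fun_smooth_op
  by (rule smooth_op_scomp) (use assms in \<open>simp_all add: smooth_add smooth_proj\<close>)

lemma smooth_op_mult:
  assumes "Cinf_ring A" "smooth n f" "smooth n g" "a \<in> {..<n} \<rightarrow>\<^sub>E carrier A"
  shows "smooth_op A n f a \<otimes>\<^bsub>underlying_ring A\<^esub> smooth_op A n g a = smooth_op A n (\<lambda>x. f x * g x) a"
  unfolding mult_underlying pair_fun_smooth_op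
  by (rule smooth_op_scomp) (use assms in \<open>simp_all add: smooth_mult smooth_proj\<close>)

lemma const_elt_smooth_op:
  assumes "Cinf_ring A" "a \<in> {..<n} \<rightarrow>\<^sub>E carrier A"
  shows "const_elt A c = smooth_op A n (\<lambda>x. c) a"
proof -
  have "smooth_op A 0 (\<lambda>x. c) (\<lambda>j\<in>{..<0}. smooth_op A n (\<lambda>x. c) a) = smooth_op A n (\<lambda>x. c) a"
    using assms by (intro smooth_op_scomp) (simp_all add: smooth_const)
  then show ?thesis
    by (simp add: const_elt_def smooth_op_def restrict_def)
qed

lemma const_elt_closed: "Cinf_ring A \<Longrightarrow> const_elt A c \<in> carrier A"
  using const_elt_smooth_op [of A "\<lambda>_. undefined" 0 c]
    smooth_op_closed [OF _ smooth_const, of A "\<lambda>_. undefined" 0 c]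
  by simp

text \<open>
  Three elements are the values of the coordinates at one tuple, so a ring law in \<open>A\<close> is the value
  at that tuple of the same law between functions on \<open>\<real>\<^sup>3\<close>.
\<close>

lemma smooth_op_triple:
  assumes "Cinf_ring A" "a \<in> carrier A" "b \<in> carrier A" "c \<in> carrier A"
  obtains t where "t \<in> {..<3} \<rightarrow>\<^sub>E carrier A" "a = smooth_op A 3 (\<lambda>x. x 0) t"
    "b = smooth_op A 3 (\<lambda>x. x 1) t" "c = smooth_op A 3 (\<lambda>x. x 2) t"
proof
  let ?t = "\<lambda>i\<in>{..<3}. if i = 0 then a else if i = 1 then b else c"
  show t: "?t \<in> {..<3} \<rightarrow>\<^sub>E carrier A"
    using assms by auto
  show "a = smooth_op A 3 (\<lambda>x. x 0) ?t" "b = smooth_op A 3 (\<lambda>x. x 1) ?t" "c = smooth_op A 3 (\<lambda>x. x 2) ?t"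
    using smooth_op_proj [OF assms(1) _ t, of 0] smooth_op_proj [OF assms(1) _ t, of 1]
      smooth_op_proj [OF assms(1) _ t, of 2] by simp_all
qed

lemma cring_underlying:
  assumes A: "Cinf_ring A"
  shows "cring (underlying_ring A)"
proof -
  let ?R = "underlying_ring A"
  note s = smooth_const smooth_proj smooth_uminus smooth_add smooth_mult smooth_op_add [OF A] smooth_op_mult [OF A]
  have c: "\<zero>\<^bsub>?R\<^esub> \<in> carrier A" "\<one>\<^bsub>?R\<^esub> \<in> carrier A"
    by (simp_all add: zero_underlying one_underlying const_elt_closed A)
  have op: "x \<oplus>\<^bsub>?R\<^esub> y \<in> carrier A" "x \<otimes>\<^bsub>?R\<^esub> y \<in> carrier A"
    if "x \<in> carrier A" "y \<in> carrier A" for x y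
    unfolding add_underlying mult_underlying using A that
    by (auto intro!: smooth_op_closed pair_fun_closed smooth_add smooth_mult smooth_proj)
  have laws: "(x \<oplus>\<^bsub>?R\<^esub> y) \<oplus>\<^bsub>?R\<^esub> z = x \<oplus>\<^bsub>?R\<^esub> (y \<oplus>\<^bsub>?R\<^esub> z) \<and> x \<oplus>\<^bsub>?R\<^esub> y = y \<oplus>\<^bsub>?R\<^esub> x \<and>
      \<zero>\<^bsub>?R\<^esub> \<oplus>\<^bsub>?R\<^esub> x = x \<and> (\<exists>w\<in>carrier A. w \<oplus>\<^bsub>?R\<^esub> x = \<zero>\<^bsub>?R\<^esub>) \<and>
      (x \<otimes>\<^bsub>?R\<^esub> y) \<otimes>\<^bsub>?R\<^esub> z = x \<otimes>\<^bsub>?R\<^esub> (y \<otimes>\<^bsub>?R\<^esub> z) \<and> \<one>\<^bsub>?R\<^esub> \<otimes>\<^bsub>?R\<^esub> x = x \<and>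
      x \<otimes>\<^bsub>?R\<^esub> y = y \<otimes>\<^bsub>?R\<^esub> x \<and> (x \<oplus>\<^bsub>?R\<^esub> y) \<otimes>\<^bsub>?R\<^esub> z = x \<otimes>\<^bsub>?R\<^esub> z \<oplus>\<^bsub>?R\<^esub> y \<otimes>\<^bsub>?R\<^esub> z"
    if xyz: "x \<in> carrier A" "y \<in> carrier A" "z \<in> carrier A" for x y z
  proof -
    obtain t where t: "t \<in> {..<3} \<rightarrow>\<^sub>E carrier A"
      and e: "x = smooth_op A 3 (\<lambda>x. x 0) t" "y = smooth_op A 3 (\<lambda>x. x 1) t" "z = smooth_op A 3 (\<lambda>x. x 2) t"
      using smooth_op_triple [OF A xyz] by blast
    have w: "smooth_op A 3 (\<lambda>x. - x 0) t \<in> carrier A"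
      by (intro smooth_op_closed A t s)
    show ?thesis
      unfolding zero_underlying one_underlying const_elt_smooth_op [OF A t] e
      by (intro conjI bexI [OF _ w]) (simp_all add: s t algebra_simps)
  qed
  show ?thesis
  proof (intro cringI abelian_groupI comm_monoidI, unfold carrier_underlying)
  qed ((use c op in \<open>simp; fail\<close>) | (use laws in blast))+
qed

lemma underlying_closed:
  assumes A: "Cinf_ring A" and "a \<in> carrier A" "b \<in> carrier A"
  shows "a \<oplus>\<^bsub>underlying_ring A\<^esub> b \<in> carrier A" "a \<otimes>\<^bsub>underlying_ring A\<^esub> b \<in> carrier A"
    "a \<ominus>\<^bsub>underlying_ring A\<^esub> b \<in> carrier A" "\<ominus>\<^bsub>underlying_ring A\<^esub> a \<in> carrier A"
proof -
  interpret cring "underlying_ring A" by (rule cring_underlying [OF A])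
  show "a \<oplus>\<^bsub>underlying_ring A\<^esub> b \<in> carrier A" "a \<otimes>\<^bsub>underlying_ring A\<^esub> b \<in> carrier A"
    "a \<ominus>\<^bsub>underlying_ring A\<^esub> b \<in> carrier A" "\<ominus>\<^bsub>underlying_ring A\<^esub> a \<in> carrier A"
    using assms(2,3) add.m_closed m_closed minus_closed a_inv_closed by simp_all
qed

lemma underlying_zero_one_closed:
  "Cinf_ring A \<Longrightarrow> \<zero>\<^bsub>underlying_ring A\<^esub> \<in> carrier A"
  "Cinf_ring A \<Longrightarrow> \<one>\<^bsub>underlying_ring A\<^esub> \<in> carrier A"
  by (simp_all add: zero_underlying one_underlying const_elt_closed)

lemma smooth_op_minus:
  assumes A: "Cinf_ring A" and "smooth n f" "smooth n g" and a: "a \<in> {..<n} \<rightarrow>\<^sub>E carrier A"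
  shows "smooth_op A n f a \<ominus>\<^bsub>underlying_ring A\<^esub> smooth_op A n g a = smooth_op A n (\<lambda>x. f x - g x) a"
proof -
  interpret cring "underlying_ring A" by (rule cring_underlying [OF A])
  have "smooth_op A n (\<lambda>x. f x - g x) a \<oplus>\<^bsub>underlying_ring A\<^esub> smooth_op A n g a = smooth_op A n f a"
    using assms by (simp add: smooth_op_add smooth_diff)
  then show ?thesis
    using assms smooth_op_closed [OF A smooth_diff _, of n f g a] smooth_op_closed [OF A _ a]
    by (metis (no_types, lifting) a_minus_def add.inv_closed add.m_assoc carrier_underlying r_neg r_zero)
qed

subsection \<open>Homomorphisms\<close>

lemma Cinf_homI:
  assumes "\<And>a. a \<in> carrier A \<Longrightarrow> h a \<in> carrier B"
    and "\<And>n f a. f \<in> Cinf n \<Longrightarrow> a \<in> {..<n} \<rightarrow>\<^sub>E carrier A \<Longrightarrow>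
           h (cop A n f a) = cop B n f (\<lambda>i\<in>{..<n}. h (a i))"
  shows "h \<in> Cinf_hom A B"
  unfolding Cinf_hom_def using assms by (intro CollectI conjI allI ballI funcsetI)

lemma Cinf_hom_closed: "h \<in> Cinf_hom A B \<Longrightarrow> a \<in> carrier A \<Longrightarrow> h a \<in> carrier B"
  by (auto simp: Cinf_hom_def)

lemma Cinf_hom_cop:
  "h \<in> Cinf_hom A B \<Longrightarrow> f \<in> Cinf n \<Longrightarrow> a \<in> {..<n} \<rightarrow>\<^sub>E carrier A \<Longrightarrow>
    h (cop A n f a) = cop B n f (\<lambda>i\<in>{..<n}. h (a i))"
  by (auto simp: Cinf_hom_def)

lemma Cinf_hom_smooth_op:
  "h \<in> Cinf_hom A B \<Longrightarrow> smooth n f \<Longrightarrow> a \<in> {..<n} \<rightarrow>\<^sub>E carrier A \<Longrightarrow>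
    h (smooth_op A n f a) = smooth_op B n f (\<lambda>i\<in>{..<n}. h (a i))"
  by (auto simp: smooth_op_def Cinf_hom_cop restrict_Cinf)

lemma restrict_empty: "restrict f {} = (\<lambda>_. undefined)"
  by (simp add: restrict_def)

lemma Cinf_hom_const: "h \<in> Cinf_hom A B \<Longrightarrow> h (const_elt A c) = const_elt B c"
  using Cinf_hom_cop [of h A B "\<lambda>x\<in>Rn 0. c" 0 "\<lambda>_. undefined"] restrict_Cinf [OF smooth_const [of 0 c]]
  by (simp add: const_elt_def restrict_empty)

lemma Cinf_hom_ring_hom:
  assumes "Cinf_ring A" "Cinf_ring B" "h \<in> Cinf_hom A B"
  shows "ring_hom_cring (underlying_ring A) (underlying_ring B) h"
proof (intro ring_hom_cringI ring_hom_memI cring_underlying assms)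
qed (use assms in \<open>auto simp: Cinf_hom_closed one_underlying Cinf_hom_const mult_underlying add_underlying
       Cinf_hom_smooth_op pair_fun_closed smooth_add smooth_mult smooth_proj pair_fun_eq\<close>)

lemma Cinf_hom_Units:
  assumes "Cinf_ring A" "Cinf_ring B" "h \<in> Cinf_hom A B" "a \<in> Units (underlying_ring A)"
  shows "h a \<in> Units (underlying_ring B)"
proof -
  interpret ring_hom_cring "underlying_ring A" "underlying_ring B" h
    by (rule Cinf_hom_ring_hom) fact+
  show ?thesis
  proof -
    from assms(4) obtain b where b: "a \<in> carrier A" "b \<in> carrier A"
      "b \<otimes>\<^bsub>underlying_ring A\<^esub> a = \<one>\<^bsub>underlying_ring A\<^esub>" "a \<otimes>\<^bsub>underlying_ring A\<^esub> b = \<one>\<^bsub>underlying_ring A\<^esub>"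
      by (auto simp: Units_def)
    have "h b \<otimes>\<^bsub>underlying_ring B\<^esub> h a = \<one>\<^bsub>underlying_ring B\<^esub>" "h a \<otimes>\<^bsub>underlying_ring B\<^esub> h b = \<one>\<^bsub>underlying_ring B\<^esub>"
      using b hom_mult [of b a] hom_mult [of a b] hom_one by simp_all
    then show ?thesis
      using b Cinf_hom_closed [OF assms(3)] by (auto simp: Units_def)
  qed
qed

subsection \<open>Residues in local \<open>C\<^sup>\<infinity>\<close>-rings\<close>

text \<open>
  Krull's theorem: Zorn's lemma applies to the ideals that contain \<open>a\<close> but not \<open>1\<close>, and the
  principal ideal of a non-unit is one of them.
\<close>

lemma (in cring) nonunit_in_maximalideal:
  assumes a: "a \<in> carrier R" "a \<notin> Units R"
  shows "\<exists>M. maximalideal M R \<and> a \<in> M"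
proof -
  define \<A> where "\<A> = {I. ideal I R \<and> a \<in> I \<and> \<one> \<notin> I}"
  have "\<one> \<notin> PIdl a"
    using a by (auto simp: cgenideal_def Units_def m_comm)
  then have "PIdl a \<in> \<A>"
    using a by (simp add: \<A>_def cgenideal_ideal cgenideal_self)
  moreover have "\<Union>\<C> \<in> \<A>" if "\<C> \<noteq> {}" "subset.chain \<A> \<C>" for \<C>
  proof -
    have "subset.chain {I. ideal I R} \<C>"
      using that by (auto simp: \<A>_def subset_chain_def)
    from chain_Union_is_ideal [OF this] that show ?thesis
      by (auto simp: \<A>_def subset_chain_def)
  qed
  ultimately obtain M where M: "M \<in> \<A>" "\<forall>I\<in>\<A>. M \<subseteq> I \<longrightarrow> I = M"
    using subset_Zorn_nonempty [of \<A>] by blast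
  have "maximalideal M R"
  proof (rule maximalidealI)
    show "ideal M R" "carrier R \<noteq> M"
      using M by (auto simp: \<A>_def)
    fix J assume "ideal J R" "M \<subseteq> J" "J \<subseteq> carrier R"
    then show "J = M \<or> J = carrier R"
      using M ideal.one_imp_carrier [of J R] by (auto simp: \<A>_def)
  qed
  with M show ?thesis by (auto simp: \<A>_def)
qed

lemma (in cring) maximalideal_no_units: "maximalideal M R \<Longrightarrow> a \<in> M \<Longrightarrow> a \<notin> Units R"
  by (metis ideal.I_l_closed ideal.one_imp_carrier maximalideal.I_notcarr maximalideal_def
      Units_inv_closed Units_l_inv)

lemma (in ring) minus_minus_cancel:
  assumes "a \<in> carrier R" "b \<in> carrier R" "c \<in> carrier R"
  shows "(a \<ominus> b) \<ominus> (a \<ominus> c) = c \<ominus> b"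
  using assms by algebra

text \<open>
  In a local \<open>C\<^sup>\<infinity>\<close>-ring this is the image of \<open>a\<close> in the residue field \<open>\<real>\<close>.  It is expressed by units
  alone because units, unlike the maximal ideal, are visibly preserved by homomorphisms.
\<close>

definition residue :: "('a, 'm) cring_inf_scheme \<Rightarrow> 'a \<Rightarrow> real"
  where "residue A a = (THE c. a \<ominus>\<^bsub>underlying_ring A\<^esub> const_elt A c \<notin> Units (underlying_ring A))"

text \<open>
  The non-units of a local ring are its maximal ideal, and reduction modulo this ideal is an
  isomorphism of the residue field with \<open>\<real>\<close> that fixes the constants; hence every element is
  congruent to the constant with the same image.
\<close>

lemma local_Cinf_nonunits:
  assumes A: "Cinf_ring A" and "local_Cinf A"
  obtains M where "maximalideal M (underlying_ring A)"
    "\<And>a. a \<in> carrier A \<Longrightarrow> a \<in> M \<longleftrightarrow> a \<notin> Units (underlying_ring A)"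
    "\<And>a. a \<in> carrier A \<Longrightarrow> \<exists>c. a \<ominus>\<^bsub>underlying_ring A\<^esub> const_elt A c \<in> M"
proof -
  let ?R = "underlying_ring A"
  interpret cring ?R by (rule cring_underlying [OF A])
  obtain M h where M: "maximalideal M ?R" "\<And>M'. maximalideal M' ?R \<Longrightarrow> M' = M"
    and h: "h \<in> Cinf_hom (quot_Cinf A M) real_Cinf"
    and bij: "bij_betw h (carrier (quot_Cinf A M)) (carrier real_Cinf)"
    using assms(2) unfolding local_Cinf_def Cinf_isomorphic_def by blast
  have id: "ideal M ?R"
    using M(1) by (simp add: maximalideal_def)
  have coset: "M +>\<^bsub>?R\<^esub> a \<in> carrier (quot_Cinf A M)" if "a \<in> carrier A" for a
    using that id by (auto simp: quot_Cinf_def A_RCOSETS_def' )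
  have const: "h (M +>\<^bsub>?R\<^esub> const_elt A c) = c" for c
    using Cinf_hom_cop [OF h restrict_Cinf [OF smooth_const [of 0 c]], of "\<lambda>_. undefined"]
    by (simp add: quot_Cinf_def real_Cinf_def const_elt_def Rn_iff restrict_empty)
  have ex: "\<exists>c. a \<ominus>\<^bsub>?R\<^esub> const_elt A c \<in> M" if a: "a \<in> carrier A" for a
  proof -
    define c where "c = h (M +>\<^bsub>?R\<^esub> a)"
    have "M +>\<^bsub>?R\<^esub> a = M +>\<^bsub>?R\<^esub> const_elt A c"
      using bij_betw_imp_inj_on [OF bij] coset [OF a] coset [OF const_elt_closed [OF A, of c]] const [of c]
      unfolding c_def by (metis inj_onD)
    then show ?thesis
      using quotient_eq_iff_same_a_r_cos [OF id, of a "const_elt A c"] a const_elt_closed [OF A] by auto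
  qed
  show ?thesis
  proof (rule that [OF M(1)])
    fix a assume "a \<in> carrier A"
    then have "a \<notin> Units ?R \<Longrightarrow> \<exists>M'. maximalideal M' ?R \<and> a \<in> M'"
      using nonunit_in_maximalideal [of a] by simp
    then show "a \<in> M \<longleftrightarrow> a \<notin> Units ?R"
      using M(2) maximalideal_no_units [OF M(1)] by metis
  qed (rule ex)
qed

text \<open>
  Two constants congruent to \<open>a\<close> differ by a non-unit, and the only constant that is not a unit is \<open>0\<close>.
\<close>

lemma residueI:
  assumes A: "Cinf_ring A" "local_Cinf A" and a: "a \<in> carrier A"
    and c: "a \<ominus>\<^bsub>underlying_ring A\<^esub> const_elt A c \<notin> Units (underlying_ring A)"
  shows "residue A a = c"
  unfolding residue_def
proof (rule the_equality [of _ c])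
  show "a \<ominus>\<^bsub>underlying_ring A\<^esub> const_elt A c \<notin> Units (underlying_ring A)" by fact
next
  fix d
  assume d: "a \<ominus>\<^bsub>underlying_ring A\<^esub> const_elt A d \<notin> Units (underlying_ring A)"
  let ?R = "underlying_ring A"
  interpret cring ?R by (rule cring_underlying [OF A(1)])
  obtain M where M: "maximalideal M ?R" "\<And>a. a \<in> carrier A \<Longrightarrow> a \<in> M \<longleftrightarrow> a \<notin> Units ?R"
    using local_Cinf_nonunits [OF A] by metis
  interpret M: ideal M ?R
    using M(1) by (simp add: maximalideal_def)
  note k = const_elt_closed [OF A(1)]
  have "a \<ominus>\<^bsub>?R\<^esub> const_elt A c \<in> M" "a \<ominus>\<^bsub>?R\<^esub> const_elt A d \<in> M"
    by (intro iffD2 [OF M(2)] underlying_closed(3) k A a c d)+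
  moreover have "x \<ominus>\<^bsub>?R\<^esub> y \<in> M" if "x \<in> M" "y \<in> M" for x y
    unfolding a_minus_def by (intro M.a_closed M.a_inv_closed that)
  ultimately have "(a \<ominus>\<^bsub>?R\<^esub> const_elt A c) \<ominus>\<^bsub>?R\<^esub> (a \<ominus>\<^bsub>?R\<^esub> const_elt A d) \<in> M"
    by blast
  also have "(a \<ominus>\<^bsub>?R\<^esub> const_elt A c) \<ominus>\<^bsub>?R\<^esub> (a \<ominus>\<^bsub>?R\<^esub> const_elt A d) = const_elt A d \<ominus>\<^bsub>?R\<^esub> const_elt A c"
    using minus_minus_cancel [of a "const_elt A c" "const_elt A d"] a k by simp
  also have "\<dots> = const_elt A (d - c)"
    using const_elt_smooth_op [OF A(1), of "\<lambda>_. undefined" 0]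
      smooth_op_minus [OF A(1) smooth_const smooth_const, of "\<lambda>_. undefined" 0 d c] by simp
  finally have "const_elt A (d - c) \<notin> Units ?R"
    using M(2) k by simp
  moreover have "const_elt A e \<in> Units ?R" if "e \<noteq> 0" for e
  proof -
    have "const_elt A e \<otimes>\<^bsub>?R\<^esub> const_elt A (inverse e) = \<one>\<^bsub>?R\<^esub>"
      using const_elt_smooth_op [OF A(1), of "\<lambda>_. undefined" 0] that
        smooth_op_mult [OF A(1) smooth_const smooth_const, of "\<lambda>_. undefined" 0 e "inverse e"]
      by (simp add: one_underlying)
    then show ?thesis
      using k by (auto simp: Units_def m_comm intro!: bexI [of _ "const_elt A (inverse e)"])
  qed
  ultimately show "d = c"
    by (cases "d - c = 0") auto
qed

lemma residue_nonunit:
  assumes A: "Cinf_ring A" "local_Cinf A" and a: "a \<in> carrier A"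
  shows "a \<ominus>\<^bsub>underlying_ring A\<^esub> const_elt A (residue A a) \<notin> Units (underlying_ring A)"
proof -
  let ?R = "underlying_ring A"
  interpret cring ?R by (rule cring_underlying [OF A(1)])
  obtain c where "a \<ominus>\<^bsub>?R\<^esub> const_elt A c \<notin> Units ?R"
  proof (rule local_Cinf_nonunits [OF A])
    fix M assume M: "\<And>a. a \<in> carrier A \<Longrightarrow> a \<in> M \<longleftrightarrow> a \<notin> Units ?R"
      "\<And>a. a \<in> carrier A \<Longrightarrow> \<exists>c. a \<ominus>\<^bsub>?R\<^esub> const_elt A c \<in> M"
    obtain c where "a \<ominus>\<^bsub>?R\<^esub> const_elt A c \<in> M"
      using M(2) [OF a] by blast
    then show ?thesis
      using that M(1) [OF underlying_closed(3) [OF A(1) a const_elt_closed [OF A(1)]]] by blast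
  qed
  with residueI [OF A a this] show ?thesis by simp
qed

lemma residue_eq_iff:
  assumes "Cinf_ring A" "local_Cinf A" "a \<in> carrier A"
  shows "residue A a = c \<longleftrightarrow> a \<ominus>\<^bsub>underlying_ring A\<^esub> const_elt A c \<notin> Units (underlying_ring A)"
proof
  assume "residue A a = c"
  with residue_nonunit [OF assms] show "a \<ominus>\<^bsub>underlying_ring A\<^esub> const_elt A c \<notin> Units (underlying_ring A)"
    by simp
qed (rule residueI [OF assms])

lemma unit_iff_residue:
  assumes A: "Cinf_ring A" "local_Cinf A" and a: "a \<in> carrier A"
  shows "a \<in> Units (underlying_ring A) \<longleftrightarrow> residue A a \<noteq> 0"
proof -
  interpret cring "underlying_ring A" by (rule cring_underlying [OF A(1)])
  show ?thesis
    using residue_eq_iff [OF A a, of 0] r_zero [of a] a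
    by (simp only: a_minus_def zero_underlying [symmetric] minus_zero carrier_underlying) blast
qed

text \<open>
  If \<open>F(a) - d\<close> and all \<open>a\<^sub>i - c\<^sub>i\<close> lie in the maximal ideal, then so does
  \<open>G(a)\<close> for \<open>G = (F - d)\<^sup>2 + \<Sum>(x\<^sub>i - c\<^sub>i)\<^sup>2\<close>.  For \<open>F(c) \<noteq> d\<close> this function has no zero, so its
  reciprocal is smooth and \<open>G(a)\<close> is a unit.
\<close>

lemma residue_smooth_op:
  assumes A: "Cinf_ring A" "local_Cinf A" and F: "smooth n F" and a: "a \<in> {..<n} \<rightarrow>\<^sub>E carrier A"
  shows "residue A (smooth_op A n F a) = F (\<lambda>i. if i < n then residue A (a i) else 0)"
proof (rule ccontr)
  let ?R = "underlying_ring A"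
  interpret cring ?R by (rule cring_underlying [OF A(1)])
  define c where "c = (\<lambda>i. if i < n then residue A (a i) else 0)"
  define d where "d = residue A (smooth_op A n F a)"
  define G where "G = (\<lambda>x. (F x - d)\<^sup>2 + (\<Sum>i\<in>{..<n}. (x i - c i)\<^sup>2))"
  assume "residue A (smooth_op A n F a) \<noteq> F (\<lambda>i. if i < n then residue A (a i) else 0)"
  then have ne: "F c \<noteq> d" by (simp add: c_def d_def)
  have sm: "smooth n (\<lambda>x. F x - d)" "smooth n (\<lambda>x. x i - c i)" "smooth n G" for i
    unfolding G_def using F
    by (simp_all add: smooth_diff smooth_add smooth_sum smooth_power2 smooth_const smooth_proj)
  obtain M where M: "maximalideal M ?R" "\<And>a. a \<in> carrier A \<Longrightarrow> a \<in> M \<longleftrightarrow> a \<notin> Units ?R"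
    using local_Cinf_nonunits [OF A] by metis
  interpret M: ideal M ?R
    using M(1) by (simp add: maximalideal_def)
  have sq: "smooth_op A n (\<lambda>x. (f x - e)\<^sup>2) a \<in> M" if f: "smooth n f" and e: "residue A (smooth_op A n f a) = e" for f e
  proof -
    have "smooth_op A n f a \<ominus>\<^bsub>?R\<^esub> const_elt A e = smooth_op A n (\<lambda>x. f x - e) a"
      by (simp add: const_elt_smooth_op [OF A(1) a] smooth_op_minus A a f smooth_const)
    moreover have "smooth_op A n f a \<ominus>\<^bsub>?R\<^esub> const_elt A e \<in> M"
      unfolding e [symmetric]
      by (intro iffD2 [OF M(2)] underlying_closed(3) const_elt_closed residue_nonunit smooth_op_closed A f a)
    ultimately have m: "smooth_op A n (\<lambda>x. f x - e) a \<in> M" by simp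
    then show ?thesis
      using M.I_l_closed [OF m, of "smooth_op A n (\<lambda>x. f x - e) a"] f a A
      by (simp add: smooth_op_mult smooth_op_closed smooth_diff smooth_const power2_eq_square)
  qed
  have add: "smooth_op A n (\<lambda>x. f x + g x) a \<in> M"
    if "smooth_op A n f a \<in> M" "smooth_op A n g a \<in> M" "smooth n f" "smooth n g" for f g
    using M.a_closed [OF that(1,2)] that A a by (simp add: smooth_op_add)
  have "smooth_op A n (\<lambda>x. \<Sum>i\<in>{..<m}. (x i - c i)\<^sup>2) a \<in> M" if "m \<le> n" for m
    using that
  proof (induction m)
    case 0
    show ?case
      using M.zero_closed by (simp add: zero_underlying const_elt_smooth_op [OF A(1) a])
  next
    case (Suc m)
    have "smooth_op A n (\<lambda>x. (x m - c m)\<^sup>2) a \<in> M"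
      using Suc.prems by (intro sq smooth_proj) (simp add: smooth_op_proj A a c_def)
    then show ?case
      using Suc by (simp add: add sm smooth_sum smooth_power2)
  qed
  from add [OF sq [OF F d_def [symmetric]] this [OF order_refl]]
  have "smooth_op A n G a \<in> M"
    unfolding G_def by (simp add: sm smooth_sum smooth_power2)
  moreover have "smooth_op A n G a \<in> Units ?R"
  proof -
    have nz: "G x \<noteq> 0" if x: "x \<in> Rn n" for x
    proof
      assume "G x = 0"
      then have "(F x - d)\<^sup>2 = 0" "(\<Sum>i\<in>{..<n}. (x i - c i)\<^sup>2) = 0"
        unfolding G_def by (simp_all add: add_nonneg_eq_0_iff sum_nonneg)
      then have "F x = d" "\<And>i. i < n \<Longrightarrow> x i = c i"
        by (simp_all add: sum_nonneg_eq_0_iff)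
      moreover from this x have "x = c"
        by (auto simp: Rn_iff c_def fun_eq_iff)
      ultimately show False using ne by simp
    qed
    have i: "smooth n (\<lambda>x. inverse (G x))"
      using sm(3) nz by (rule smooth_inverse)
    have "smooth_op A n G a \<otimes>\<^bsub>?R\<^esub> smooth_op A n (\<lambda>x. inverse (G x)) a = smooth_op A n (\<lambda>x. G x * inverse (G x)) a"
      by (rule smooth_op_mult [OF A(1) sm(3) i a])
    also have "\<dots> = smooth_op A n (\<lambda>x. 1) a"
      by (rule smooth_op_cong) (simp add: nz)
    finally have "smooth_op A n G a \<otimes>\<^bsub>?R\<^esub> smooth_op A n (\<lambda>x. inverse (G x)) a = \<one>\<^bsub>?R\<^esub>"
      by (simp add: one_underlying const_elt_smooth_op [OF A(1) a])
    then show ?thesis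
      using smooth_op_closed [OF A(1) sm(3) a] smooth_op_closed [OF A(1) i a]
      by (auto simp: Units_def m_comm intro!: bexI [of _ "smooth_op A n (\<lambda>x. inverse (G x)) a"])
  qed
  ultimately show False
    using M(2) smooth_op_closed [OF A(1) sm(3) a] by blast
qed

lemma residue_const:
  assumes "Cinf_ring A" "local_Cinf A"
  shows "residue A (const_elt A c) = c"
  using residue_smooth_op [OF assms smooth_const, of "\<lambda>_. undefined" 0 c]
    const_elt_smooth_op [OF assms(1), of "\<lambda>_. undefined" 0 c] by simp

text \<open>
  In a local ring only the germ of \<open>f\<close> at the residue matters: a function \<open>g\<close> with \<open>g f = 0\<close> that
  does not vanish at the residue gives a unit \<open>g(a)\<close> annihilating \<open>f(a)\<close>.
\<close>

lemma smooth_op_eq_zero: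
  assumes A: "Cinf_ring A" "local_Cinf A" and f: "smooth n f" and g: "smooth n g"
    and a: "a \<in> {..<n} \<rightarrow>\<^sub>E carrier A"
    and z: "\<And>x. x \<in> Rn n \<Longrightarrow> g x * f x = 0"
    and nz: "g (\<lambda>i. if i < n then residue A (a i) else 0) \<noteq> 0"
  shows "smooth_op A n f a = \<zero>\<^bsub>underlying_ring A\<^esub>"
proof -
  let ?R = "underlying_ring A"
  interpret cring ?R by (rule cring_underlying [OF A(1)])
  have c: "smooth_op A n f a \<in> carrier ?R" "smooth_op A n g a \<in> carrier ?R"
    using smooth_op_closed A f g a by simp_all
  have u: "smooth_op A n g a \<in> Units ?R"
    using unit_iff_residue [OF A] c nz residue_smooth_op [OF A g a] by simp
  have "smooth_op A n g a \<otimes>\<^bsub>?R\<^esub> smooth_op A n f a = smooth_op A n (\<lambda>x. 0) a"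
    unfolding smooth_op_mult [OF A(1) g f a] by (rule smooth_op_cong) (rule z)
  moreover have "smooth_op A n (\<lambda>x. 0) a = \<zero>\<^bsub>?R\<^esub>"
    by (simp add: zero_underlying const_elt_smooth_op [OF A(1) a])
  ultimately have "smooth_op A n g a \<otimes>\<^bsub>?R\<^esub> smooth_op A n f a = smooth_op A n g a \<otimes>\<^bsub>?R\<^esub> \<zero>\<^bsub>?R\<^esub>"
    using r_null [OF c(2)] by simp
  then show ?thesis
    by (rule iffD1 [OF Units_l_cancel [OF u c(1) zero_closed]])
qed

section \<open>Presheaves of \<open>C\<^sup>\<infinity>\<close>-rings and their stalks\<close>

lemma presheaf_rst_closed:
  "presheaf X F \<Longrightarrow> openin X U \<Longrightarrow> openin X V \<Longrightarrow> V \<subseteq> U \<Longrightarrow> s \<in> sec F U \<Longrightarrow> rst F U V s \<in> sec F V"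
  by (auto simp: presheaf_def)

lemma presheaf_rst_id: "presheaf X F \<Longrightarrow> openin X U \<Longrightarrow> s \<in> sec F U \<Longrightarrow> rst F U U s = s"
  by (auto simp: presheaf_def)

lemma presheaf_rst_rst:
  "presheaf X F \<Longrightarrow> openin X U \<Longrightarrow> openin X V \<Longrightarrow> openin X W \<Longrightarrow> W \<subseteq> V \<Longrightarrow> V \<subseteq> U \<Longrightarrow>
    s \<in> sec F U \<Longrightarrow> rst F V W (rst F U V s) = rst F U W s"
  by (auto simp: presheaf_def)

lemma germ_eqI_subset:
  assumes P: "presheaf X F" and U: "openin X U" "s \<in> sec F U" and V: "openin X V" "t \<in> sec F V"
    and W: "openin X W" "x \<in> W" "W \<subseteq> U" "W \<subseteq> V" "rst F U W s = rst F V W t"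
  shows "germ X F x U s \<subseteq> germ X F x V t"
proof
  fix p assume "p \<in> germ X F x U s"
  then obtain V' r W' where p: "p = (V', r)" "openin X V'" "x \<in> V'" "r \<in> sec F V'"
    and W': "openin X W'" "x \<in> W'" "W' \<subseteq> U" "W' \<subseteq> V'" "rst F U W' s = rst F V' W' r"
    by (auto simp: germ_def)
  have o: "openin X (W \<inter> W')"
    using W(1) W'(1) by blast
  have "rst F V (W \<inter> W') t = rst F W (W \<inter> W') (rst F U W s)"
    using presheaf_rst_rst [OF P V(1) W(1) o _ W(4) V(2)] W(5) by simp
  also have "\<dots> = rst F U (W \<inter> W') s"
    using presheaf_rst_rst [OF P U(1) W(1) o _ W(3) U(2)] by simp
  also have "\<dots> = rst F W' (W \<inter> W') (rst F U W' s)"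
    using presheaf_rst_rst [OF P U(1) W'(1) o _ W'(3) U(2)] by simp
  also have "\<dots> = rst F V' (W \<inter> W') r"
    using presheaf_rst_rst [OF P p(2) W'(1) o _ W'(4) p(4)] W'(5) by simp
  finally show "p \<in> germ X F x V t"
    unfolding germ_def using p o W W' by (auto intro!: exI [of _ "W \<inter> W'"])
qed

lemma germ_eqI:
  assumes "presheaf X F" "openin X U" "s \<in> sec F U" "openin X V" "t \<in> sec F V"
    and "openin X W" "x \<in> W" "W \<subseteq> U" "W \<subseteq> V" "rst F U W s = rst F V W t"
  shows "germ X F x U s = germ X F x V t"
  using germ_eqI_subset [OF assms] germ_eqI_subset [OF assms(1,4,5,2,3,6,7,9,8)] assms(10) by auto

lemma germ_self:
  assumes "presheaf X F" "openin X U" "x \<in> U" "s \<in> sec F U"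
  shows "(U, s) \<in> germ X F x U s"
  using assms by (auto simp: germ_def)

lemma germ_eqE:
  assumes "presheaf X F" "germ X F x U s = germ X F x V t" "openin X V" "x \<in> V" "t \<in> sec F V"
  obtains W where "openin X W" "x \<in> W" "W \<subseteq> U" "W \<subseteq> V" "rst F U W s = rst F V W t"
proof -
  have "(V, t) \<in> germ X F x U s"
    unfolding assms(2) by (rule germ_self [OF assms(1,3,4,5)])
  then show ?thesis
    using that by (auto simp: germ_def)
qed

lemma germ_rst:
  assumes "presheaf X F" "openin X U" "s \<in> sec F U" "openin X V" "V \<subseteq> U" "x \<in> V"
  shows "germ X F x V (rst F U V s) = germ X F x U s"
  using assms presheaf_rst_closed [OF assms(1,2,4,5,3)]
  by (intro germ_eqI [where W = V]) (auto simp: presheaf_rst_id)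

lemma germ_in_stalk: "openin X U \<Longrightarrow> x \<in> U \<Longrightarrow> s \<in> sec F U \<Longrightarrow> germ X F x U s \<in> stalk X F x"
  by (auto simp: stalk_def)

lemma common_representatives:
  fixes n :: nat
  assumes P: "presheaf X F" and x: "x \<in> topspace X" and g: "\<And>i. i < n \<Longrightarrow> g i \<in> stalk X F x"
  shows "\<exists>U s. openin X U \<and> x \<in> U \<and> s \<in> {..<n} \<rightarrow>\<^sub>E sec F U \<and> (\<forall>i<n. g i = germ X F x U (s i))"
proof -
  have "\<forall>i\<in>{..<n}. \<exists>U s. openin X U \<and> x \<in> U \<and> s \<in> sec F U \<and> g i = germ X F x U s"
    using g by (fastforce simp: stalk_def)
  then obtain U s where Us: "\<And>i. i < n \<Longrightarrow> openin X (U i) \<and> x \<in> U i \<and> s i \<in> sec F (U i) \<and> g i = germ X F x (U i) (s i)"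
    by (metis lessThan_iff)
  define V where "V = (\<Inter>i\<in>{..<n}. U i) \<inter> topspace X"
  have V: "openin X V" "x \<in> V" "\<And>i. i < n \<Longrightarrow> V \<subseteq> U i"
    unfolding V_def using Us x by (auto intro!: openin_INT)
  have "(\<lambda>i\<in>{..<n}. rst F (U i) V (s i)) \<in> {..<n} \<rightarrow>\<^sub>E sec F V"
    using Us V presheaf_rst_closed [OF P] by auto
  moreover have "\<forall>i<n. g i = germ X F x V ((\<lambda>i\<in>{..<n}. rst F (U i) V (s i)) i)"
    using Us V germ_rst [OF P] by simp
  ultimately show ?thesis
    using V by blast
qed

lemma common_neighbourhood:
  fixes n :: nat
  assumes P: "presheaf X F" and U: "openin X U" "x \<in> U" and V: "openin X V" "x \<in> V"
    and s: "\<And>i. i < n \<Longrightarrow> s i \<in> sec F U" and t: "\<And>i. i < n \<Longrightarrow> t i \<in> sec F V"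
    and eq: "\<And>i. i < n \<Longrightarrow> germ X F x U (s i) = germ X F x V (t i)"
  obtains W where "openin X W" "x \<in> W" "W \<subseteq> U" "W \<subseteq> V" "\<And>i. i < n \<Longrightarrow> rst F U W (s i) = rst F V W (t i)"
proof -
  have "\<forall>i\<in>{..<n}. \<exists>W. openin X W \<and> x \<in> W \<and> W \<subseteq> U \<and> W \<subseteq> V \<and> rst F U W (s i) = rst F V W (t i)"
    using germ_eqE [OF P eq V t] by (metis lessThan_iff)
  then obtain W where W: "\<And>i. i < n \<Longrightarrow> openin X (W i) \<and> x \<in> W i \<and> W i \<subseteq> U \<and> W i \<subseteq> V \<and>
      rst F U (W i) (s i) = rst F V (W i) (t i)"
    by (metis lessThan_iff)
  define W' where "W' = U \<inter> V \<inter> ((\<Inter>i\<in>{..<n}. W i) \<inter> topspace X)"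
  have "openin X ((\<Inter>i\<in>{..<n}. W i) \<inter> topspace X)"
    by (rule openin_INT) (use W in auto)
  then have W': "openin X W'" "x \<in> W'" "W' \<subseteq> U" "W' \<subseteq> V" "\<And>i. i < n \<Longrightarrow> W' \<subseteq> W i"
    unfolding W'_def using W U V openin_subset [OF U(1)] by auto
  have "rst F U W' (s i) = rst F V W' (t i)" if i: "i < n" for i
    using presheaf_rst_rst [OF P U(1) _ W'(1) W'(5) [OF i] _ s [OF i]]
      presheaf_rst_rst [OF P V(1) _ W'(1) W'(5) [OF i] _ t [OF i]] W [OF i] by metis
  with W' that show ?thesis by blast
qed

subsection \<open>The stalk of a presheaf of \<open>C\<^sup>\<infinity>\<close>-rings\<close>

definition Cinf_presheaf :: "'x topology \<Rightarrow> ('x, 'a, 'm) cpsh_scheme \<Rightarrow> bool" where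
  "Cinf_presheaf X F \<longleftrightarrow> presheaf X F \<and>
     (\<forall>U. openin X U \<longrightarrow> Cinf_ring (sections_Cinf F U)) \<and>
     (\<forall>U V. openin X U \<longrightarrow> openin X V \<longrightarrow> V \<subseteq> U \<longrightarrow>
        rst F U V \<in> Cinf_hom (sections_Cinf F U) (sections_Cinf F V))"

lemma sections_Cinf_simps [simp]:
  "carrier (sections_Cinf F U) = sec F U" "cop (sections_Cinf F U) = pop F U"
  by (simp_all add: sections_Cinf_def)

lemma stalk_Cinf_simps [simp]:
  "carrier (stalk_Cinf X F x) = stalk X F x" "cop (stalk_Cinf X F x) = stalk_op X F x"
  by (simp_all add: stalk_Cinf_def)

lemma Cinf_presheafD:
  assumes "Cinf_presheaf X F"
  shows "presheaf X F" "openin X U \<Longrightarrow> Cinf_ring (sections_Cinf F U)"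
    "openin X U \<Longrightarrow> openin X V \<Longrightarrow> V \<subseteq> U \<Longrightarrow> rst F U V \<in> Cinf_hom (sections_Cinf F U) (sections_Cinf F V)"
  using assms by (auto simp: Cinf_presheaf_def)

text \<open>
  The operations that pass to stalks.  Besides the elements of \<open>Cinf n\<close> these are the composites
  \<open>f \<circ> (g\<^sub>0, \<dots>, g\<^bsub>m-1\<^esub>)\<close>, by the composition law for sections; both kinds occur in the
  composition law for the stalk.
\<close>

definition natural_op :: "'x topology \<Rightarrow> ('x, 'a, 'm) cpsh_scheme \<Rightarrow> nat \<Rightarrow> rfun \<Rightarrow> bool" where
  "natural_op X F n f \<longleftrightarrow> (\<forall>U. openin X U \<longrightarrow> (\<forall>s\<in>{..<n} \<rightarrow>\<^sub>E sec F U.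
     pop F U n f s \<in> sec F U \<and>
     (\<forall>V. openin X V \<longrightarrow> V \<subseteq> U \<longrightarrow>
        rst F U V (pop F U n f s) = pop F V n f (\<lambda>i\<in>{..<n}. rst F U V (s i)))))"

lemma natural_op_Cinf:
  assumes "Cinf_presheaf X F" "f \<in> Cinf n"
  shows "natural_op X F n f"
  using cop_closed [OF Cinf_presheafD(2) [OF assms(1)] assms(2)]
    Cinf_hom_cop [OF Cinf_presheafD(3) [OF assms(1)] assms(2)]
  by (auto simp: natural_op_def)

lemma rst_tuple:
  assumes "presheaf X F" "openin X U" "openin X V" "V \<subseteq> U" "s \<in> {..<n::nat} \<rightarrow>\<^sub>E sec F U"
  shows "(\<lambda>i\<in>{..<n}. rst F U V (s i)) \<in> {..<n} \<rightarrow>\<^sub>E sec F V"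
  using assms by (auto simp: PiE_iff intro!: presheaf_rst_closed)

lemma natural_op_scomp:
  assumes F: "Cinf_presheaf X F" and f: "f \<in> Cinf m" and g: "\<And>j. j < m \<Longrightarrow> g j \<in> Cinf n"
  shows "natural_op X F n (scomp n m f g)"
  unfolding natural_op_def
proof (intro allI impI ballI conjI)
  fix U s assume U: "openin X U" and s: "s \<in> {..<n} \<rightarrow>\<^sub>E sec F U"
  note P = Cinf_presheafD(1) [OF F]
  let ?u = "\<lambda>U s. \<lambda>j\<in>{..<m}. pop F U n (g j) s"
  have eq: "pop F U n (scomp n m f g) s = pop F U m f (?u U s)"
    if "openin X U" "s \<in> {..<n} \<rightarrow>\<^sub>E sec F U" for U s
    using cop_scomp [OF Cinf_presheafD(2) [OF F that(1)] f g, where a = s] that(2) by simp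
  have u: "?u U s \<in> {..<m} \<rightarrow>\<^sub>E sec F U"
    using natural_op_Cinf [OF F g] U s by (auto simp: natural_op_def)
  then show "pop F U n (scomp n m f g) s \<in> sec F U"
    using natural_op_Cinf [OF F f] U unfolding natural_op_def eq [OF U s] by blast
  fix V assume V: "openin X V" "V \<subseteq> U"
  have "rst F U V (pop F U m f (?u U s)) = pop F V m f (\<lambda>j\<in>{..<m}. rst F U V (?u U s j))"
    using natural_op_Cinf [OF F f] U V u by (auto simp: natural_op_def)
  also have "(\<lambda>j\<in>{..<m}. rst F U V (?u U s j)) = ?u V (\<lambda>i\<in>{..<n}. rst F U V (s i))"
    using natural_op_Cinf [OF F g] U V s by (intro restrict_ext) (simp add: natural_op_def)
  finally show "rst F U V (pop F U n (scomp n m f g) s) =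
      pop F V n (scomp n m f g) (\<lambda>i\<in>{..<n}. rst F U V (s i))"
    unfolding eq [OF V(1) rst_tuple [OF P U V s]] eq [OF U s] .
qed

lemma stalk_op_germ:
  assumes P: "presheaf X F" and f: "natural_op X F n f" and U: "openin X U" "x \<in> U"
    and s: "s \<in> {..<n} \<rightarrow>\<^sub>E sec F U" and g: "\<And>i. i < n \<Longrightarrow> g i = germ X F x U (s i)"
  shows "stalk_op X F x n f g = germ X F x U (pop F U n f s)"
  unfolding stalk_op_def
proof (rule the_equality)
  show "\<exists>V t. openin X V \<and> x \<in> V \<and> t \<in> {..<n} \<rightarrow>\<^sub>E sec F V \<and> (\<forall>i<n. g i = germ X F x V (t i)) \<and>
      germ X F x U (pop F U n f s) = germ X F x V (pop F V n f t)"
    using U s g by blast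
next
  fix c
  assume "\<exists>V t. openin X V \<and> x \<in> V \<and> t \<in> {..<n} \<rightarrow>\<^sub>E sec F V \<and> (\<forall>i<n. g i = germ X F x V (t i)) \<and>
      c = germ X F x V (pop F V n f t)"
  then obtain V t where V: "openin X V" "x \<in> V" and t: "t \<in> {..<n} \<rightarrow>\<^sub>E sec F V"
    and gt: "\<And>i. i < n \<Longrightarrow> g i = germ X F x V (t i)" and c: "c = germ X F x V (pop F V n f t)"
    by blast
  obtain W where W: "openin X W" "x \<in> W" "W \<subseteq> U" "W \<subseteq> V" "\<And>i. i < n \<Longrightarrow> rst F U W (s i) = rst F V W (t i)"
    using common_neighbourhood [OF P U V, of n s t] s t g gt by (auto simp: PiE_iff)
  have "(\<lambda>i\<in>{..<n}. rst F U W (s i)) = (\<lambda>i\<in>{..<n}. rst F V W (t i))"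
    using W(5) by auto
  then have "rst F U W (pop F U n f s) = rst F V W (pop F V n f t)"
    using f U V W s t unfolding natural_op_def by metis
  then show "c = germ X F x U (pop F U n f s)"
    unfolding c using f U V W s t
    by (intro germ_eqI [OF P, where W = W]) (auto simp: natural_op_def)
qed

lemma stalk_Cinf_ring:
  assumes F: "Cinf_presheaf X F" and x: "x \<in> topspace X"
  shows "Cinf_ring (stalk_Cinf X F x)"
proof -
  note P = Cinf_presheafD(1) [OF F]
  have rep: "\<exists>U s. openin X U \<and> x \<in> U \<and> s \<in> {..<n} \<rightarrow>\<^sub>E sec F U \<and> (\<forall>i<n. a i = germ X F x U (s i))"
    if "a \<in> {..<n} \<rightarrow>\<^sub>E stalk X F x" for n and a :: "nat \<Rightarrow> _"
    using common_representatives [OF P x, of n a] that by (auto simp: PiE_iff)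
  have closed: "stalk_op X F x n f a \<in> stalk X F x" if f: "f \<in> Cinf n" and a: "a \<in> {..<n} \<rightarrow>\<^sub>E stalk X F x" for n f a
  proof -
    obtain U s where U: "openin X U" "x \<in> U" and s: "s \<in> {..<n} \<rightarrow>\<^sub>E sec F U" "\<forall>i<n. a i = germ X F x U (s i)"
      using rep [OF a] by blast
    have "pop F U n f s \<in> sec F U"
      using natural_op_Cinf [OF F f] U s by (auto simp: natural_op_def)
    then show ?thesis
      using stalk_op_germ [OF P natural_op_Cinf [OF F f] U s(1)] s(2) U by (auto simp: germ_in_stalk)
  qed
  have proj: "stalk_op X F x n (\<lambda>x\<in>Rn n. x i) a = a i" if i: "i < n" and a: "a \<in> {..<n} \<rightarrow>\<^sub>E stalk X F x" for n i a
  proof -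
    obtain U s where U: "openin X U" "x \<in> U" and s: "s \<in> {..<n} \<rightarrow>\<^sub>E sec F U" "\<forall>i<n. a i = germ X F x U (s i)"
      using rep [OF a] by blast
    have "pop F U n (\<lambda>x\<in>Rn n. x i) s = s i"
      using smooth_op_proj [OF Cinf_presheafD(2) [OF F U(1)] i] s by (simp add: smooth_op_def)
    then show ?thesis
      using stalk_op_germ [OF P natural_op_Cinf [OF F restrict_Cinf [OF smooth_proj]] U s(1)] s(2) i by simp
  qed
  have comp: "stalk_op X F x n (scomp n m f g) a = stalk_op X F x m f (\<lambda>j\<in>{..<m}. stalk_op X F x n (g j) a)"
    if f: "f \<in> Cinf m" and g: "\<And>j. j < m \<Longrightarrow> g j \<in> Cinf n" and a: "a \<in> {..<n} \<rightarrow>\<^sub>E stalk X F x" for n m f g a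
  proof -
    obtain U s where U: "openin X U" "x \<in> U" and s: "s \<in> {..<n} \<rightarrow>\<^sub>E sec F U" "\<forall>i<n. a i = germ X F x U (s i)"
      using rep [OF a] by blast
    let ?u = "\<lambda>j\<in>{..<m}. pop F U n (g j) s"
    have u: "?u \<in> {..<m} \<rightarrow>\<^sub>E sec F U"
      using natural_op_Cinf [OF F g] U s by (auto simp: natural_op_def)
    have "stalk_op X F x m f (\<lambda>j\<in>{..<m}. stalk_op X F x n (g j) a) = germ X F x U (pop F U m f ?u)"
      using stalk_op_germ [OF P natural_op_Cinf [OF F g] U s(1)] s(2)
      by (intro stalk_op_germ [OF P natural_op_Cinf [OF F f] U u]) simp
    also have "pop F U m f ?u = pop F U n (scomp n m f g) s"
      using cop_scomp [OF Cinf_presheafD(2) [OF F U(1)] f g, where a = s] s by simp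
    also have "germ X F x U \<dots> = stalk_op X F x n (scomp n m f g) a"
      using s(2) by (intro stalk_op_germ [OF P natural_op_scomp [OF F f g] U s(1), symmetric]) auto
    finally show ?thesis by (rule sym)
  qed
  show ?thesis
  proof (rule Cinf_ringI, unfold stalk_Cinf_simps)
  qed (rule closed proj comp; assumption)+
qed

lemma germ_Cinf_hom:
  assumes F: "Cinf_presheaf X F" and U: "openin X U" "x \<in> U"
  shows "germ X F x U \<in> Cinf_hom (sections_Cinf F U) (stalk_Cinf X F x)"
  using stalk_op_germ [OF Cinf_presheafD(1) [OF F] natural_op_Cinf [OF F] U] U
  by (auto simp: Cinf_hom_def germ_in_stalk)

text \<open>
  An inverse of a germ is represented over some neighbourhood, and over a smaller one the product of
  the representatives is \<open>1\<close>.
\<close>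

lemma germ_unit:
  assumes F: "Cinf_presheaf X F" and U: "openin X U" "x \<in> U" and s: "s \<in> sec F U"
    and u: "germ X F x U s \<in> Units (underlying_ring (stalk_Cinf X F x))"
  obtains W where "openin X W" "x \<in> W" "W \<subseteq> U" "rst F U W s \<in> Units (underlying_ring (sections_Cinf F W))"
proof -
  note P = Cinf_presheafD(1) [OF F]
  have x: "x \<in> topspace X" using U openin_subset by blast
  let ?S = "underlying_ring (stalk_Cinf X F x)"
  interpret S: cring ?S by (rule cring_underlying [OF stalk_Cinf_ring [OF F x]])
  obtain c where c: "c \<in> stalk X F x" "germ X F x U s \<otimes>\<^bsub>?S\<^esub> c = \<one>\<^bsub>?S\<^esub>"
    using u by (auto simp: Units_def)
  then obtain V t where V: "openin X V" "x \<in> V" and t: "t \<in> sec F V" "c = germ X F x V t"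
    by (auto simp: stalk_def)
  define V' where "V' = U \<inter> V"
  have V': "openin X V'" "x \<in> V'" "V' \<subseteq> U" "V' \<subseteq> V"
    using U V by (auto simp: V'_def)
  let ?R = "\<lambda>W. underlying_ring (sections_Cinf F W)"
  have R: "cring (?R W)" if "openin X W" for W
    using cring_underlying Cinf_presheafD(2) [OF F that] by blast
  define s' where "s' = rst F U V' s"
  define t' where "t' = rst F V V' t"
  have st: "s' \<in> sec F V'" "t' \<in> sec F V'" "germ X F x V' s' = germ X F x U s" "germ X F x V' t' = c"
    using s t U V V' by (simp_all add: s'_def t'_def presheaf_rst_closed [OF P] germ_rst [OF P])
  interpret G: ring_hom_cring "?R V'" ?S "germ X F x V'"
    using Cinf_hom_ring_hom [OF Cinf_presheafD(2) [OF F V'(1)] stalk_Cinf_ring [OF F x] germ_Cinf_hom [OF F V'(1,2)]] .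
  have "germ X F x V' (s' \<otimes>\<^bsub>?R V'\<^esub> t') = germ X F x V' \<one>\<^bsub>?R V'\<^esub>"
    using c st by simp
  moreover have o: "\<one>\<^bsub>?R V'\<^esub> \<in> sec F V'" "s' \<otimes>\<^bsub>?R V'\<^esub> t' \<in> sec F V'"
    using underlying_zero_one_closed(2) [OF Cinf_presheafD(2) [OF F V'(1)]]
      underlying_closed(2) [OF Cinf_presheafD(2) [OF F V'(1)], of s' t'] st by auto
  ultimately obtain W where W: "openin X W" "x \<in> W" "W \<subseteq> V'"
      "rst F V' W (s' \<otimes>\<^bsub>?R V'\<^esub> t') = rst F V' W \<one>\<^bsub>?R V'\<^esub>"
    using germ_eqE [OF P _ V'(1,2)] by metis
  interpret H: ring_hom_cring "?R V'" "?R W" "rst F V' W"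
    using Cinf_hom_ring_hom [OF Cinf_presheafD(2) [OF F V'(1)] Cinf_presheafD(2) [OF F W(1)] Cinf_presheafD(3) [OF F V'(1) W(1,3)]] .
  have "rst F V' W s' \<otimes>\<^bsub>?R W\<^esub> rst F V' W t' = \<one>\<^bsub>?R W\<^esub>"
    using W(4) st by simp
  moreover have "rst F V' W s' \<in> sec F W" "rst F V' W t' \<in> sec F W"
    using presheaf_rst_closed [OF P V'(1) W(1,3)] st by auto
  moreover have "rst F V' W s' = rst F U W s"
    unfolding s'_def by (rule presheaf_rst_rst [OF P U(1) V'(1) W(1,3) V'(3) s])
  ultimately have "rst F U W s \<in> Units (?R W)"
    using H.S.m_comm [of "rst F V' W s'" "rst F V' W t'"] by (auto simp: Units_def)
  with W V' that show ?thesis by blast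
qed

subsection \<open>The values of a section\<close>

definition local_stalks :: "'x topology \<Rightarrow> ('x, 'a, 'm) cpsh_scheme \<Rightarrow> bool"
  where "local_stalks X F \<longleftrightarrow> (\<forall>x\<in>topspace X. local_Cinf (stalk_Cinf X F x))"

definition section_value :: "'x topology \<Rightarrow> ('x, 'a, 'm) cpsh_scheme \<Rightarrow> 'x set \<Rightarrow> 'a \<Rightarrow> 'x \<Rightarrow> real"
  where "section_value X F U s y = residue (stalk_Cinf X F y) (germ X F y U s)"

lemma section_value_smooth_op:
  assumes F: "Cinf_presheaf X F" and L: "local_stalks X F" and U: "openin X U" "y \<in> U"
    and f: "smooth n f" and s: "s \<in> {..<n} \<rightarrow>\<^sub>E sec F U"
  shows "section_value X F U (smooth_op (sections_Cinf F U) n f s) y =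
    f (\<lambda>i. if i < n then section_value X F U (s i) y else 0)"
proof -
  have y: "y \<in> topspace X" using U openin_subset by blast
  have "(\<lambda>i\<in>{..<n}. germ X F y U (s i)) \<in> {..<n} \<rightarrow>\<^sub>E carrier (stalk_Cinf X F y)"
    using s U by (auto simp: germ_in_stalk PiE_iff)
  then have "residue (stalk_Cinf X F y) (smooth_op (stalk_Cinf X F y) n f (\<lambda>i\<in>{..<n}. germ X F y U (s i))) =
      f (\<lambda>i. if i < n then residue (stalk_Cinf X F y) ((\<lambda>i\<in>{..<n}. germ X F y U (s i)) i) else 0)"
    using L y by (intro residue_smooth_op stalk_Cinf_ring F f) (auto simp: local_stalks_def)
  then show ?thesis
    using Cinf_hom_smooth_op [OF germ_Cinf_hom [OF F U] f, of s] s
    by (simp add: section_value_def cong: if_cong)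
qed

lemma section_value_rst:
  "presheaf X F \<Longrightarrow> openin X U \<Longrightarrow> s \<in> sec F U \<Longrightarrow> openin X V \<Longrightarrow> V \<subseteq> U \<Longrightarrow> y \<in> V \<Longrightarrow>
    section_value X F V (rst F U V s) y = section_value X F U s y"
  by (simp add: section_value_def germ_rst)

lemma section_value_nonzero_open:
  assumes F: "Cinf_presheaf X F" and L: "local_stalks X F" and U: "openin X U" and s: "s \<in> sec F U"
  shows "openin X {y \<in> U. section_value X F U s y \<noteq> 0}"
proof (subst openin_subopen, intro ballI)
  fix y assume "y \<in> {y \<in> U. section_value X F U s y \<noteq> 0}"
  then have y: "y \<in> U" "section_value X F U s y \<noteq> 0" by auto
  have loc: "local_Cinf (stalk_Cinf X F z)" "Cinf_ring (stalk_Cinf X F z)" if "z \<in> U" for z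
    using L that openin_subset [OF U] stalk_Cinf_ring [OF F] by (auto simp: local_stalks_def)
  have iff: "germ X F z U s \<in> Units (underlying_ring (stalk_Cinf X F z)) \<longleftrightarrow> section_value X F U s z \<noteq> 0"
    if "z \<in> U" for z
    unfolding section_value_def using unit_iff_residue [OF loc(2,1)] that germ_in_stalk [OF U that s] by simp
  obtain W where W: "openin X W" "y \<in> W" "W \<subseteq> U" and u: "rst F U W s \<in> Units (underlying_ring (sections_Cinf F W))"
    using germ_unit [OF F U y(1) s] iff [OF y(1)] y(2) by blast
  have "section_value X F U s z \<noteq> 0" if "z \<in> W" for z
  proof -
    have z: "z \<in> U" using that W by blast
    have "germ X F z W (rst F U W s) \<in> Units (underlying_ring (stalk_Cinf X F z))"
      by (rule Cinf_hom_Units [OF Cinf_presheafD(2) [OF F W(1)] loc(2) [OF z] germ_Cinf_hom [OF F W(1) that] u])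
    then show ?thesis
      using germ_rst [OF Cinf_presheafD(1) [OF F] U s W(1,3) that] iff [OF z] by simp
  qed
  then show "\<exists>T. openin X T \<and> y \<in> T \<and> T \<subseteq> {y \<in> U. section_value X F U s y \<noteq> 0}"
    using W by blast
qed

text \<open>
  Continuity of the values of a section: \<open>f\<close> takes a nonzero value at the value of a section exactly
  where the section \<open>f(s)\<close> is invertible, which is an open condition.
\<close>

lemma section_value_open:
  assumes F: "Cinf_presheaf X F" and L: "local_stalks X F" and U: "openin X U" and s: "s \<in> sec F U"
    and f: "smooth 1 f"
  shows "openin X {y \<in> U. f (\<lambda>i. if i < 1 then section_value X F U s y else 0) \<noteq> 0}"
proof -
  let ?s = "\<lambda>i\<in>{..<1::nat}. s"
  have s': "?s \<in> {..<1} \<rightarrow>\<^sub>E sec F U"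
    using s by auto
  have "openin X {y \<in> U. section_value X F U (smooth_op (sections_Cinf F U) 1 f ?s) y \<noteq> 0}"
    using smooth_op_closed [OF Cinf_presheafD(2) [OF F U] f, of ?s] s'
    by (intro section_value_nonzero_open F L U) simp
  also have "{y \<in> U. section_value X F U (smooth_op (sections_Cinf F U) 1 f ?s) y \<noteq> 0} =
      {y \<in> U. f (\<lambda>i. if i < 1 then section_value X F U s y else 0) \<noteq> 0}"
    using section_value_smooth_op [OF F L U _ f s'] by (auto cong: if_cong)
  finally show ?thesis .
qed

lemma section_value_continuous:
  assumes "Cinf_presheaf X F" "local_stalks X F" "openin X U" "s \<in> sec F U"
  shows "openin X {y \<in> U. section_value X F U s y < c}" "openin X {y \<in> U. c < section_value X F U s y}"
  using section_value_open [OF assms smooth_flat [OF smooth_diff [OF smooth_const [of 1 c] smooth_proj [of 1 0]]]]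
    section_value_open [OF assms smooth_flat [OF smooth_diff [OF smooth_proj [of 1 0] smooth_const [of 1 c]]]]
  by (simp_all add: flat_eq_0_iff not_le)

section \<open>The associated sheaf\<close>

lemma germ_sections_stalk: "\<sigma> \<in> germ_sections X F U \<Longrightarrow> y \<in> U \<Longrightarrow> \<sigma> y \<in> stalk X F y"
  by (simp add: germ_sections_def PiE_iff)

lemma germ_sections_extensional: "\<sigma> \<in> germ_sections X F U \<Longrightarrow> restrict \<sigma> U = \<sigma>"
  by (simp add: germ_sections_def PiE_iff extensional_restrict)

lemma germ_sections_local:
  assumes "\<sigma> \<in> germ_sections X F U" "z \<in> U"
  obtains V s where "openin X V" "z \<in> V" "s \<in> sec F V" "\<forall>y\<in>U \<inter> V. \<sigma> y = germ X F y V s"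
  using assms unfolding germ_sections_def by blast

lemma germ_sectionsI:
  assumes "\<And>y. y \<in> U \<Longrightarrow> \<sigma> y \<in> stalk X F y" "\<sigma> \<in> extensional U"
    and "\<And>z. z \<in> U \<Longrightarrow> \<exists>V. openin X V \<and> z \<in> V \<and> (\<exists>s\<in>sec F V. \<forall>y\<in>U \<inter> V. \<sigma> y = germ X F y V s)"
  shows "\<sigma> \<in> germ_sections X F U"
  using assms by (simp add: germ_sections_def PiE_iff)

lemma germ_sections_restrict:
  assumes \<sigma>: "\<sigma> \<in> germ_sections X F U" and V: "V \<subseteq> U"
  shows "restrict \<sigma> V \<in> germ_sections X F V"
proof (rule germ_sectionsI)
  show "restrict \<sigma> V y \<in> stalk X F y" if "y \<in> V" for y
    using that V germ_sections_stalk [OF \<sigma>, of y] by (simp add: subsetD)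
  fix z assume "z \<in> V"
  with V have "z \<in> U" by blast
  then obtain W s where W: "openin X W" "z \<in> W" "s \<in> sec F W" "\<forall>y\<in>U \<inter> W. \<sigma> y = germ X F y W s"
    using germ_sections_local [OF \<sigma>] by metis
  have "\<forall>y\<in>V \<inter> W. restrict \<sigma> V y = germ X F y W s"
    using W(4) V by (simp add: subset_iff)
  with W show "\<exists>W. openin X W \<and> z \<in> W \<and> (\<exists>s\<in>sec F W. \<forall>y\<in>V \<inter> W. restrict \<sigma> V y = germ X F y W s)"
    by blast
qed simp

text \<open>
  This reduces pointwise operations on sections of the associated sheaf, locally, to operations on
  sections of the presheaf.
\<close>

lemma germ_sections_common:
  fixes n :: nat
  assumes P: "presheaf X F" and U: "openin X U" "z \<in> U" and \<sigma>: "\<And>i. i < n \<Longrightarrow> \<sigma> i \<in> germ_sections X F U"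
  obtains V s where "openin X V" "z \<in> V" "V \<subseteq> U" "s \<in> {..<n} \<rightarrow>\<^sub>E sec F V"
    "\<And>i y. i < n \<Longrightarrow> y \<in> V \<Longrightarrow> \<sigma> i y = germ X F y V (s i)"
proof -
  have "\<forall>i\<in>{..<n}. \<exists>V s. openin X V \<and> z \<in> V \<and> s \<in> sec F V \<and> (\<forall>y\<in>U \<inter> V. \<sigma> i y = germ X F y V s)"
    using \<sigma> U(2) unfolding germ_sections_def by fastforce
  then obtain V s where Vs: "\<And>i. i < n \<Longrightarrow> openin X (V i) \<and> z \<in> V i \<and> s i \<in> sec F (V i) \<and>
      (\<forall>y\<in>U \<inter> V i. \<sigma> i y = germ X F y (V i) (s i))"
    by (metis lessThan_iff)
  define W where "W = U \<inter> ((\<Inter>i\<in>{..<n}. V i) \<inter> topspace X)"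
  have "openin X ((\<Inter>i\<in>{..<n}. V i) \<inter> topspace X)"
    by (rule openin_INT) (use Vs in auto)
  then have W: "openin X W" "z \<in> W" "W \<subseteq> U" "\<And>i. i < n \<Longrightarrow> W \<subseteq> V i"
    unfolding W_def using Vs U openin_subset [OF U(1)] by auto
  show ?thesis
  proof (rule that [OF W(1-3)])
    show "(\<lambda>i\<in>{..<n}. rst F (V i) W (s i)) \<in> {..<n} \<rightarrow>\<^sub>E sec F W"
      using Vs W presheaf_rst_closed [OF P] by auto
    show "\<sigma> i y = germ X F y W ((\<lambda>i\<in>{..<n}. rst F (V i) W (s i)) i)" if "i < n" "y \<in> W" for i y
    proof -
      have "\<sigma> i y = germ X F y (V i) (s i)"
        using Vs [OF that(1)] W that by blast
      also have "\<dots> = germ X F y W (rst F (V i) W (s i))"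
        using Vs [OF that(1)] W that by (intro germ_rst [OF P, symmetric]) auto
      finally show ?thesis
        using that(1) by simp
    qed
  qed
qed

lemma sheafify_Cinf_simps [simp]:
  "sec (sheafify_Cinf X F) = germ_sections X F"
  "rst (sheafify_Cinf X F) U V \<sigma> = restrict \<sigma> V"
  "pop (sheafify_Cinf X F) U n f \<tau> = (\<lambda>x\<in>U. stalk_op X F x n f (\<lambda>i\<in>{..<n}. \<tau> i x))"
  by (simp_all add: sheafify_Cinf_def)

lemma sheafify_Cinf_presheaf:
  assumes F: "Cinf_presheaf X F"
  shows "Cinf_presheaf X (sheafify_Cinf X F)"
proof -
  note P = Cinf_presheafD(1) [OF F]
  let ?S = "sheafify_Cinf X F"
  have tup: "(\<lambda>i\<in>{..<n}. \<sigma> i y) \<in> {..<n} \<rightarrow>\<^sub>E stalk X F y"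
    if "\<sigma> \<in> {..<n} \<rightarrow>\<^sub>E germ_sections X F U" "y \<in> U" for n U y and \<sigma> :: "nat \<Rightarrow> _"
    using that by (auto simp: PiE_iff intro: germ_sections_stalk)
  have "presheaf X ?S"
    unfolding presheaf_def
    by (intro conjI allI impI ballI funcsetI)
      (simp_all add: germ_sections_restrict germ_sections_extensional Int_absorb1)
  moreover have "Cinf_ring (sections_Cinf ?S U)" if U: "openin X U" for U
  proof -
    have st: "Cinf_ring (stalk_Cinf X F y)" if "y \<in> U" for y
      using stalk_Cinf_ring [OF F] that openin_subset [OF U] by blast
    have closed: "pop ?S U n f \<sigma> \<in> germ_sections X F U"
      if f: "f \<in> Cinf n" and \<sigma>: "\<sigma> \<in> {..<n} \<rightarrow>\<^sub>E germ_sections X F U" for n f \<sigma>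
      unfolding germ_sections_def
    proof (intro CollectI conjI ballI)
      show "pop ?S U n f \<sigma> \<in> (\<Pi>\<^sub>E z\<in>U. stalk X F z)"
        using cop_closed [OF st f] tup [OF \<sigma>] by auto
      fix z assume z: "z \<in> U"
      obtain V s where V: "openin X V" "z \<in> V" "V \<subseteq> U" and s: "s \<in> {..<n} \<rightarrow>\<^sub>E sec F V"
        "\<And>i y. i < n \<Longrightarrow> y \<in> V \<Longrightarrow> \<sigma> i y = germ X F y V (s i)"
        using germ_sections_common [OF P U z, of n \<sigma>] \<sigma> by (auto simp: PiE_iff)
      have "pop ?S U n f \<sigma> y = germ X F y V (pop F V n f s)" if "y \<in> V" for y
        using stalk_op_germ [OF P natural_op_Cinf [OF F f] V(1) that s(1)] s(2) that V by auto
      moreover have "pop F V n f s \<in> sec F V"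
        using natural_op_Cinf [OF F f] V s by (auto simp: natural_op_def)
      ultimately show "\<exists>V. openin X V \<and> z \<in> V \<and> (\<exists>s\<in>sec F V. \<forall>y\<in>U \<inter> V. pop ?S U n f \<sigma> y = germ X F y V s)"
        using V by blast
    qed
    have proj: "pop ?S U n (\<lambda>x\<in>Rn n. x i) \<sigma> = \<sigma> i"
      if i: "i < n" and \<sigma>: "\<sigma> \<in> {..<n} \<rightarrow>\<^sub>E germ_sections X F U" for n i \<sigma>
    proof -
      have "stalk_op X F y n (\<lambda>x\<in>Rn n. x i) (\<lambda>i\<in>{..<n}. \<sigma> i y) = \<sigma> i y" if "y \<in> U" for y
        using smooth_op_proj [OF st [OF that] i, of "\<lambda>i\<in>{..<n}. \<sigma> i y"] tup [OF \<sigma> that] i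
        by (simp add: smooth_op_def)
      then have "pop ?S U n (\<lambda>x\<in>Rn n. x i) \<sigma> = restrict (\<sigma> i) U"
        unfolding sheafify_Cinf_simps by (intro restrict_ext)
      also have "\<dots> = \<sigma> i"
        by (rule germ_sections_extensional [where X = X and F = F]) (use \<sigma> i in \<open>simp add: PiE_iff\<close>)
      finally show ?thesis .
    qed
    have comp: "pop ?S U n (scomp n m f g) \<sigma> = pop ?S U m f (\<lambda>j\<in>{..<m}. pop ?S U n (g j) \<sigma>)"
      if f: "f \<in> Cinf m" and g: "\<And>j. j < m \<Longrightarrow> g j \<in> Cinf n"
        and \<sigma>: "\<sigma> \<in> {..<n} \<rightarrow>\<^sub>E germ_sections X F U" for n m f g \<sigma>
    proof -
      have "stalk_op X F y n (scomp n m f g) (\<lambda>i\<in>{..<n}. \<sigma> i y) =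
          stalk_op X F y m f (\<lambda>j\<in>{..<m}. stalk_op X F y n (g j) (\<lambda>i\<in>{..<n}. \<sigma> i y))" if y: "y \<in> U" for y
        using cop_scomp [OF st [OF y] f g, where a = "\<lambda>i\<in>{..<n}. \<sigma> i y"] tup [OF \<sigma> y] by simp
      moreover have "(\<lambda>j\<in>{..<m}. (\<lambda>j\<in>{..<m}. pop ?S U n (g j) \<sigma>) j y) =
          (\<lambda>j\<in>{..<m}. stalk_op X F y n (g j) (\<lambda>i\<in>{..<n}. \<sigma> i y))" if y: "y \<in> U" for y
        by (rule restrict_ext) (simp add: y)
      ultimately show ?thesis
        unfolding sheafify_Cinf_simps by (intro restrict_ext) simp
    qed
    show ?thesis
    proof (rule Cinf_ringI)
      let ?A = "sections_Cinf ?S U"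
      show "cop ?A n f a \<in> carrier ?A" if "f \<in> Cinf n" "a \<in> {..<n} \<rightarrow>\<^sub>E carrier ?A" for n f a
        using that unfolding sections_Cinf_simps sheafify_Cinf_simps(1) by (rule closed)
      show "cop ?A n (\<lambda>x\<in>Rn n. x i) a = a i" if "i < n" "a \<in> {..<n} \<rightarrow>\<^sub>E carrier ?A" for n i a
        using that unfolding sections_Cinf_simps sheafify_Cinf_simps(1) by (rule proj)
      show "cop ?A n (scomp n m f g) a = cop ?A m f (\<lambda>j\<in>{..<m}. cop ?A n (g j) a)"
        if "f \<in> Cinf m" "\<And>j. j < m \<Longrightarrow> g j \<in> Cinf n" "a \<in> {..<n} \<rightarrow>\<^sub>E carrier ?A" for n m f g a
        using that unfolding sections_Cinf_simps sheafify_Cinf_simps(1) by (rule comp)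
    qed
  qed
  moreover have "rst ?S U V \<in> Cinf_hom (sections_Cinf ?S U) (sections_Cinf ?S V)"
    if "openin X U" "openin X V" "V \<subseteq> U" for U V
  proof (rule Cinf_homI, unfold sections_Cinf_simps)
    have eq: "(\<lambda>i\<in>{..<n}. \<sigma> i y) = (\<lambda>i\<in>{..<n}. (\<lambda>i\<in>{..<n}. restrict (\<sigma> i) V) i y)" if "y \<in> V" for n y and \<sigma> :: "nat \<Rightarrow> _"
      using that by auto
    fix n f and \<sigma> :: "nat \<Rightarrow> _"
    have "restrict (pop ?S U n f \<sigma>) V = (\<lambda>y\<in>V. stalk_op X F y n f (\<lambda>i\<in>{..<n}. \<sigma> i y))"
      using that by (simp add: Int_absorb1)
    also have "\<dots> = pop ?S V n f (\<lambda>i\<in>{..<n}. restrict (\<sigma> i) V)"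
      unfolding sheafify_Cinf_simps by (intro restrict_ext arg_cong [where f = "stalk_op X F _ n f"] eq)
    finally show "rst ?S U V (pop ?S U n f \<sigma>) = pop ?S V n f (\<lambda>i\<in>{..<n}. rst ?S U V (\<sigma> i))"
      by (simp only: sheafify_Cinf_simps)
  qed (simp only: sheafify_Cinf_simps germ_sections_restrict that)
  ultimately show ?thesis
    unfolding Cinf_presheaf_def by blast
qed

definition to_sheaf :: "'x topology \<Rightarrow> ('x, 'a, 'm) psh_scheme \<Rightarrow> 'x set \<Rightarrow> 'a \<Rightarrow> 'x \<Rightarrow> ('x, 'a) germ"
  where "to_sheaf X F U s = (\<lambda>y\<in>U. germ X F y U s)"

lemma to_sheaf_closed: "openin X U \<Longrightarrow> s \<in> sec F U \<Longrightarrow> to_sheaf X F U s \<in> germ_sections X F U"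
  unfolding germ_sections_def to_sheaf_def
  by (intro CollectI conjI ballI restrict_PiE_iff [THEN iffD2] exI [of _ U] bexI [of _ s])
    (simp_all add: germ_in_stalk)

lemma to_sheaf_rst:
  assumes "presheaf X F" "openin X U" "s \<in> sec F U" "openin X V" "V \<subseteq> U"
  shows "restrict (to_sheaf X F U s) V = to_sheaf X F V (rst F U V s)"
proof -
  have "to_sheaf X F U s y = germ X F y V (rst F U V s)" if "y \<in> V" for y
    using germ_rst [OF assms that] that assms(5) by (simp add: to_sheaf_def subsetD)
  then show ?thesis
    unfolding to_sheaf_def [of X F V] by (rule restrict_ext)
qed

lemma to_sheaf_Cinf_hom:
  assumes F: "Cinf_presheaf X F" and U: "openin X U"
  shows "to_sheaf X F U \<in> Cinf_hom (sections_Cinf F U) (sections_Cinf (sheafify_Cinf X F) U)"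
proof (rule Cinf_homI, unfold sections_Cinf_simps)
  fix n f s assume f: "f \<in> Cinf n" and s: "s \<in> {..<n} \<rightarrow>\<^sub>E sec F U"
  have "stalk_op X F y n f (\<lambda>i\<in>{..<n}. (\<lambda>i\<in>{..<n}. to_sheaf X F U (s i)) i y) = germ X F y U (pop F U n f s)"
    if y: "y \<in> U" for y
    by (rule stalk_op_germ [OF Cinf_presheafD(1) [OF F] natural_op_Cinf [OF F f] U y s])
      (simp add: to_sheaf_def y)
  then show "to_sheaf X F U (pop F U n f s) = pop (sheafify_Cinf X F) U n f (\<lambda>i\<in>{..<n}. to_sheaf X F U (s i))"
    unfolding sheafify_Cinf_simps to_sheaf_def [of X F U "pop F U n f s"]
    by (rule restrict_ext [OF sym])
qed (simp only: sheafify_Cinf_simps to_sheaf_closed [OF U])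

section \<open>Homotopy groups of simplicial \<open>C\<^sup>\<infinity>\<close>-rings\<close>

lemma level_simps [simp]: "carrier (level A k) = spx A k" "cop (level A k) = sop A k"
  by (simp_all add: level_def)

abbreviation lring :: "('a, 'm) scring_scheme \<Rightarrow> nat \<Rightarrow> 'a ring"
  where "lring A k \<equiv> underlying_ring (level A k)"

lemma simplicial_CinfD:
  assumes "simplicial_Cinf A"
  shows "Cinf_ring (level A k)"
    "\<theta> \<in> simplex_maps m n \<Longrightarrow> sact A m n \<theta> \<in> Cinf_hom (level A n) (level A m)"
    "s \<in> spx A n \<Longrightarrow> sact A n n (\<lambda>j\<in>{..n}. j) s = s"
    "\<theta> \<in> simplex_maps l m \<Longrightarrow> \<eta> \<in> simplex_maps m n \<Longrightarrow> s \<in> spx A n \<Longrightarrow>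
      sact A l m \<theta> (sact A m n \<eta> s) = sact A l n (compose {..l} \<eta> \<theta>) s"
  using assms by (simp_all add: simplicial_Cinf_def simplicial_set_def)

lemma coface_map: "coface k i \<in> simplex_maps k (Suc k)"
  by (auto simp: coface_def simplex_maps_def mono_on_def)

lemma face_hom: "simplicial_Cinf A \<Longrightarrow> face A k i \<in> Cinf_hom (level A (Suc k)) (level A k)"
  unfolding face_def by (rule simplicial_CinfD(2) [OF _ coface_map])

lemma base_map: "(\<lambda>j\<in>{..k}. 0) \<in> simplex_maps k 0"
  by (auto simp: simplex_maps_def mono_on_def)

lemma base_hom: "simplicial_Cinf A \<Longrightarrow> base A k \<in> Cinf_hom (level A 0) (level A k)"
  using simplicial_CinfD(2) [OF _ base_map] by (simp add: base_def [abs_def])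

lemma face_closed: "simplicial_Cinf A \<Longrightarrow> w \<in> spx A (Suc k) \<Longrightarrow> face A k i w \<in> spx A k"
  using Cinf_hom_closed [OF face_hom] by simp

lemma base_closed: "simplicial_Cinf A \<Longrightarrow> v \<in> spx A 0 \<Longrightarrow> base A k v \<in> spx A k"
  using Cinf_hom_closed [OF base_hom] by simp

lemma face_base:
  assumes A: "simplicial_Cinf A" and v: "v \<in> spx A 0"
  shows "face A k i (base A (Suc k) v) = base A k v"
proof -
  have "compose {..k} (\<lambda>j\<in>{..Suc k}. 0) (coface k i) = (\<lambda>j\<in>{..k}. 0 :: nat)"
    by (auto simp: compose_def coface_def)
  then show ?thesis
    using simplicial_CinfD(4) [OF A coface_map base_map v, of k i] by (simp add: face_def base_def)
qed

definition last_degeneracy :: "('a, 'm) sset_scheme \<Rightarrow> nat \<Rightarrow> 'a \<Rightarrow> 'a"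
  where "last_degeneracy S k = sact S (Suc k) k (\<lambda>j\<in>{..Suc k}. min j k)"

lemma last_degeneracy_map: "(\<lambda>j\<in>{..Suc k}. min j k) \<in> simplex_maps (Suc k) k"
  by (auto simp: simplex_maps_def mono_on_def)

lemma last_degeneracy_closed:
  "simplicial_Cinf A \<Longrightarrow> s \<in> spx A k \<Longrightarrow> last_degeneracy A k s \<in> spx A (Suc k)"
  unfolding last_degeneracy_def
  using Cinf_hom_closed [OF simplicial_CinfD(2) [OF _ last_degeneracy_map]] by simp

lemma last_degeneracy_base:
  assumes A: "simplicial_Cinf A" and v: "v \<in> spx A 0"
  shows "last_degeneracy A k (base A k v) = base A (Suc k) v"
proof -
  have "compose {..Suc k} (\<lambda>j\<in>{..k}. 0) (\<lambda>j\<in>{..Suc k}. min j k) = (\<lambda>j\<in>{..Suc k}. 0 :: nat)"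
    by (auto simp: compose_def)
  then show ?thesis
    using simplicial_CinfD(4) [OF A last_degeneracy_map base_map v, of k]
    by (simp add: last_degeneracy_def base_def)
qed

lemma face_last_degeneracy:
  assumes A: "simplicial_Cinf A" and s: "s \<in> spx A k" and i: "i = k \<or> i = Suc k"
  shows "face A k i (last_degeneracy A k s) = s"
proof -
  have "compose {..k} (\<lambda>j\<in>{..Suc k}. min j k) (coface k i) = (\<lambda>j\<in>{..k}. j)"
    using i by (auto simp: compose_def coface_def)
  then show ?thesis
    using simplicial_CinfD(4) [OF A coface_map last_degeneracy_map s, of i] simplicial_CinfD(3) [OF A s]
    by (simp add: face_def last_degeneracy_def)
qed

lemma face_last_degeneracy_lower:
  assumes A: "simplicial_Cinf A" and s: "s \<in> spx A (Suc l)" and i: "i \<le> l"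
  shows "face A (Suc l) i (last_degeneracy A (Suc l) s) = last_degeneracy A l (face A l i s)"
proof -
  have "compose {..Suc l} (\<lambda>j\<in>{..Suc (Suc l)}. min j (Suc l)) (coface (Suc l) i) =
        compose {..Suc l} (coface l i) (\<lambda>j\<in>{..Suc l}. min j l)"
    using i by (auto simp: compose_def coface_def fun_eq_iff)
  then show ?thesis
    using simplicial_CinfD(4) [OF A coface_map last_degeneracy_map s, of i]
      simplicial_CinfD(4) [OF A last_degeneracy_map coface_map s, of i]
    by (simp add: face_def last_degeneracy_def)
qed

subsection \<open>Smooth operations on spheres and homotopies\<close>

lemma spheres_iff:
  "s \<in> spheres A k v \<longleftrightarrow> s \<in> spx A k \<and> (\<forall>j i. k = Suc j \<longrightarrow> i \<le> k \<longrightarrow> face A j i s = base A j v)"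
  by (auto simp: spheres_def)

lemma spheres_spx: "s \<in> spheres A k v \<Longrightarrow> s \<in> spx A k"
  by (simp add: spheres_iff)

lemma homot_iff:
  "(s, t) \<in> homot A k v \<longleftrightarrow> s \<in> spheres A k v \<and> t \<in> spheres A k v \<and>
     (\<exists>w\<in>spx A (Suc k). (\<forall>i<k. face A k i w = base A k v) \<and> face A k k w = s \<and> face A k (Suc k) w = t)"
  by (simp add: homot_def)

lemma homot_spheres: "(s, t) \<in> homot A k v \<Longrightarrow> s \<in> spheres A k v" "(s, t) \<in> homot A k v \<Longrightarrow> t \<in> spheres A k v"
  by (simp_all add: homot_iff)

lemma tuple_hom_eq:
  assumes "h \<in> Cinf_hom A B" "f \<in> Cinf n" "a \<in> {..<n} \<rightarrow>\<^sub>E carrier A" "\<And>i. i < n \<Longrightarrow> h (a i) = b i" "b \<in> extensional {..<n}"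
  shows "h (cop A n f a) = cop B n f b"
proof -
  have "(\<lambda>i\<in>{..<n}. h (a i)) = b"
    using assms(4,5) by (intro ext) (auto simp: extensional_def)
  then show ?thesis
    using Cinf_hom_cop [OF assms(1-3)] by simp
qed

lemma spheres_op:
  assumes A: "simplicial_Cinf A" and f: "f \<in> Cinf n" and v: "v \<in> {..<n} \<rightarrow>\<^sub>E spx A 0"
    and s: "s \<in> extensional {..<n}" "\<And>i. i < n \<Longrightarrow> s i \<in> spheres A k (v i)"
  shows "sop A k n f s \<in> spheres A k (sop A 0 n f v)"
  unfolding spheres_iff
proof (intro conjI allI impI)
  have sk: "s \<in> {..<n} \<rightarrow>\<^sub>E spx A k"
    using spheres_spx [OF s(2)] s(1) by (simp add: PiE_iff)
  then show "sop A k n f s \<in> spx A k"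
    using cop_closed [OF simplicial_CinfD(1) [OF A] f, of s k] by simp
  fix j i assume k: "k = Suc j" "i \<le> k"
  have "face A j i (sop A k n f s) = sop A j n f (\<lambda>l\<in>{..<n}. base A j (v l))"
    using tuple_hom_eq [OF face_hom [OF A, of j i] f, of s "\<lambda>l\<in>{..<n}. base A j (v l)"] sk s(2) k
    by (simp add: spheres_iff)
  also have "\<dots> = base A j (sop A 0 n f v)"
    using Cinf_hom_cop [OF base_hom [OF A] f, of v j] v by simp
  finally show "face A j i (sop A k n f s) = base A j (sop A 0 n f v)" .
qed

text \<open>
  Faces are homomorphisms, so an operation applied to homotopies is a homotopy.  The base points may
  differ: multiplying by the degenerate simplices of a vertex \<open>\<rho>\<close>, which form a sphere based at
  \<open>\<rho>\<close>, is a case of this.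
\<close>

lemma homot_op:
  assumes A: "simplicial_Cinf A" and f: "f \<in> Cinf n" and v: "v \<in> {..<n} \<rightarrow>\<^sub>E spx A 0"
    and s: "s \<in> extensional {..<n}" and t: "t \<in> extensional {..<n}"
    and st: "\<And>i. i < n \<Longrightarrow> (s i, t i) \<in> homot A k (v i)"
  shows "(sop A k n f s, sop A k n f t) \<in> homot A k (sop A 0 n f v)"
proof -
  have "\<forall>i\<in>{..<n}. \<exists>w\<in>spx A (Suc k). (\<forall>j<k. face A k j w = base A k (v i)) \<and> face A k k w = s i \<and> face A k (Suc k) w = t i"
    using st by (simp add: homot_iff)
  then obtain w where w: "\<And>i. i < n \<Longrightarrow> w i \<in> spx A (Suc k) \<and> (\<forall>j<k. face A k j (w i) = base A k (v i)) \<and>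
      face A k k (w i) = s i \<and> face A k (Suc k) (w i) = t i"
    by (metis lessThan_iff)
  let ?w = "restrict w {..<n}"
  have wE: "?w \<in> {..<n} \<rightarrow>\<^sub>E carrier (level A (Suc k))"
    using w by simp
  have F: "face A k j (sop A (Suc k) n f ?w) = sop A k n f b"
    if "\<And>i. i < n \<Longrightarrow> face A k j (w i) = b i" "b \<in> extensional {..<n}" for j b
    using tuple_hom_eq [OF face_hom [OF A, of k j] f wE, of b] that by simp
  have "sop A (Suc k) n f ?w \<in> spx A (Suc k)"
    using cop_closed [OF simplicial_CinfD(1) [OF A] f wE] by simp
  moreover have "face A k j (sop A (Suc k) n f ?w) = base A k (sop A 0 n f v)" if "j < k" for j
    using F [of j "\<lambda>l\<in>{..<n}. base A k (v l)"] Cinf_hom_cop [OF base_hom [OF A] f, of v k] v w that by simp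
  moreover have "face A k k (sop A (Suc k) n f ?w) = sop A k n f s"
    using F [of k s] s w by simp
  moreover have "face A k (Suc k) (sop A (Suc k) n f ?w) = sop A k n f t"
    using F [of "Suc k" t] t w by simp
  moreover have "sop A k n f s \<in> spheres A k (sop A 0 n f v)"
    by (rule spheres_op [OF A f v s homot_spheres(1) [OF st]])
  moreover have "sop A k n f t \<in> spheres A k (sop A 0 n f v)"
    by (rule spheres_op [OF A f v t homot_spheres(2) [OF st]])
  ultimately show ?thesis
    unfolding homot_iff by blast
qed

lemma base_sphere: "simplicial_Cinf A \<Longrightarrow> v \<in> spx A 0 \<Longrightarrow> base A k v \<in> spheres A k v"
  by (simp add: spheres_iff base_closed face_base)

text \<open>
  The last degeneracy of \<open>s\<close> is a homotopy from \<open>s\<close> to itself.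
\<close>

lemma homot_refl:
  assumes A: "simplicial_Cinf A" and v: "v \<in> spx A 0" and s: "s \<in> spheres A k v"
  shows "(s, s) \<in> homot A k v"
proof -
  have sk: "s \<in> spx A k" using s by (rule spheres_spx)
  have "face A k i (last_degeneracy A k s) = base A k v" if i: "i < k" for i
  proof -
    obtain l where l: "k = Suc l" using i by (cases k) auto
    have "face A l i s = base A l v"
      using s i unfolding spheres_iff l by simp
    then show ?thesis
      using face_last_degeneracy_lower [OF A, of s l i] sk i l last_degeneracy_base [OF A v, of l] by simp
  qed
  then show ?thesis
    unfolding homot_iff using s face_last_degeneracy [OF A sk] last_degeneracy_closed [OF A sk] by blast
qed

lemma underlying_binary_ops:
  assumes "Cinf_ring A" "a \<in> carrier A" "b \<in> carrier A"
  shows "a \<oplus>\<^bsub>underlying_ring A\<^esub> b = cop A 2 (\<lambda>x\<in>Rn 2. x 0 + x 1) (pair_fun a b)"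
    "a \<otimes>\<^bsub>underlying_ring A\<^esub> b = cop A 2 (\<lambda>x\<in>Rn 2. x 0 * x 1) (pair_fun a b)"
    "a \<ominus>\<^bsub>underlying_ring A\<^esub> b = cop A 2 (\<lambda>x\<in>Rn 2. x 0 - x 1) (pair_fun a b)"
proof -
  have p: "pair_fun a b \<in> {..<2} \<rightarrow>\<^sub>E carrier A"
    using assms by (simp add: pair_fun_closed)
  show "a \<ominus>\<^bsub>underlying_ring A\<^esub> b = cop A 2 (\<lambda>x\<in>Rn 2. x 0 - x 1) (pair_fun a b)"
    using smooth_op_minus [OF assms(1) smooth_proj smooth_proj p, of 0 1]
      smooth_op_proj [OF assms(1) _ p, of 0] smooth_op_proj [OF assms(1) _ p, of 1]
    by (simp add: smooth_op_def)
qed (simp_all add: underlying_ring_def)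

lemma binary_Cinf:
  "(\<lambda>x\<in>Rn 2. x 0 + x 1) \<in> Cinf 2" "(\<lambda>x\<in>Rn 2. x 0 * x 1) \<in> Cinf 2" "(\<lambda>x\<in>Rn 2. x 0 - x 1) \<in> Cinf 2"
  by (intro restrict_Cinf smooth_add smooth_mult smooth_diff smooth_proj)+

lemma pair_fun_ext: "pair_fun a b \<in> extensional {..<2}"
  by (simp add: pair_fun_def)

lemma homot_binary:
  assumes A: "simplicial_Cinf A" and v: "v \<in> spx A 0" "v' \<in> spx A 0"
    and st: "(s, t) \<in> homot A k v" "(s', t') \<in> homot A k v'"
  shows "(s \<oplus>\<^bsub>lring A k\<^esub> s', t \<oplus>\<^bsub>lring A k\<^esub> t') \<in> homot A k (v \<oplus>\<^bsub>lring A 0\<^esub> v')"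
    "(s \<otimes>\<^bsub>lring A k\<^esub> s', t \<otimes>\<^bsub>lring A k\<^esub> t') \<in> homot A k (v \<otimes>\<^bsub>lring A 0\<^esub> v')"
    "(s \<ominus>\<^bsub>lring A k\<^esub> s', t \<ominus>\<^bsub>lring A k\<^esub> t') \<in> homot A k (v \<ominus>\<^bsub>lring A 0\<^esub> v')"
proof -
  have c: "s \<in> spx A k" "t \<in> spx A k" "s' \<in> spx A k" "t' \<in> spx A k"
    using st homot_spheres spheres_spx by metis+
  have "(pair_fun s s' i, pair_fun t t' i) \<in> homot A k (pair_fun v v' i)" if "i < 2" for i
    using st that by (simp add: pair_fun_def)
  then have "(sop A k 2 f (pair_fun s s'), sop A k 2 f (pair_fun t t')) \<in> homot A k (sop A 0 2 f (pair_fun v v'))"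
    if "f \<in> Cinf 2" for f
    using v by (intro homot_op [OF A that] pair_fun_ext pair_fun_closed)
  from this [OF binary_Cinf(1)] this [OF binary_Cinf(2)] this [OF binary_Cinf(3)]
  show "(s \<oplus>\<^bsub>lring A k\<^esub> s', t \<oplus>\<^bsub>lring A k\<^esub> t') \<in> homot A k (v \<oplus>\<^bsub>lring A 0\<^esub> v')"
    "(s \<otimes>\<^bsub>lring A k\<^esub> s', t \<otimes>\<^bsub>lring A k\<^esub> t') \<in> homot A k (v \<otimes>\<^bsub>lring A 0\<^esub> v')"
    "(s \<ominus>\<^bsub>lring A k\<^esub> s', t \<ominus>\<^bsub>lring A k\<^esub> t') \<in> homot A k (v \<ominus>\<^bsub>lring A 0\<^esub> v')"
    using c v by (simp_all add: underlying_binary_ops simplicial_CinfD(1) [OF A])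
qed

lemma (in ring) maltsev_laws:
  assumes "a \<in> carrier R" "b \<in> carrier R"
  shows "(a \<ominus> b) \<oplus> b = a" "(a \<ominus> a) \<oplus> b = b"
  using assms by algebra+

text \<open>
  A reflexive relation compatible with the operation \<open>x - y + z\<close> is an equivalence relation.  This
  applies at every base point, because \<open>v - v + v = v\<close>.
\<close>

lemma homot_maltsev:
  assumes A: "simplicial_Cinf A" and v: "v \<in> spx A 0"
    and "(s, s') \<in> homot A k v" "(t, t') \<in> homot A k v" "(u, u') \<in> homot A k v"
  shows "((s \<ominus>\<^bsub>lring A k\<^esub> t) \<oplus>\<^bsub>lring A k\<^esub> u, (s' \<ominus>\<^bsub>lring A k\<^esub> t') \<oplus>\<^bsub>lring A k\<^esub> u') \<in> homot A k v"
proof -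
  interpret cring "lring A 0" by (rule cring_underlying [OF simplicial_CinfD(1) [OF A]])
  have "v \<ominus>\<^bsub>lring A 0\<^esub> v \<in> spx A 0"
    using underlying_closed(3) [OF simplicial_CinfD(1) [OF A], of v 0 v] v by simp
  then have "((s \<ominus>\<^bsub>lring A k\<^esub> t) \<oplus>\<^bsub>lring A k\<^esub> u, (s' \<ominus>\<^bsub>lring A k\<^esub> t') \<oplus>\<^bsub>lring A k\<^esub> u')
      \<in> homot A k ((v \<ominus>\<^bsub>lring A 0\<^esub> v) \<oplus>\<^bsub>lring A 0\<^esub> v)"
    by (intro homot_binary A v assms)
  then show ?thesis
    using maltsev_laws(1) [of v v] v by simp
qed

lemma equiv_homot:
  assumes A: "simplicial_Cinf A" and v: "v \<in> spx A 0"
  shows "equiv (spheres A k v) (homot A k v)"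
proof (rule equivI)
  interpret cring "lring A k" by (rule cring_underlying [OF simplicial_CinfD(1) [OF A]])
  have c: "s \<in> carrier (lring A k)" if "s \<in> spheres A k v" for s
    using spheres_spx [OF that] by simp
  show "homot A k v \<subseteq> spheres A k v \<times> spheres A k v"
    using homot_spheres by (auto dest: homot_spheres)
  show "refl_on (spheres A k v) (homot A k v)"
    by (rule refl_onI) (rule homot_refl [OF A v])
  show "sym (homot A k v)"
  proof (rule symI)
    fix s t assume st: "(s, t) \<in> homot A k v"
    note sp = homot_spheres [OF st]
    show "(t, s) \<in> homot A k v"
      using homot_maltsev [OF A v homot_refl [OF A v sp(1)] st homot_refl [OF A v sp(2)]]
        maltsev_laws [OF c [OF sp(1)] c [OF sp(2)]] by simp
  qed
  show "trans (homot A k v)"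
  proof (rule transI)
    fix s t u assume st: "(s, t) \<in> homot A k v" and tu: "(t, u) \<in> homot A k v"
    note sp = homot_spheres [OF st] homot_spheres [OF tu]
    show "(s, u) \<in> homot A k v"
      using homot_maltsev [OF A v st homot_refl [OF A v sp(2)] tu]
        maltsev_laws(1) [OF c [OF sp(1)] c [OF sp(2)]] maltsev_laws(2) [OF c [OF sp(2)] c [OF sp(4)]] by simp
  qed
qed

subsection \<open>Homotopy classes and induced maps\<close>

abbreviation hclass :: "('a, 'm) sset_scheme \<Rightarrow> nat \<Rightarrow> 'a \<Rightarrow> 'a \<Rightarrow> 'a set"
  where "hclass A k v s \<equiv> homot A k v `` {s}"

lemma hclass_eq_iff:
  assumes "simplicial_Cinf A" "v \<in> spx A 0" "s \<in> spheres A k v" "t \<in> spheres A k v"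
  shows "hclass A k v s = hclass A k v t \<longleftrightarrow> (s, t) \<in> homot A k v"
  using eq_equiv_class_iff [OF equiv_homot [OF assms(1,2)] assms(3,4)] .

lemma hclass_in_pi: "s \<in> spheres A k v \<Longrightarrow> hclass A k v s \<in> pi_set A k v"
  unfolding pi_set_def by (rule quotientI)

lemma pi_setE:
  assumes "c \<in> pi_set A k v"
  obtains s where "s \<in> spheres A k v" "c = hclass A k v s"
  using assms unfolding pi_set_def by (rule quotientE)

lemma scring_homD:
  assumes "h \<in> scring_hom A B"
  shows "h k \<in> Cinf_hom (level A k) (level B k)" "a \<in> spx A k \<Longrightarrow> h k a \<in> spx B k"
    "\<theta> \<in> simplex_maps m n \<Longrightarrow> a \<in> spx A n \<Longrightarrow> h m (sact A m n \<theta> a) = sact B m n \<theta> (h n a)"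
    "w \<in> spx A (Suc k) \<Longrightarrow> h k (face A k i w) = face B k i (h (Suc k) w)"
    "v \<in> spx A 0 \<Longrightarrow> h k (base A k v) = base B k (h 0 v)"
proof -
  show h: "h k \<in> Cinf_hom (level A k) (level B k)" for k
    using assms by (simp add: scring_hom_def)
  show "a \<in> spx A k \<Longrightarrow> h k a \<in> spx B k"
    using Cinf_hom_closed [OF h, of a k] by simp
  show act: "\<theta> \<in> simplex_maps m n \<Longrightarrow> a \<in> spx A n \<Longrightarrow> h m (sact A m n \<theta> a) = sact B m n \<theta> (h n a)" for \<theta> m n a
    using assms by (simp add: scring_hom_def)
  show "w \<in> spx A (Suc k) \<Longrightarrow> h k (face A k i w) = face B k i (h (Suc k) w)"
    unfolding face_def by (rule act [OF coface_map])
  show "v \<in> spx A 0 \<Longrightarrow> h k (base A k v) = base B k (h 0 v)"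
    unfolding base_def by (rule act [OF base_map])
qed

lemma spheres_hom:
  assumes h: "h \<in> scring_hom A B" and v: "v \<in> spx A 0" and s: "s \<in> spheres A k v"
  shows "h k s \<in> spheres B k (h 0 v)"
  unfolding spheres_iff
proof (intro conjI allI impI)
  show "h k s \<in> spx B k"
    by (rule scring_homD(2) [OF h spheres_spx [OF s]])
  fix j i assume k: "k = Suc j" "i \<le> k"
  have "face B j i (h k s) = h j (face A j i s)"
    using scring_homD(4) [OF h, of s j i] spheres_spx [OF s] k by simp
  also have "face A j i s = base A j v"
    using s k by (simp add: spheres_iff)
  finally show "face B j i (h k s) = base B j (h 0 v)"
    using scring_homD(5) [OF h v] by simp
qed

lemma homot_hom:
  assumes h: "h \<in> scring_hom A B" and v: "v \<in> spx A 0" and st: "(s, t) \<in> homot A k v"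
  shows "(h k s, h k t) \<in> homot B k (h 0 v)"
proof -
  obtain w where w: "w \<in> spx A (Suc k)" "\<And>i. i < k \<Longrightarrow> face A k i w = base A k v" "face A k k w = s" "face A k (Suc k) w = t"
    using st unfolding homot_iff by blast
  have "h (Suc k) w \<in> spx B (Suc k)"
    by (rule scring_homD(2) [OF h w(1)])
  moreover have "face B k i (h (Suc k) w) = base B k (h 0 v)" if "i < k" for i
    using scring_homD(4) [OF h w(1), of i] scring_homD(5) [OF h v, of k] w(2) [OF that] by simp
  moreover have "face B k k (h (Suc k) w) = h k s" "face B k (Suc k) (h (Suc k) w) = h k t"
    using scring_homD(4) [OF h w(1)] w by metis+
  ultimately show ?thesis
    unfolding homot_iff using spheres_hom [OF h v] homot_spheres [OF st] by blast
qed

lemma pi_map_hclass: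
  assumes A: "simplicial_Cinf A" and B: "simplicial_Cinf B" and h: "h \<in> scring_hom A B"
    and v: "v \<in> spx A 0" and s: "s \<in> spheres A k v"
  shows "pi_map B k (h 0 v) h (hclass A k v s) = hclass B k (h 0 v) (h k s)"
proof -
  have w: "h 0 v \<in> spx B 0" by (rule scring_homD(2) [OF h v])
  have "hclass B k (h 0 v) (h k s') = hclass B k (h 0 v) (h k s)" if "(s, s') \<in> homot A k v" for s'
    using homot_hom [OF h v that] homot_spheres [OF that] spheres_hom [OF h v]
    by (simp add: hclass_eq_iff [OF B w] equivE [OF equiv_homot [OF B w]] sym_def)
       (metis equiv_homot [OF B w] equivE symE)
  moreover have "(s, s) \<in> homot A k v"
    by (rule homot_refl [OF A v s])
  moreover have "pi_map B k (h 0 v) h (hclass A k v s) = (\<Union>s'\<in>homot A k v `` {s}. hclass B k (h 0 v) (h k s'))"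
    unfolding pi_map_def by blast
  ultimately show ?thesis by blast
qed

lemma szero_closed: "simplicial_Cinf A \<Longrightarrow> szero A \<in> spx A 0"
  using underlying_zero_one_closed(1) [OF simplicial_CinfD(1), of A 0] by (simp add: szero_def)

lemma szero_hom: "h \<in> scring_hom A B \<Longrightarrow> h 0 (szero A) = szero B"
  using Cinf_hom_const [OF scring_homD(1), of h A B 0 0] by (simp add: szero_def zero_underlying)

lemma spheres_0: "spheres A 0 v = spx A 0"
  by (simp add: spheres_def)

lemma homot_0: "homot A 0 v = homot A 0 w"
  by (simp add: homot_def spheres_0)

subsection \<open>The \<open>C\<^sup>\<infinity>\<close>-ring \<open>\<pi>\<^sub>0\<close>\<close>

abbreviation comp_class :: "('a, 'm) scring_scheme \<Rightarrow> 'a \<Rightarrow> 'a set"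
  where "comp_class A \<equiv> hclass A 0 (szero A)"

text \<open>
  As for stalks, the composition law for \<open>\<pi>\<^sub>0\<close> involves elements of \<open>Cinf n\<close> and their composites, and
  this property holds for both.
\<close>

definition class_op :: "('a, 'm) scring_scheme \<Rightarrow> nat \<Rightarrow> rfun \<Rightarrow> bool" where
  "class_op A n f \<longleftrightarrow> (\<forall>a\<in>{..<n} \<rightarrow>\<^sub>E spx A 0. \<forall>b\<in>{..<n} \<rightarrow>\<^sub>E spx A 0.
     (\<forall>i<n. (a i, b i) \<in> homot A 0 (szero A)) \<longrightarrow> (sop A 0 n f a, sop A 0 n f b) \<in> homot A 0 (szero A))"

lemma class_op_Cinf:
  assumes A: "simplicial_Cinf A" and f: "f \<in> Cinf n"
  shows "class_op A n f"
  unfolding class_op_def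
proof (intro ballI impI)
  fix a b assume a: "a \<in> {..<n} \<rightarrow>\<^sub>E spx A 0" and b: "b \<in> {..<n} \<rightarrow>\<^sub>E spx A 0"
    and ab: "\<forall>i<n. (a i, b i) \<in> homot A 0 (szero A)"
  have "(sop A 0 n f a, sop A 0 n f b) \<in> homot A 0 (sop A 0 n f a)"
    using a b ab homot_0 [of A "szero A"] by (intro homot_op [OF A f a]) (auto simp: PiE_iff)
  then show "(sop A 0 n f a, sop A 0 n f b) \<in> homot A 0 (szero A)"
    using homot_0 by metis
qed

lemma class_op_scomp:
  assumes A: "simplicial_Cinf A" and f: "f \<in> Cinf m" and g: "\<And>j. j < m \<Longrightarrow> g j \<in> Cinf n"
  shows "class_op A n (scomp n m f g)"
  unfolding class_op_def
proof (intro ballI impI)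
  fix a b assume a: "a \<in> {..<n} \<rightarrow>\<^sub>E spx A 0" and b: "b \<in> {..<n} \<rightarrow>\<^sub>E spx A 0"
    and ab: "\<forall>i<n. (a i, b i) \<in> homot A 0 (szero A)"
  have g': "(\<lambda>j\<in>{..<m}. sop A 0 n (g j) c) \<in> {..<m} \<rightarrow>\<^sub>E spx A 0" if "c \<in> {..<n} \<rightarrow>\<^sub>E spx A 0" for c
    using cop_closed [OF simplicial_CinfD(1) [OF A] g, where k2 = 0 and a = c] that by simp
  have "(sop A 0 n (g j) a, sop A 0 n (g j) b) \<in> homot A 0 (szero A)" if "j < m" for j
    using class_op_Cinf [OF A g [OF that]] a b ab by (simp add: class_op_def)
  then have "(sop A 0 m f (\<lambda>j\<in>{..<m}. sop A 0 n (g j) a), sop A 0 m f (\<lambda>j\<in>{..<m}. sop A 0 n (g j) b))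
      \<in> homot A 0 (szero A)"
    using class_op_Cinf [OF A f] g' [OF a] g' [OF b] by (simp add: class_op_def)
  moreover have "sop A 0 n (scomp n m f g) c = sop A 0 m f (\<lambda>j\<in>{..<m}. sop A 0 n (g j) c)"
    if "c \<in> {..<n} \<rightarrow>\<^sub>E spx A 0" for c
    using cop_scomp [OF simplicial_CinfD(1) [OF A] f g, where k2 = 0 and a = c] that by simp
  ultimately show "(sop A 0 n (scomp n m f g) a, sop A 0 n (scomp n m f g) b) \<in> homot A 0 (szero A)"
    using a b by simp
qed

lemma pi0_op_class:
  assumes A: "simplicial_Cinf A" and f: "class_op A n f" and a: "a \<in> {..<n} \<rightarrow>\<^sub>E spx A 0"
    and c: "\<And>i. i < n \<Longrightarrow> c i = comp_class A (a i)"
  shows "pi0_op A n f c = comp_class A (sop A 0 n f a)"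
proof -
  let ?b = "\<lambda>i\<in>{..<n}. SOME b. b \<in> c i"
  note z = szero_closed [OF A]
  have b: "(a i, ?b i) \<in> homot A 0 (szero A)" if i: "i < n" for i
  proof -
    have "a i \<in> c i"
      using homot_refl [OF A z, of "a i" 0] a i c by (auto simp: spheres_0)
    then have "(SOME b. b \<in> c i) \<in> c i" by (rule someI)
    then show ?thesis using i c by simp
  qed
  then have "?b \<in> {..<n} \<rightarrow>\<^sub>E spx A 0"
    using homot_spheres(2) [OF b] by (auto simp: PiE_iff spheres_0)
  with f a b have "(sop A 0 n f a, sop A 0 n f ?b) \<in> homot A 0 (szero A)"
    by (simp add: class_op_def)
  then show ?thesis
    unfolding pi0_op_def using equiv_class_eq [OF equiv_homot [OF A z]] by metis
qed

lemma comp_class_tuple: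
  fixes n :: nat
  assumes "c \<in> {..<n} \<rightarrow>\<^sub>E pi_ring A 0"
  obtains a where "a \<in> {..<n} \<rightarrow>\<^sub>E spx A 0" "\<And>i. i < n \<Longrightarrow> c i = comp_class A (a i)"
proof -
  have "\<forall>i\<in>{..<n}. \<exists>a\<in>spx A 0. c i = comp_class A a"
  proof
    fix i assume "i \<in> {..<n}"
    then have "c i \<in> pi_ring A 0" using assms by auto
    then show "\<exists>a\<in>spx A 0. c i = comp_class A a"
      by (rule pi_setE) (auto simp: spheres_0)
  qed
  then obtain a where "\<And>i. i < n \<Longrightarrow> a i \<in> spx A 0 \<and> c i = comp_class A (a i)"
    by (metis lessThan_iff)
  then show ?thesis
    using that [of "restrict a {..<n}"] by simp
qed

lemma comp_class_closed: "a \<in> spx A 0 \<Longrightarrow> comp_class A a \<in> pi_ring A 0"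
  by (rule hclass_in_pi) (simp add: spheres_0)

lemma pi0_Cinf_simps [simp]: "carrier (pi0_Cinf A) = pi_ring A 0" "cop (pi0_Cinf A) = pi0_op A"
  by (simp_all add: pi0_Cinf_def)

lemma pi0_Cinf_ring:
  assumes A: "simplicial_Cinf A"
  shows "Cinf_ring (pi0_Cinf A)"
proof (rule Cinf_ringI, unfold pi0_Cinf_simps)
  note L = simplicial_CinfD(1) [OF A, of 0]
  fix n f c assume f: "f \<in> Cinf n" and c: "c \<in> {..<n} \<rightarrow>\<^sub>E pi_ring A 0"
  obtain a where a: "a \<in> {..<n} \<rightarrow>\<^sub>E spx A 0" "\<And>i. i < n \<Longrightarrow> c i = comp_class A (a i)"
    using comp_class_tuple [OF c] by metis
  have "sop A 0 n f a \<in> spx A 0"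
    using cop_closed [OF L f, of a] a(1) by simp
  moreover have "pi0_op A n f c = comp_class A (sop A 0 n f a)"
    by (rule pi0_op_class [OF A class_op_Cinf [OF A f] a])
  ultimately show "pi0_op A n f c \<in> pi_ring A 0"
    by (simp add: comp_class_closed)
next
  note L = simplicial_CinfD(1) [OF A, of 0]
  fix n i :: nat and c assume i: "i < n" and c: "c \<in> {..<n} \<rightarrow>\<^sub>E pi_ring A 0"
  obtain a where a: "a \<in> {..<n} \<rightarrow>\<^sub>E spx A 0" "\<And>i. i < n \<Longrightarrow> c i = comp_class A (a i)"
    using comp_class_tuple [OF c] by metis
  have "sop A 0 n (\<lambda>x\<in>Rn n. x i) a = a i"
    using smooth_op_proj [OF L i, of a] a(1) by (simp add: smooth_op_def)
  moreover have "pi0_op A n (\<lambda>x\<in>Rn n. x i) c = comp_class A (sop A 0 n (\<lambda>x\<in>Rn n. x i) a)"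
    by (rule pi0_op_class [OF A class_op_Cinf [OF A restrict_Cinf [OF smooth_proj]] a])
  ultimately show "pi0_op A n (\<lambda>x\<in>Rn n. x i) c = c i"
    using a(2) [OF i] by simp
next
  note L = simplicial_CinfD(1) [OF A, of 0]
  fix n m f g c assume f: "f \<in> Cinf m" and g: "\<And>j. j < m \<Longrightarrow> g j \<in> Cinf n" and c: "c \<in> {..<n} \<rightarrow>\<^sub>E pi_ring A 0"
  obtain a where a: "a \<in> {..<n} \<rightarrow>\<^sub>E spx A 0" "\<And>i. i < n \<Longrightarrow> c i = comp_class A (a i)"
    using comp_class_tuple [OF c] by metis
  let ?b = "\<lambda>j\<in>{..<m}. sop A 0 n (g j) a"
  have b: "?b \<in> {..<m} \<rightarrow>\<^sub>E spx A 0"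
    using cop_closed [OF L g, where a = a] a(1) by simp
  have "pi0_op A n (g j) c = comp_class A (?b j)" if "j < m" for j
    using pi0_op_class [OF A class_op_Cinf [OF A g [OF that]] a] that by simp
  then have "pi0_op A m f (\<lambda>j\<in>{..<m}. pi0_op A n (g j) c) = comp_class A (sop A 0 m f ?b)"
    by (intro pi0_op_class [OF A class_op_Cinf [OF A f] b]) simp
  also have "sop A 0 m f ?b = sop A 0 n (scomp n m f g) a"
    using cop_scomp [OF L f g, where a = a] a(1) by simp
  also have "comp_class A \<dots> = pi0_op A n (scomp n m f g) c"
    using pi0_op_class [OF A class_op_scomp [OF A f g] a] by simp
  finally show "pi0_op A n (scomp n m f g) c = pi0_op A m f (\<lambda>j\<in>{..<m}. pi0_op A n (g j) c)"
    by (rule sym)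
qed

lemma comp_class_Cinf_hom:
  assumes A: "simplicial_Cinf A"
  shows "comp_class A \<in> Cinf_hom (level A 0) (pi0_Cinf A)"
proof (rule Cinf_homI, unfold pi0_Cinf_simps level_simps)
  fix n f a assume f: "f \<in> Cinf n" and a: "a \<in> {..<n} \<rightarrow>\<^sub>E spx A 0"
  show "comp_class A (sop A 0 n f a) = pi0_op A n f (\<lambda>i\<in>{..<n}. comp_class A (a i))"
    using pi0_op_class [OF A class_op_Cinf [OF A f] a] by simp
qed (rule comp_class_closed)

lemma pi0_map_Cinf_hom:
  assumes A: "simplicial_Cinf A" and B: "simplicial_Cinf B" and h: "h \<in> scring_hom A B"
  shows "pi_map B 0 (szero B) h \<in> Cinf_hom (pi0_Cinf A) (pi0_Cinf B)"
proof -
  have cl: "pi_map B 0 (szero B) h (comp_class A a) = comp_class B (h 0 a)" if "a \<in> spx A 0" for a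
    using pi_map_hclass [OF A B h szero_closed [OF A], of a 0] that by (simp add: spheres_0 szero_hom [OF h])
  show ?thesis
  proof (rule Cinf_homI, unfold pi0_Cinf_simps)
    fix c assume "c \<in> pi_ring A 0"
    then obtain a where a: "a \<in> spx A 0" "c = comp_class A a"
      by (rule pi_setE) (auto simp: spheres_0)
    show "pi_map B 0 (szero B) h c \<in> pi_ring B 0"
      unfolding a(2) cl [OF a(1)] by (rule comp_class_closed [OF scring_homD(2) [OF h a(1)]])
  next
    fix n f c assume f: "f \<in> Cinf n" and c: "c \<in> {..<n} \<rightarrow>\<^sub>E pi_ring A 0"
    obtain a where a: "a \<in> {..<n} \<rightarrow>\<^sub>E spx A 0" "\<And>i. i < n \<Longrightarrow> c i = comp_class A (a i)"
      using comp_class_tuple [OF c] by metis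
    have ai: "a i \<in> spx A 0" if "i < n" for i
      using a(1) that by auto
    have fa: "sop A 0 n f a \<in> spx A 0"
      using cop_closed [OF simplicial_CinfD(1) [OF A] f, of a 0] a(1) by simp
    have hE: "(\<lambda>i\<in>{..<n}. h 0 (a i)) \<in> {..<n} \<rightarrow>\<^sub>E spx B 0"
      using ai scring_homD(2) [OF h] by simp
    have "pi0_op A n f c = comp_class A (sop A 0 n f a)"
      by (rule pi0_op_class [OF A class_op_Cinf [OF A f] a])
    then have "pi_map B 0 (szero B) h (pi0_op A n f c) = comp_class B (h 0 (sop A 0 n f a))"
      using cl [OF fa] by simp
    also have "h 0 (sop A 0 n f a) = sop B 0 n f (\<lambda>i\<in>{..<n}. h 0 (a i))"
      using Cinf_hom_cop [OF scring_homD(1) [OF h] f, of a] a(1) by simp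
    also have "comp_class B \<dots> = pi0_op B n f (\<lambda>i\<in>{..<n}. pi_map B 0 (szero B) h (c i))"
      using a(2) cl ai by (intro pi0_op_class [OF B class_op_Cinf [OF B f] hE, symmetric]) simp
    finally show "pi_map B 0 (szero B) h (pi0_op A n f c) = pi0_op B n f (\<lambda>i\<in>{..<n}. pi_map B 0 (szero B) h (c i))" .
  qed
qed

section \<open>Gluing in sheaves\<close>

lemma sheaf_presheaf: "sheaf X F \<Longrightarrow> presheaf X F"
  by (simp add: sheaf_def)

lemma sheaf_unique:
  assumes F: "sheaf X F" and \<U>: "\<And>U. U \<in> \<U> \<Longrightarrow> openin X U"
    and s: "s \<in> sec F (\<Union>\<U>)" and t: "t \<in> sec F (\<Union>\<U>)"
    and eq: "\<And>U. U \<in> \<U> \<Longrightarrow> rst F (\<Union>\<U>) U s = rst F (\<Union>\<U>) U t"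
  shows "s = t"
proof -
  note P = sheaf_presheaf [OF F]
  have O: "openin X (\<Union>\<U>)" using \<U> by blast
  have "\<exists>!t. t \<in> sec F (\<Union>\<U>) \<and> (\<forall>U\<in>\<U>. rst F (\<Union>\<U>) U t = rst F (\<Union>\<U>) U s)"
  proof -
    have "\<forall>U\<in>\<U>. openin X U \<and> rst F (\<Union>\<U>) U s \<in> sec F U"
      using \<U> presheaf_rst_closed [OF P O _ _ s] by (simp add: Union_upper)
    moreover have "\<forall>U\<in>\<U>. \<forall>V\<in>\<U>. rst F U (U \<inter> V) (rst F (\<Union>\<U>) U s) = rst F V (U \<inter> V) (rst F (\<Union>\<U>) V s)"
      using \<U> presheaf_rst_rst [OF P O _ _ _ _ s] by (simp add: Union_upper openin_Int)
    ultimately show ?thesis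
      using F unfolding sheaf_def by (elim conjE allE [of _ \<U>] allE [of _ "\<lambda>U. rst F (\<Union>\<U>) U s"]) blast
  qed
  then show ?thesis
    using s t eq by (metis (no_types, lifting))
qed

lemma sheaf_eq_germs:
  assumes F: "sheaf X F" and U: "openin X U" and s: "s \<in> sec F U" and t: "t \<in> sec F U"
    and eq: "\<And>y. y \<in> U \<Longrightarrow> germ X F y U s = germ X F y U t"
  shows "s = t"
proof -
  define \<U> where "\<U> = {W. openin X W \<and> W \<subseteq> U \<and> rst F U W s = rst F U W t}"
  have "\<Union>\<U> = U"
  proof (intro equalityI subsetI)
    fix y assume y: "y \<in> U"
    obtain W where "openin X W" "y \<in> W" "W \<subseteq> U" "rst F U W s = rst F U W t"
      using germ_eqE [OF sheaf_presheaf [OF F] eq [OF y] U y t] by metis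
    then show "y \<in> \<Union>\<U>" by (auto simp: \<U>_def)
  qed (auto simp: \<U>_def)
  then show ?thesis
    using sheaf_unique [OF F, of \<U> s t] s t by (simp add: \<U>_def)
qed

lemma sheaf_glue:
  assumes F: "sheaf X F" and U: "\<And>i. i \<in> I \<Longrightarrow> openin X (U i)" and s: "\<And>i. i \<in> I \<Longrightarrow> s i \<in> sec F (U i)"
    and eq: "\<And>i j. i \<in> I \<Longrightarrow> j \<in> I \<Longrightarrow> rst F (U i) (U i \<inter> U j) (s i) = rst F (U j) (U i \<inter> U j) (s j)"
  obtains t where "t \<in> sec F (\<Union>(U ` I))" "\<And>i. i \<in> I \<Longrightarrow> rst F (\<Union>(U ` I)) (U i) t = s i"
proof -
  \<comment> \<open>The sheaf condition is about families indexed by open sets; members of the cover that are equal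
    carry equal sections, so \<open>s\<close> is such a family.\<close>
  define s' where "s' = (\<lambda>V. s (SOME i. i \<in> I \<and> U i = V))"
  have s': "s' (U i) = s i" if i: "i \<in> I" for i
  proof -
    define j where "j = (SOME j. j \<in> I \<and> U j = U i)"
    have j: "j \<in> I" "U j = U i"
      using someI [of "\<lambda>j. j \<in> I \<and> U j = U i" i] i unfolding j_def by blast+
    have "s j = s i"
      using eq [OF j(1) i] presheaf_rst_id [OF sheaf_presheaf [OF F] U [OF i]] s [OF i] s [OF j(1)] j(2) by simp
    then show ?thesis by (simp add: s'_def j_def)
  qed
  have "\<forall>V\<in>U ` I. openin X V \<and> s' V \<in> sec F V"
    using U s s' by simp
  moreover have "\<forall>V\<in>U ` I. \<forall>W\<in>U ` I. rst F V (V \<inter> W) (s' V) = rst F W (V \<inter> W) (s' W)"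
  proof (intro ballI)
    fix V W assume "V \<in> U ` I" "W \<in> U ` I"
    then obtain i j where "i \<in> I" "V = U i" "j \<in> I" "W = U j" by blast
    then show "rst F V (V \<inter> W) (s' V) = rst F W (V \<inter> W) (s' W)"
      using eq [of i j] s' by simp
  qed
  ultimately have "\<exists>!t. t \<in> sec F (\<Union>(U ` I)) \<and> (\<forall>V\<in>U ` I. rst F (\<Union>(U ` I)) V t = s' V)"
    using F unfolding sheaf_def by (elim conjE allE [of _ "U ` I"] allE [of _ s']) blast
  then obtain t where "t \<in> sec F (\<Union>(U ` I))" "\<forall>V\<in>U ` I. rst F (\<Union>(U ` I)) V t = s' V"
    by blast
  with s' that show ?thesis by simp
qed

lemma sheaf_glue2:
  assumes F: "sheaf X F" and U: "openin X U" "s \<in> sec F U" and V: "openin X V" "t \<in> sec F V"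
    and eq: "rst F U (U \<inter> V) s = rst F V (U \<inter> V) t"
  obtains r where "r \<in> sec F (U \<union> V)" "rst F (U \<union> V) U r = s" "rst F (U \<union> V) V r = t"
proof -
  define u where "u = (\<lambda>W. if W = U then s else t)"
  have uU: "u U = s" by (simp add: u_def)
  have uV: "u V = t"
  proof (cases "U = V")
    case True
    then show ?thesis
      using eq presheaf_rst_id [OF sheaf_presheaf [OF F] U] presheaf_rst_id [OF sheaf_presheaf [OF F] V]
      by (simp add: u_def)
  qed (simp add: u_def)
  have mem: "u W \<in> sec F W" "openin X W" if "W = U \<or> W = V" for W
    using that U V uU uV by auto
  have "rst F W (W \<inter> W') (u W) = rst F W' (W \<inter> W') (u W')" if "W = U \<or> W = V" "W' = U \<or> W' = V" for W W'
    using that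
  proof (elim disjE; hypsubst)
    show "rst F U (U \<inter> U) (u U) = rst F U (U \<inter> U) (u U)" "rst F V (V \<inter> V) (u V) = rst F V (V \<inter> V) (u V)"
      by (rule refl)+
    show "rst F U (U \<inter> V) (u U) = rst F V (U \<inter> V) (u V)"
      unfolding uU uV by (rule eq)
    show "rst F V (V \<inter> U) (u V) = rst F U (V \<inter> U) (u U)"
      unfolding uU uV Int_commute [of V U] by (rule eq [symmetric])
  qed
  then obtain r where r: "r \<in> sec F (\<Union>{W. W = U \<or> W = V})"
      "\<And>W. W = U \<or> W = V \<Longrightarrow> rst F (\<Union>{W. W = U \<or> W = V}) W r = u W"
    using sheaf_glue [OF F, of "{W. W = U \<or> W = V}" "\<lambda>W. W" u] mem by auto
  moreover have "\<Union>{W. W = U \<or> W = V} = U \<union> V" by auto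
  ultimately show ?thesis
    using that [of r] uU uV by simp
qed

section \<open>Sheaves of simplicial \<open>C\<^sup>\<infinity>\<close>-rings\<close>

lemma level_psh_simps [simp]:
  "sec (level_psh \<O> k) U = spx (ssec \<O> U) k" "rst (level_psh \<O> k) U V = srst \<O> U V k"
  "pop (level_psh \<O> k) U = sop (ssec \<O> U) k" "sections_Cinf (level_psh \<O> k) U = level (ssec \<O> U) k"
  by (simp_all add: level_psh_def sections_Cinf_def level_def)

lemma simplicial_sheafD:
  assumes "simplicial_sheaf X \<O>"
  shows "openin X U \<Longrightarrow> simplicial_Cinf (ssec \<O> U)"
    "openin X U \<Longrightarrow> openin X V \<Longrightarrow> V \<subseteq> U \<Longrightarrow> srst \<O> U V \<in> scring_hom (ssec \<O> U) (ssec \<O> V)"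
    "sheaf X (level_psh \<O> k)" "presheaf X (level_psh \<O> k)"
  using assms by (simp_all add: simplicial_sheaf_def sheaf_presheaf)

lemma level_psh_Cinf_presheaf:
  assumes S: "simplicial_sheaf X \<O>"
  shows "Cinf_presheaf X (level_psh \<O> k)"
  unfolding Cinf_presheaf_def level_psh_simps
  using simplicial_sheafD(4) [OF S, of k] simplicial_CinfD(1) [OF simplicial_sheafD(1) [OF S]]
    scring_homD(1) [OF simplicial_sheafD(2) [OF S]] by blast

lemma pi_psh_simps [simp]:
  "sec (pi_psh \<O> k) U = pi_ring (ssec \<O> U) k"
  "rst (pi_psh \<O> k) U V = pi_map (ssec \<O> V) k (szero (ssec \<O> V)) (srst \<O> U V)"
  by (simp_all add: pi_psh_def)

lemma pi0_psh_simps [simp]: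
  "sec (pi0_psh \<O>) = sec (pi_psh \<O> 0)" "rst (pi0_psh \<O>) = rst (pi_psh \<O> 0)"
  "pop (pi0_psh \<O>) U = pi0_op (ssec \<O> U)" "sections_Cinf (pi0_psh \<O>) U = pi0_Cinf (ssec \<O> U)"
  by (simp_all add: pi0_psh_def sections_Cinf_def pi0_Cinf_def)

abbreviation sclass :: "('x, 'a, 'm) ssheaf_scheme \<Rightarrow> nat \<Rightarrow> 'x set \<Rightarrow> 'a \<Rightarrow> 'a set"
  where "sclass \<O> k U \<equiv> hclass (ssec \<O> U) k (szero (ssec \<O> U))"

abbreviation ssph :: "('x, 'a, 'm) ssheaf_scheme \<Rightarrow> nat \<Rightarrow> 'x set \<Rightarrow> 'a set"
  where "ssph \<O> k U \<equiv> spheres (ssec \<O> U) k (szero (ssec \<O> U))"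

lemma ssph_rst:
  assumes S: "simplicial_sheaf X \<O>" and U: "openin X U" "openin X V" "V \<subseteq> U" and s: "s \<in> ssph \<O> k U"
  shows "srst \<O> U V k s \<in> ssph \<O> k V"
  using spheres_hom [OF simplicial_sheafD(2) [OF S U] szero_closed [OF simplicial_sheafD(1) [OF S U(1)]] s]
  by (simp add: szero_hom [OF simplicial_sheafD(2) [OF S U]])

lemma sclass_rst:
  assumes S: "simplicial_sheaf X \<O>" and U: "openin X U" "openin X V" "V \<subseteq> U" and s: "s \<in> ssph \<O> k U"
  shows "rst (pi_psh \<O> k) U V (sclass \<O> k U s) = sclass \<O> k V (srst \<O> U V k s)"
  using pi_map_hclass [OF simplicial_sheafD(1) [OF S U(1)] simplicial_sheafD(1) [OF S U(2)]
      simplicial_sheafD(2) [OF S U] szero_closed [OF simplicial_sheafD(1) [OF S U(1)]] s]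
  by (simp add: szero_hom [OF simplicial_sheafD(2) [OF S U]])

lemma pi_psh_presheaf:
  assumes S: "simplicial_sheaf X \<O>"
  shows "presheaf X (pi_psh \<O> k)"
  unfolding presheaf_def
proof (intro conjI allI impI ballI funcsetI)
  fix U V c assume U: "openin X U" "openin X V" "V \<subseteq> U" and "c \<in> sec (pi_psh \<O> k) U"
  then obtain s where s: "s \<in> ssph \<O> k U" "c = sclass \<O> k U s"
    unfolding pi_psh_simps by (elim pi_setE)
  show "rst (pi_psh \<O> k) U V c \<in> sec (pi_psh \<O> k) V"
    unfolding s(2) sclass_rst [OF S U s(1)] pi_psh_simps(1) by (rule hclass_in_pi [OF ssph_rst [OF S U s(1)]])
next
  note P = simplicial_sheafD(4) [OF S, of k]
  fix U c assume U: "openin X U" and "c \<in> sec (pi_psh \<O> k) U"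
  then obtain s where s: "s \<in> ssph \<O> k U" "c = sclass \<O> k U s"
    unfolding pi_psh_simps by (elim pi_setE)
  show "rst (pi_psh \<O> k) U U c = c"
    unfolding s(2) sclass_rst [OF S U U order_refl s(1)]
    using presheaf_rst_id [OF P U, of s] spheres_spx [OF s(1)] by simp
next
  note P = simplicial_sheafD(4) [OF S, of k]
  fix U V W c assume U: "openin X U" "openin X V" "openin X W" "W \<subseteq> V" "V \<subseteq> U" and "c \<in> sec (pi_psh \<O> k) U"
  then obtain s where s: "s \<in> ssph \<O> k U" "c = sclass \<O> k U s"
    unfolding pi_psh_simps by (elim pi_setE)
  have "rst (pi_psh \<O> k) V W (rst (pi_psh \<O> k) U V c) = sclass \<O> k W (srst \<O> V W k (srst \<O> U V k s))"
    unfolding s(2) sclass_rst [OF S U(1,2,5) s(1)]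
    by (rule sclass_rst [OF S U(2-4) ssph_rst [OF S U(1,2,5) s(1)]])
  also have "srst \<O> V W k (srst \<O> U V k s) = srst \<O> U W k s"
    using presheaf_rst_rst [OF P U, of s] spheres_spx [OF s(1)] by simp
  also have "sclass \<O> k W \<dots> = rst (pi_psh \<O> k) U W c"
    unfolding s(2) by (rule sclass_rst [OF S U(1,3) subset_trans [OF U(4,5)] s(1), symmetric])
  finally show "rst (pi_psh \<O> k) V W (rst (pi_psh \<O> k) U V c) = rst (pi_psh \<O> k) U W c" .
qed

lemma pi0_psh_Cinf_presheaf:
  assumes S: "simplicial_sheaf X \<O>"
  shows "Cinf_presheaf X (pi0_psh \<O>)"
proof -
  have "presheaf X (pi0_psh \<O>)"
    using pi_psh_presheaf [OF S, of 0] unfolding presheaf_def pi0_psh_simps .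
  moreover have "Cinf_ring (sections_Cinf (pi0_psh \<O>) U)" if "openin X U" for U
    unfolding pi0_psh_simps by (rule pi0_Cinf_ring [OF simplicial_sheafD(1) [OF S that]])
  moreover have "rst (pi0_psh \<O>) U V \<in> Cinf_hom (sections_Cinf (pi0_psh \<O>) U) (sections_Cinf (pi0_psh \<O>) V)"
    if "openin X U" "openin X V" "V \<subseteq> U" for U V
    unfolding pi0_psh_simps pi_psh_simps
    by (rule pi0_map_Cinf_hom [OF simplicial_sheafD(1) [OF S that(1)] simplicial_sheafD(1) [OF S that(2)]
          simplicial_sheafD(2) [OF S that]])
  ultimately show ?thesis
    unfolding Cinf_presheaf_def by blast
qed

lemma pi0_sheaf_Cinf_presheaf:
  "simplicial_sheaf X \<O> \<Longrightarrow> Cinf_presheaf X (pi0_sheaf X \<O>)"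
  unfolding pi0_sheaf_def by (intro sheafify_Cinf_presheaf pi0_psh_Cinf_presheaf)

text \<open>The quotient map from \<open>\<O>\<^sub>0\<close> to \<open>\<pi>\<^sub>0(\<O>)\<close>.\<close>

definition to_pi0 :: "'x topology \<Rightarrow> ('x, 'a, 'm) ssheaf_scheme \<Rightarrow> 'x set \<Rightarrow> 'a \<Rightarrow> 'x \<Rightarrow> ('x, 'a set) germ"
  where "to_pi0 X \<O> U s = to_sheaf X (pi0_psh \<O>) U (sclass \<O> 0 U s)"

lemma to_pi0_Cinf_hom:
  assumes S: "simplicial_sheaf X \<O>" and U: "openin X U"
  shows "to_pi0 X \<O> U \<in> Cinf_hom (level (ssec \<O> U) 0) (sections_Cinf (pi0_sheaf X \<O>) U)"
proof -
  have "to_sheaf X (pi0_psh \<O>) U \<circ> comp_class (ssec \<O> U) \<in> Cinf_hom (level (ssec \<O> U) 0) (sections_Cinf (pi0_sheaf X \<O>) U)"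
    unfolding pi0_sheaf_def
    using to_sheaf_Cinf_hom [OF pi0_psh_Cinf_presheaf [OF S] U] unfolding pi0_psh_simps
    by (rule Cinf_hom_comp [OF comp_class_Cinf_hom [OF simplicial_sheafD(1) [OF S U]]])
  then show ?thesis
    by (simp add: to_pi0_def [abs_def] o_def)
qed

lemma to_pi0_rst:
  assumes S: "simplicial_sheaf X \<O>" and U: "openin X U" "openin X V" "V \<subseteq> U" and s: "s \<in> spx (ssec \<O> U) 0"
  shows "rst (pi0_sheaf X \<O>) U V (to_pi0 X \<O> U s) = to_pi0 X \<O> V (srst \<O> U V 0 s)"
proof -
  have s0: "s \<in> ssph \<O> 0 U" using s by (simp add: spheres_0)
  have "restrict (to_sheaf X (pi0_psh \<O>) U (sclass \<O> 0 U s)) V =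
      to_sheaf X (pi0_psh \<O>) V (rst (pi0_psh \<O>) U V (sclass \<O> 0 U s))"
    by (rule to_sheaf_rst [OF Cinf_presheafD(1) [OF pi0_psh_Cinf_presheaf [OF S]] U(1) _ U(2,3)])
       (simp add: hclass_in_pi [OF s0])
  then show ?thesis
    by (simp only: pi0_sheaf_def to_pi0_def sheafify_Cinf_simps pi0_psh_simps sclass_rst [OF S U s0])
qed

section \<open>Functions separating points from closed sets\<close>

text \<open>
  Let \<open>c\<close> be the value at \<open>y\<close> of the image of \<open>s\<close>.  If \<open>s - c\<close> were invertible at \<open>y\<close>, then so would be
  its image, because homomorphisms preserve units; so \<open>c\<close> is the value of \<open>s\<close> as well.
\<close>

lemma section_value_hom:
  assumes F: "Cinf_presheaf X F" "local_stalks X F" and G: "Cinf_presheaf X G" "local_stalks X G"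
    and \<psi>: "\<And>U. openin X U \<Longrightarrow> \<psi> U \<in> Cinf_hom (sections_Cinf F U) (sections_Cinf G U)"
    and nat: "\<And>U V s. openin X U \<Longrightarrow> openin X V \<Longrightarrow> V \<subseteq> U \<Longrightarrow> s \<in> sec F U \<Longrightarrow>
      rst G U V (\<psi> U s) = \<psi> V (rst F U V s)"
    and U: "openin X U" "y \<in> U" and s: "s \<in> sec F U"
  shows "section_value X G U (\<psi> U s) y = section_value X F U s y"
proof -
  let ?AF = "sections_Cinf F U" and ?AG = "sections_Cinf G U"
  let ?SF = "stalk_Cinf X F y" and ?SG = "stalk_Cinf X G y"
  have y: "y \<in> topspace X" using U openin_subset by blast
  have loc: "Cinf_ring ?SF" "local_Cinf ?SF" "Cinf_ring ?SG" "local_Cinf ?SG"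
    using stalk_Cinf_ring y F G by (auto simp: local_stalks_def)
  have \<psi>s: "\<psi> U s \<in> sec G U"
    using Cinf_hom_closed [OF \<psi> [OF U(1)], of s] s by simp
  define c where "c = section_value X G U (\<psi> U s) y"
  define t where "t = s \<ominus>\<^bsub>underlying_ring ?AF\<^esub> const_elt ?AF c"
  have AF: "Cinf_ring ?AF" and AG: "Cinf_ring ?AG"
    using Cinf_presheafD(2) [OF F(1) U(1)] Cinf_presheafD(2) [OF G(1) U(1)] .
  have t: "t \<in> sec F U"
    using underlying_closed(3) [OF AF _ const_elt_closed [OF AF], of s c] s by (simp add: t_def)
  have minus: "h (a \<ominus>\<^bsub>underlying_ring A\<^esub> const_elt A c) = h a \<ominus>\<^bsub>underlying_ring B\<^esub> const_elt B c"
    if A: "Cinf_ring A" and B: "Cinf_ring B" and h: "h \<in> Cinf_hom A B" and a: "a \<in> carrier A"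
    for A :: "'z cring_inf" and B :: "'w cring_inf" and h a
  proof -
    interpret ring_hom_cring "underlying_ring A" "underlying_ring B" h
      by (rule Cinf_hom_ring_hom [OF A B h])
    show ?thesis
      using a const_elt_closed [OF A] underlying_closed [OF A] by (simp add: a_minus_def Cinf_hom_const [OF h])
  qed
  have "germ X F y U t \<notin> Units (underlying_ring ?SF)"
  proof
    assume "germ X F y U t \<in> Units (underlying_ring ?SF)"
    then obtain W where W: "openin X W" "y \<in> W" "W \<subseteq> U"
        "rst F U W t \<in> Units (underlying_ring (sections_Cinf F W))"
      using germ_unit [OF F(1) U t] by metis
    note AFW = Cinf_presheafD(2) [OF F(1) W(1)] and AGW = Cinf_presheafD(2) [OF G(1) W(1)]
    have "germ X G y W (\<psi> W (rst F U W t)) \<in> Units (underlying_ring ?SG)"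
      by (rule Cinf_hom_Units [OF AGW loc(3) germ_Cinf_hom [OF G(1) W(1,2)]],
          rule Cinf_hom_Units [OF AFW AGW \<psi> [OF W(1)] W(4)])
    also have "germ X G y W (\<psi> W (rst F U W t)) = germ X G y U (\<psi> U t)"
      using germ_rst [OF Cinf_presheafD(1) [OF G(1)] U(1) _ W(1,3,2), of "\<psi> U t"]
        Cinf_hom_closed [OF \<psi> [OF U(1)], of t] t nat [OF U(1) W(1,3) t] by simp
    also have "\<psi> U t = \<psi> U s \<ominus>\<^bsub>underlying_ring ?AG\<^esub> const_elt ?AG c"
      unfolding t_def using minus [OF AF AG \<psi> [OF U(1)], of s] s by simp
    also have "germ X G y U \<dots> = germ X G y U (\<psi> U s) \<ominus>\<^bsub>underlying_ring ?SG\<^esub> const_elt ?SG c"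
      using minus [OF AG loc(3) germ_Cinf_hom [OF G(1) U], of "\<psi> U s"] \<psi>s by simp
    finally show False
      using residue_nonunit [OF loc(3,4), of "germ X G y U (\<psi> U s)"] germ_in_stalk [OF U \<psi>s]
      unfolding c_def section_value_def by simp
  qed
  then have "germ X F y U s \<ominus>\<^bsub>underlying_ring ?SF\<^esub> const_elt ?SF c \<notin> Units (underlying_ring ?SF)"
    unfolding t_def using minus [OF AF loc(1) germ_Cinf_hom [OF F(1) U], of s] s by simp
  then show ?thesis
    unfolding section_value_def [of X F] c_def [symmetric]
    using residueI [OF loc(1,2), of "germ X F y U s" c] germ_in_stalk [OF U s] by simp
qed

lemma section_value_const:
  assumes F: "Cinf_presheaf X F" "local_stalks X F" and U: "openin X U" "y \<in> U"
  shows "section_value X F U (const_elt (sections_Cinf F U) c) y = c"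
proof -
  have y: "y \<in> topspace X" using U openin_subset by blast
  show ?thesis
    unfolding section_value_def Cinf_hom_const [OF germ_Cinf_hom [OF F(1) U]]
    using residue_const stalk_Cinf_ring [OF F(1) y] F(2) y by (auto simp: local_stalks_def)
qed

text \<open>
  The constants \<open>1\<close> at a point and \<open>0\<close> on a closed set not containing it form one section over the
  closed union, which a soft sheaf extends to the whole space.
\<close>

lemma soft_separating_section:
  assumes X: "Hausdorff_space X" and F: "Cinf_presheaf X F" "local_stalks X F" and soft: "soft X F"
    and U: "openin X U" "x \<in> U"
  obtains a where "a \<in> sec F (topspace X)" "section_value X F (topspace X) a x = 1"
    "\<And>y. y \<in> topspace X - U \<Longrightarrow> section_value X F (topspace X) a y = 0"
proof -
  let ?T = "topspace X"
  let ?k = "const_elt (sections_Cinf F ?T)"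
  note P = Cinf_presheafD(1) [OF F(1)]
  have x: "x \<in> ?T" using U openin_subset by blast
  have k: "?k c \<in> sec F ?T" for c
    using const_elt_closed [OF Cinf_presheafD(2) [OF F(1) openin_topspace], of c] by simp
  define Z where "Z = insert x (?T - U)"
  define \<tau> where "\<tau> = (\<lambda>y\<in>Z. germ X F y ?T (?k (if y = x then 1 else 0)))"
  have cx: "closedin X {x}"
    by (rule closedin_Hausdorff_singleton [OF X x])
  have "closedin X ({x} \<union> (?T - U))"
    by (intro closedin_Un cx closedin_diff closedin_topspace U)
  then have Z: "closedin X Z" by (simp add: Z_def)
  have "\<tau> \<in> germ_sections X F Z"
  proof (rule germ_sectionsI)
    show "\<tau> y \<in> stalk X F y" if "y \<in> Z" for y
      using that k closedin_subset [OF Z] by (simp add: \<tau>_def germ_in_stalk subsetD)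
    show "\<tau> \<in> extensional Z" by (simp add: \<tau>_def)
    fix z assume z: "z \<in> Z"
    \<comment> \<open>The point \<open>x\<close> is isolated in \<open>Z\<close>: only \<open>x\<close> lies in \<open>U\<close>, and the rest lies in the complement of \<open>x\<close>.\<close>
    define V where "V = (if z = x then U else ?T - {x})"
    define c :: real where "c = (if z = x then 1 else 0)"
    have V: "openin X V" "z \<in> V"
      using U z closedin_subset [OF Z] cx by (auto simp: V_def)
    have "\<tau> y = germ X F y V (rst F ?T V (?k c))" if y: "y \<in> Z \<inter> V" for y
    proof -
      have "(if y = x then 1 else 0) = c"
        using y U by (auto simp: V_def Z_def c_def split: if_splits)
      then have "\<tau> y = germ X F y ?T (?k c)"
        using y by (simp add: \<tau>_def)
      also have "\<dots> = germ X F y V (rst F ?T V (?k c))"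
        using y by (intro germ_rst [OF P openin_topspace k V(1) openin_subset [OF V(1)], symmetric]) simp
      finally show ?thesis .
    qed
    moreover have "rst F ?T V (?k c) \<in> sec F V"
      by (rule presheaf_rst_closed [OF P openin_topspace V(1) openin_subset [OF V(1)] k])
    ultimately show "\<exists>V. openin X V \<and> z \<in> V \<and> (\<exists>s\<in>sec F V. \<forall>y\<in>Z \<inter> V. \<tau> y = germ X F y V s)"
      using V by blast
  qed
  then have "\<exists>a\<in>sec F ?T. \<forall>z\<in>Z. germ X F z ?T a = \<tau> z"
    using soft Z by (simp add: soft_def)
  then obtain a where a: "a \<in> sec F ?T" "\<And>z. z \<in> Z \<Longrightarrow> germ X F z ?T a = \<tau> z"
    by (elim bexE) simp
  have val: "section_value X F ?T a z = (if z = x then 1 else 0)" if z: "z \<in> Z" for z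
  proof -
    have "section_value X F ?T a z = section_value X F ?T (?k (if z = x then 1 else 0)) z"
      unfolding section_value_def using a(2) [OF z] z by (simp add: \<tau>_def)
    also have "\<dots> = (if z = x then 1 else 0)"
      using section_value_const [OF F openin_topspace] z closedin_subset [OF Z] by blast
    finally show ?thesis .
  qed
  show ?thesis
  proof (rule that [OF a(1)])
    show "section_value X F ?T a x = 1"
      using val [of x] by (simp add: Z_def)
    fix y assume "y \<in> ?T - U"
    with U(2) have "y \<in> Z" "y \<noteq> x" by (auto simp: Z_def)
    then show "section_value X F ?T a y = 0"
      using val [of y] by simp
  qed
qed

text \<open>
  The generators are the images of the coordinate functions, because every \<open>f\<close> in \<open>Cinf n\<close> is the
  result of applying the operation \<open>f\<close> to the coordinates.
\<close>

lemma finitely_generated_elements: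
  assumes "finitely_generated A"
  obtains n x where "x \<in> {..<n} \<rightarrow>\<^sub>E carrier A" "\<And>a. a \<in> carrier A \<Longrightarrow> \<exists>F\<in>Cinf n. a = cop A n F x"
proof -
  obtain n h where h: "h \<in> Cinf_hom (free_Cinf n) A" "h ` Cinf n = carrier A"
    using assms unfolding finitely_generated_def by blast
  let ?p = "\<lambda>i\<in>{..<n}. \<lambda>x\<in>Rn n. x i"
  let ?x = "\<lambda>i\<in>{..<n}. h (\<lambda>x\<in>Rn n. x i)"
  have p: "(\<lambda>x\<in>Rn n. x i) \<in> Cinf n" for i
    by (rule restrict_Cinf [OF smooth_proj])
  have "cop A n F ?x = h F" if F: "F \<in> Cinf n" for F
  proof -
    have "scomp n n F ?p = F"
    proof
      fix x
      have "(\<lambda>j. if j < n then x j else 0) = x" if "x \<in> Rn n"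
        using that by (auto simp: Rn_iff)
      then show "scomp n n F ?p x = F x"
        using F by (cases "x \<in> Rn n") (simp_all add: scomp_def Cinf_def extensional_def cong: if_cong)
    qed
    moreover have "h (cop (free_Cinf n) n F ?p) = cop A n F (\<lambda>i\<in>{..<n}. h (?p i))"
      using p by (intro Cinf_hom_cop [OF h(1) F]) (simp add: free_Cinf_def)
    moreover have "(\<lambda>i\<in>{..<n}. h (?p i)) = ?x"
      by (rule restrict_ext) simp
    ultimately show ?thesis
      by (simp add: free_Cinf_def)
  qed
  then have "\<exists>F\<in>Cinf n. a = cop A n F ?x" if "a \<in> carrier A" for a
    using that h(2) by (metis imageE)
  moreover have "?x \<in> {..<n} \<rightarrow>\<^sub>E carrier A"
    using p by (simp add: h(2) [symmetric] PiE_iff)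
  ultimately show ?thesis
    using that by blast
qed

lemma second_countable_Euclidean_space: "second_countable (Euclidean_space n)"
proof -
  have "second_countable (euclidean :: (nat \<Rightarrow> real) topology)"
    unfolding second_countable_def
  proof -
    obtain B :: "(nat \<Rightarrow> real) set set" where B: "countable B" "topological_basis B"
      using ex_countable_basis by blast
    have "\<exists>V\<in>B. x \<in> V \<and> V \<subseteq> U" if "open U" "x \<in> U" for U x
      by (rule topological_basisE [OF B(2) that]) blast
    then show "\<exists>\<B>. countable \<B> \<and> (\<forall>V\<in>\<B>. openin euclidean V) \<and>
        (\<forall>U x. openin euclidean U \<and> x \<in> U \<longrightarrow> (\<exists>V\<in>\<B>. x \<in> V \<and> V \<subseteq> (U :: (nat \<Rightarrow> real) set)))"
      using B(1) topological_basis_open [OF B(2)] by (intro exI [of _ B]) simp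
  qed
  then show ?thesis
    unfolding Euclidean_space_def euclidean_product_topology
    by (rule second_countable_subtopology)
qed

text \<open>
  Generators of the \<open>C\<^sup>\<infinity>\<close>-ring of global sections are the coordinates of a continuous map to some
  \<open>\<real>\<^sup>n\<close>, and all values of global sections factor through it.  Because softness separates points
  from closed sets by such values, the map is an embedding.
\<close>

lemma soft_finitely_generated_second_countable:
  assumes X: "Hausdorff_space X" and F: "Cinf_presheaf X F" "local_stalks X F" and soft: "soft X F"
    and fg: "finitely_generated (sections_Cinf F (topspace X))"
  shows "second_countable X"
proof -
  let ?T = "topspace X"
  obtain n x where x: "x \<in> {..<n} \<rightarrow>\<^sub>E carrier (sections_Cinf F ?T)"
    and gen: "\<And>a. a \<in> carrier (sections_Cinf F ?T) \<Longrightarrow> \<exists>f\<in>Cinf n. a = cop (sections_Cinf F ?T) n f x"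
    using finitely_generated_elements [OF fg] by metis
  define \<Phi> where "\<Phi> = (\<lambda>y i. if i < n then section_value X F ?T (x i) y else 0)"
  have xi: "x i \<in> sec F ?T" if "i < n" for i
    using x that by auto
  have cont: "continuous_map X (Euclidean_space n) \<Phi>"
    unfolding \<Phi>_def continuous_map_componentwise_Euclidean_space continuous_map_upper_lower_semicontinuous_lt
    using section_value_continuous [OF F openin_topspace xi] by simp
  obtain \<B> where \<B>: "countable \<B>" "\<forall>V\<in>\<B>. openin (Euclidean_space n) V"
    "\<forall>U z. openin (Euclidean_space n) U \<and> z \<in> U \<longrightarrow> (\<exists>V\<in>\<B>. z \<in> V \<and> V \<subseteq> U)"
    using second_countable_Euclidean_space [of n] unfolding second_countable_def by (elim exE conjE)
  let ?pre = "\<lambda>V. {y \<in> ?T. \<Phi> y \<in> V}"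
  have "\<exists>V\<in>?pre ` \<B>. z \<in> V \<and> V \<subseteq> U" if U: "openin X U" "z \<in> U" for U z
  proof -
    obtain a where a: "a \<in> sec F ?T" "section_value X F ?T a z = 1"
      "\<And>y. y \<in> ?T - U \<Longrightarrow> section_value X F ?T a y = 0"
      using soft_separating_section [OF X F soft U] by metis
    obtain f where f: "f \<in> Cinf n" "a = cop (sections_Cinf F ?T) n f x"
      using gen [of a] a(1) by auto
    have val: "section_value X F ?T a y = f (\<Phi> y)" if "y \<in> ?T" for y
      unfolding f(2) cop_smooth_op [OF f(1)] \<Phi>_def
      using section_value_smooth_op [OF F openin_topspace that Cinf_smooth [OF f(1)], of x] x by simp
    have z: "z \<in> ?T" using U openin_subset by blast
    let ?G = "{p \<in> Rn n. f p \<in> {1/2<..}}"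
    have "continuous_map (Euclidean_space n) euclideanreal f"
      using C_diff_continuous Cinf_smooth [OF f(1)] by (auto simp: smooth_def simp del: C_diff.simps)
    then have "openin (Euclidean_space n) ?G"
      by (rule openin_continuous_map_preimage) simp
    moreover have "\<Phi> z \<in> ?G"
      using val [OF z] a(2) by (simp add: \<Phi>_def Rn_iff)
    ultimately obtain V where V: "V \<in> \<B>" "\<Phi> z \<in> V" "V \<subseteq> ?G"
      using \<B>(3) by blast
    have "?pre V \<subseteq> U"
    proof
      fix y assume y: "y \<in> ?pre V"
      then have "section_value X F ?T a y > 1/2"
        using V(3) val by auto
      then show "y \<in> U"
        using a(3) [of y] y by auto
    qed
    then show ?thesis
      using V z by blast
  qed
  moreover have "openin X V" if "V \<in> ?pre ` \<B>" for V
    using that \<B>(2) openin_continuous_map_preimage [OF cont] by blast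
  moreover have "countable (?pre ` \<B>)"
    using \<B>(1) by simp
  ultimately show ?thesis
    unfolding second_countable_def by blast
qed

section \<open>Bump functions in \<open>\<O>\<^sub>0\<close>\<close>

text \<open>A smooth function of one variable that is \<open>0\<close> up to \<open>1/2\<close> and \<open>1\<close> from \<open>3/4\<close> on.\<close>

definition smooth_step :: "real \<Rightarrow> real"
  where "smooth_step t = flat (t - 1/2) * inverse (flat (t - 1/2) + flat (3/4 - t))"

lemma smooth_smooth_step: "smooth n f \<Longrightarrow> smooth n (\<lambda>x. smooth_step (f x))"
proof -
  assume f: "smooth n f"
  have "flat (t - 1/2) + flat (3/4 - t) \<noteq> 0" for t
    using flat_nonneg [of "t - 1/2"] flat_nonneg [of "3/4 - t"] flat_eq_0_iff [of "t - 1/2"]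
      flat_eq_0_iff [of "3/4 - t"] by linarith
  then show ?thesis
    unfolding smooth_step_def
    by (intro smooth_mult smooth_inverse smooth_add smooth_flat smooth_diff smooth_const f) auto
qed

lemma smooth_step_low: "flat (1/2 - t) * smooth_step t = 0"
  and smooth_step_high: "flat (t - 3/4) * (smooth_step t - 1) = 0"
proof -
  show "flat (1/2 - t) * smooth_step t = 0"
    using flat_eq_0_iff [of "1/2 - t"] flat_eq_0_iff [of "t - 1/2"] by (cases "t \<le> 1/2") (auto simp: smooth_step_def)
  show "flat (t - 3/4) * (smooth_step t - 1) = 0"
    using flat_eq_0_iff [of "t - 3/4"] flat_eq_0_iff [of "3/4 - t"] flat_eq_0_iff [of "t - 1/2"]
    by (cases "t \<le> 3/4") (auto simp: smooth_step_def)
qed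

lemma unary_smooth_op_germ_zero:
  assumes F: "Cinf_presheaf X F" "local_stalks X F" and U: "openin X U" "y \<in> U" and s: "s \<in> sec F U"
    and f: "smooth 1 (\<lambda>x. f (x 0))" and g: "smooth 1 (\<lambda>x. g (x 0))"
    and z: "\<And>t. g t * f t = 0" and nz: "g (section_value X F U s y) \<noteq> 0"
  shows "germ X F y U (smooth_op (sections_Cinf F U) 1 (\<lambda>x. f (x 0)) (\<lambda>i\<in>{..<1}. s)) =
    germ X F y U \<zero>\<^bsub>underlying_ring (sections_Cinf F U)\<^esub>"
proof -
  let ?A = "sections_Cinf F U" and ?S = "stalk_Cinf X F y"
  have y: "y \<in> topspace X" using U openin_subset by blast
  have loc: "Cinf_ring ?S" "local_Cinf ?S"
    using stalk_Cinf_ring [OF F(1) y] F(2) y by (simp_all add: local_stalks_def)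
  have G: "germ X F y U \<in> Cinf_hom ?A ?S"
    by (rule germ_Cinf_hom [OF F(1) U])
  let ?t = "\<lambda>i\<in>{..<1::nat}. germ X F y U s"
  have t: "?t \<in> {..<1} \<rightarrow>\<^sub>E carrier ?S"
    using germ_in_stalk [OF U s] by simp
  have "germ X F y U (smooth_op ?A 1 (\<lambda>x. f (x 0)) (\<lambda>i\<in>{..<1}. s)) = smooth_op ?S 1 (\<lambda>x. f (x 0)) (\<lambda>i\<in>{..<1}. germ X F y U ((\<lambda>i\<in>{..<1}. s) i))"
    using s by (intro Cinf_hom_smooth_op [OF G f]) simp
  also have "(\<lambda>i\<in>{..<1}. germ X F y U ((\<lambda>i\<in>{..<1}. s) i)) = ?t"
    by (rule restrict_ext) simp
  also have "smooth_op ?S 1 (\<lambda>x. f (x 0)) ?t = \<zero>\<^bsub>underlying_ring ?S\<^esub>"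
    using z nz by (intro smooth_op_eq_zero [OF loc f g t]) (simp_all add: section_value_def)
  also have "\<dots> = germ X F y U \<zero>\<^bsub>underlying_ring ?A\<^esub>"
    by (simp add: zero_underlying Cinf_hom_const [OF G])
  finally show ?thesis .
qed

lemma (in ring) eq_if_minus_zero: "a \<in> carrier R \<Longrightarrow> b \<in> carrier R \<Longrightarrow> a \<ominus> b = \<zero> \<Longrightarrow> a = b"
  using maltsev_laws(1) [of a b] by simp

lemma localized_spaceD:
  assumes "localized_space X \<O>"
  shows "simplicial_sheaf X \<O>" "Hausdorff_space X" "soft X (pi0_sheaf X \<O>)"
    "finitely_generated (sections_Cinf (pi0_sheaf X \<O>) (topspace X))"
    "local_stalks X (pi0_sheaf X \<O>)" "local_stalks X (level_psh \<O> 0)"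
  using assms by (simp_all add: localized_space_def simplicial_Cinf_space_def local_stalks_def)

lemma localized_space_second_countable: "localized_space X \<O> \<Longrightarrow> second_countable X"
  using soft_finitely_generated_second_countable [of X "pi0_sheaf X \<O>"] localized_spaceD [of X \<O>]
    pi0_sheaf_Cinf_presheaf [of X \<O>] by blast

lemma section_value_to_pi0:
  assumes L: "localized_space X \<O>" and U: "openin X U" "y \<in> U" and s: "s \<in> spx (ssec \<O> U) 0"
  shows "section_value X (pi0_sheaf X \<O>) U (to_pi0 X \<O> U s) y = section_value X (level_psh \<O> 0) U s y"
proof -
  note D = localized_spaceD [OF L]
  show ?thesis
  proof (rule section_value_hom [OF level_psh_Cinf_presheaf [OF D(1)] D(6) pi0_sheaf_Cinf_presheaf [OF D(1)] D(5) _ _ U])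
    show "to_pi0 X \<O> U \<in> Cinf_hom (sections_Cinf (level_psh \<O> 0) U) (sections_Cinf (pi0_sheaf X \<O>) U)" if "openin X U" for U
      unfolding level_psh_simps by (rule to_pi0_Cinf_hom [OF D(1) that])
    show "rst (pi0_sheaf X \<O>) U V (to_pi0 X \<O> U s) = to_pi0 X \<O> V (rst (level_psh \<O> 0) U V s)"
      if "openin X U" "openin X V" "V \<subseteq> U" "s \<in> sec (level_psh \<O> 0) U" for U V s
      using to_pi0_rst [OF D(1) that(1-3), of s] that(4) by simp
  qed (use s in simp)
qed

text \<open>
  Locally the generators of \<open>\<pi>\<^sub>0(\<O>)\<close> lift to \<open>\<O>\<^sub>0\<close>, and hence so do all smooth functions of them, all on
  one neighbourhood.
\<close>

lemma lift_generators:
  fixes n :: nat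
  assumes L: "localized_space X \<O>" and U: "openin X U" "x \<in> U"
    and e: "e \<in> {..<n} \<rightarrow>\<^sub>E sec (pi0_sheaf X \<O>) (topspace X)"
  obtains V t where "openin X V" "x \<in> V" "V \<subseteq> U" "t \<in> {..<n} \<rightarrow>\<^sub>E spx (ssec \<O> V) 0"
    "\<And>i. i < n \<Longrightarrow> to_pi0 X \<O> V (t i) = rst (pi0_sheaf X \<O>) (topspace X) V (e i)"
proof -
  note S = localized_spaceD(1) [OF L]
  note Q = Cinf_presheafD(1) [OF pi0_psh_Cinf_presheaf [OF S]]
  have UX: "U \<subseteq> topspace X" by (rule openin_subset [OF U(1)])
  have r: "restrict (e i) U \<in> germ_sections X (pi0_psh \<O>) U" if "i < n" for i
    using e that by (intro germ_sections_restrict [OF _ UX]) (auto simp: pi0_sheaf_def)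
  obtain V s where V: "openin X V" "x \<in> V" "V \<subseteq> U" and s: "s \<in> {..<n} \<rightarrow>\<^sub>E sec (pi0_psh \<O>) V"
      "\<And>i y. i < n \<Longrightarrow> y \<in> V \<Longrightarrow> restrict (e i) U y = germ X (pi0_psh \<O>) y V (s i)"
    using germ_sections_common [OF Q U, of n "\<lambda>i. restrict (e i) U"] r by metis
  have "s \<in> {..<n} \<rightarrow>\<^sub>E pi_ring (ssec \<O> V) 0"
    using s(1) by simp
  then obtain t where t: "t \<in> {..<n} \<rightarrow>\<^sub>E spx (ssec \<O> V) 0" "\<And>i. i < n \<Longrightarrow> s i = sclass \<O> 0 V (t i)"
    using comp_class_tuple by metis
  show ?thesis
  proof (rule that [OF V t(1)])
    fix i assume i: "i < n"
    have "germ X (pi0_psh \<O>) y V (sclass \<O> 0 V (t i)) = e i y" if "y \<in> V" for y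
      using s(2) [OF i that] t(2) [OF i] V(3) that by (simp add: subsetD)
    then show "to_pi0 X \<O> V (t i) = rst (pi0_sheaf X \<O>) (topspace X) V (e i)"
      unfolding to_pi0_def to_sheaf_def pi0_sheaf_def sheafify_Cinf_simps by (rule restrict_ext)
  qed
qed

text \<open>
  A bump function at \<open>x\<close> in \<open>\<O>\<^sub>0\<close>.  On a neighbourhood \<open>V\<close> of \<open>x\<close> to which the generators lift,
  softness of \<open>\<pi>\<^sub>0(\<O>)\<close> gives a function with value \<open>1\<close> at \<open>x\<close> and \<open>0\<close> outside \<open>V\<close>; it is a smooth
  function of the generators, so it lifts to \<open>\<O>\<^sub>0\<close> over \<open>V\<close>.  Composing the lift with the smooth step
  makes it vanish near the boundary of \<open>V\<close>, since the stalks of \<open>\<O>\<^sub>0\<close> are local, and so it extends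
  by zero.
\<close>

lemma bump_section:
  assumes L: "localized_space X \<O>" and U: "openin X U" "x \<in> U"
  obtains \<rho> W V where "\<rho> \<in> spx (ssec \<O> (topspace X)) 0" "openin X W" "x \<in> W" "W \<subseteq> U" "openin X V"
    "U \<union> V = topspace X" "srst \<O> (topspace X) W 0 \<rho> = \<one>\<^bsub>lring (ssec \<O> W) 0\<^esub>"
    "srst \<O> (topspace X) V 0 \<rho> = \<zero>\<^bsub>lring (ssec \<O> V) 0\<^esub>"
proof -
  note D = localized_spaceD [OF L]
  let ?T = "topspace X" and ?P = "pi0_sheaf X \<O>" and ?F = "level_psh \<O> 0"
  note F = level_psh_Cinf_presheaf [OF D(1), of 0] and P = pi0_sheaf_Cinf_presheaf [OF D(1)]
  note sh = simplicial_sheafD(3) [OF D(1), of 0] and Fp = simplicial_sheafD(4) [OF D(1), of 0]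
  obtain n e where e: "e \<in> {..<n} \<rightarrow>\<^sub>E carrier (sections_Cinf ?P ?T)"
    and gen: "\<And>a. a \<in> carrier (sections_Cinf ?P ?T) \<Longrightarrow> \<exists>f\<in>Cinf n. a = cop (sections_Cinf ?P ?T) n f e"
    using finitely_generated_elements [OF D(4)] by metis
  have e': "e \<in> {..<n} \<rightarrow>\<^sub>E sec ?P ?T" using e by simp
  obtain V t where V: "openin X V" "x \<in> V" "V \<subseteq> U" and t: "t \<in> {..<n} \<rightarrow>\<^sub>E spx (ssec \<O> V) 0"
      "\<And>i. i < n \<Longrightarrow> to_pi0 X \<O> V (t i) = rst ?P ?T V (e i)"
    using lift_generators [OF L U e'] by metis
  have VT: "V \<subseteq> ?T" by (rule openin_subset [OF V(1)])
  obtain a where a: "a \<in> sec ?P ?T" "section_value X ?P ?T a x = 1"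
      "\<And>y. y \<in> ?T - V \<Longrightarrow> section_value X ?P ?T a y = 0"
    using soft_separating_section [OF D(2) P D(5,3) V(1,2)] by metis
  obtain f where f: "f \<in> Cinf n" "a = cop (sections_Cinf ?P ?T) n f e"
    using gen [of a] a(1) by auto
  define b where "b = sop (ssec \<O> V) 0 n f t"
  have SV: "simplicial_Cinf (ssec \<O> V)" by (rule simplicial_sheafD(1) [OF D(1) V(1)])
  note LV = simplicial_CinfD(1) [OF SV, of 0]
  have b: "b \<in> spx (ssec \<O> V) 0"
    using cop_closed [OF LV f(1), of t] t(1) by (simp add: b_def)
  have "to_pi0 X \<O> V b = rst ?P ?T V a"
  proof -
    have "to_pi0 X \<O> V b = cop (sections_Cinf ?P V) n f (\<lambda>i\<in>{..<n}. to_pi0 X \<O> V (t i))"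
      using Cinf_hom_cop [OF to_pi0_Cinf_hom [OF D(1) V(1)] f(1), of t] t(1) by (simp add: b_def)
    also have "(\<lambda>i\<in>{..<n}. to_pi0 X \<O> V (t i)) = (\<lambda>i\<in>{..<n}. rst ?P ?T V (e i))"
      by (rule restrict_ext) (simp add: t(2))
    also have "cop (sections_Cinf ?P V) n f \<dots> = rst ?P ?T V a"
      unfolding f(2) by (rule Cinf_hom_cop [OF Cinf_presheafD(3) [OF P openin_topspace V(1) VT] f(1) e, symmetric])
    finally show ?thesis .
  qed
  then have bval: "section_value X ?F V b y = section_value X ?P ?T a y" if "y \<in> V" for y
    using section_value_to_pi0 [OF L V(1) that b]
      section_value_rst [OF Cinf_presheafD(1) [OF P] openin_topspace a(1) V(1) VT that] by simp
  let ?b = "\<lambda>i\<in>{..<1::nat}. b"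
  define \<rho> where "\<rho> = smooth_op (level (ssec \<O> V) 0) 1 (\<lambda>x. smooth_step (x 0)) ?b"
  have bE: "?b \<in> {..<1} \<rightarrow>\<^sub>E carrier (level (ssec \<O> V) 0)"
    using b by simp
  have st: "smooth 1 (\<lambda>x. smooth_step (x 0))"
    by (intro smooth_smooth_step smooth_proj)
  have \<rho>: "\<rho> \<in> spx (ssec \<O> V) 0"
    using smooth_op_closed [OF LV st bE] by (simp add: \<rho>_def)
  define N where "N = {y \<in> ?T. section_value X ?P ?T a y < 1/2}"
  define W where "W = V \<inter> {y \<in> ?T. 3/4 < section_value X ?P ?T a y}"
  have N: "openin X N"
    unfolding N_def by (rule section_value_continuous(1) [OF P D(5) openin_topspace a(1)])
  have "openin X W"
    unfolding W_def by (rule openin_Int [OF V(1) section_value_continuous(2) [OF P D(5) openin_topspace a(1)]])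
  moreover have "x \<in> W" "W \<subseteq> V"
    using V(2) VT a(2) by (auto simp: W_def)
  ultimately have W: "openin X W" "x \<in> W" "W \<subseteq> V" by blast+
  have cov: "V \<union> N = ?T"
    using VT a(3) by (auto simp: N_def)
  have zero: "\<zero>\<^bsub>lring (ssec \<O> U) 0\<^esub> \<in> sec ?F U" if "openin X U" for U
    using underlying_zero_one_closed(1) [OF simplicial_CinfD(1) [OF simplicial_sheafD(1) [OF D(1) that]], of 0] by simp
  have one: "\<one>\<^bsub>lring (ssec \<O> U) 0\<^esub> \<in> sec ?F U" if "openin X U" for U
    using underlying_zero_one_closed(2) [OF simplicial_CinfD(1) [OF simplicial_sheafD(1) [OF D(1) that]], of 0] by simp
  have rzero: "rst ?F U U' \<zero>\<^bsub>lring (ssec \<O> U) 0\<^esub> = \<zero>\<^bsub>lring (ssec \<O> U') 0\<^esub>"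
    and rone: "rst ?F U U' \<one>\<^bsub>lring (ssec \<O> U) 0\<^esub> = \<one>\<^bsub>lring (ssec \<O> U') 0\<^esub>"
    if "openin X U" "openin X U'" "U' \<subseteq> U" for U U'
    using Cinf_hom_const [OF Cinf_presheafD(3) [OF F that]] by (simp_all add: zero_underlying one_underlying)
  have eqI: "rst ?F U U' s = rst ?F U U' s'"
    if "openin X U" "openin X U'" "U' \<subseteq> U" "s \<in> sec ?F U" "s' \<in> sec ?F U"
      "\<And>y. y \<in> U' \<Longrightarrow> germ X ?F y U s = germ X ?F y U s'" for U U' s s'
    using that presheaf_rst_closed [OF Fp that(1-3)] germ_rst [OF Fp that(1) _ that(2,3)]
    by (intro sheaf_eq_germs [OF sh that(2)]) simp_all
  have VN: "openin X (V \<inter> N)" using V(1) N by blast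
  \<comment> \<open>Where \<open>a\<close> is less than \<open>1/2\<close>, the germs of \<open>\<rho>\<close> vanish, so \<open>\<rho>\<close> and \<open>0\<close> can be glued.\<close>
  have "rst ?F V (V \<inter> N) \<rho> = rst ?F V (V \<inter> N) \<zero>\<^bsub>lring (ssec \<O> V) 0\<^esub>"
  proof (rule eqI [OF V(1) VN Int_lower1])
    show "\<rho> \<in> sec ?F V" "\<zero>\<^bsub>lring (ssec \<O> V) 0\<^esub> \<in> sec ?F V"
      using \<rho> zero [OF V(1)] by simp_all
    fix y assume y: "y \<in> V \<inter> N"
    have "germ X ?F y V (smooth_op (sections_Cinf ?F V) 1 (\<lambda>x. smooth_step (x 0)) ?b) =
        germ X ?F y V \<zero>\<^bsub>underlying_ring (sections_Cinf ?F V)\<^esub>"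
    proof (rule unary_smooth_op_germ_zero [OF F D(6) V(1)])
      show "smooth 1 (\<lambda>x. flat (1/2 - x 0))"
        by (intro smooth_flat smooth_diff smooth_const smooth_proj)
      show "flat (1/2 - section_value X ?F V b y) \<noteq> 0"
        using y bval [of y] by (simp add: flat_eq_0_iff N_def)
    qed (use y b st smooth_step_low in auto)
    then show "germ X ?F y V \<rho> = germ X ?F y V \<zero>\<^bsub>lring (ssec \<O> V) 0\<^esub>"
      by (simp add: \<rho>_def)
  qed
  then have "rst ?F V (V \<inter> N) \<rho> = rst ?F N (V \<inter> N) \<zero>\<^bsub>lring (ssec \<O> N) 0\<^esub>"
    by (simp only: rzero [OF V(1) VN Int_lower1] rzero [OF N VN Int_lower2])
  then obtain \<rho>' where \<rho>': "\<rho>' \<in> sec ?F ?T" "rst ?F ?T V \<rho>' = \<rho>" "rst ?F ?T N \<rho>' = \<zero>\<^bsub>lring (ssec \<O> N) 0\<^esub>"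
    using sheaf_glue2 [OF sh V(1) _ N zero [OF N]] \<rho> unfolding cov by auto
  \<comment> \<open>Where \<open>a\<close> exceeds \<open>3/4\<close>, the same argument applies to \<open>\<rho> - 1\<close>.\<close>
  have "rst ?F V W \<rho> = rst ?F V W \<one>\<^bsub>lring (ssec \<O> V) 0\<^esub>"
  proof (rule eqI [OF V(1) W(1,3)])
    show mem: "\<rho> \<in> sec ?F V" "\<one>\<^bsub>lring (ssec \<O> V) 0\<^esub> \<in> sec ?F V"
      using \<rho> one [OF V(1)] by simp_all
    fix y assume y: "y \<in> W"
    have yV: "y \<in> V" and yT: "y \<in> ?T" using y W VT by auto
    let ?R = "lring (ssec \<O> V) 0" and ?S = "underlying_ring (stalk_Cinf X ?F y)"
    interpret G: ring_hom_cring ?R ?S "germ X ?F y V"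
      using Cinf_hom_ring_hom [OF LV stalk_Cinf_ring [OF F yT]] germ_Cinf_hom [OF F V(1) yV] by simp
    have "germ X ?F y V (smooth_op (sections_Cinf ?F V) 1 (\<lambda>x. smooth_step (x 0) - 1) ?b) =
        germ X ?F y V \<zero>\<^bsub>underlying_ring (sections_Cinf ?F V)\<^esub>"
    proof (rule unary_smooth_op_germ_zero [OF F D(6) V(1) yV, where g = "\<lambda>t. flat (t - 3/4)" and f = "\<lambda>t. smooth_step t - 1"])
      show "smooth 1 (\<lambda>x. flat (x 0 - 3/4))" "smooth 1 (\<lambda>x. smooth_step (x 0) - 1)"
        by (intro smooth_flat smooth_diff smooth_const smooth_proj st)+
      show "flat (section_value X ?F V b y - 3/4) \<noteq> 0"
        using y bval [OF yV] by (simp add: flat_eq_0_iff W_def)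
    qed (use b smooth_step_high in simp_all)
    moreover have "smooth_op (level (ssec \<O> V) 0) 1 (\<lambda>x. smooth_step (x 0) - 1) ?b = \<rho> \<ominus>\<^bsub>?R\<^esub> \<one>\<^bsub>?R\<^esub>"
      unfolding \<rho>_def one_underlying const_elt_smooth_op [OF LV bE]
      by (rule smooth_op_minus [OF LV st smooth_const bE, symmetric])
    ultimately have "germ X ?F y V (\<rho> \<ominus>\<^bsub>?R\<^esub> \<one>\<^bsub>?R\<^esub>) = germ X ?F y V \<zero>\<^bsub>?R\<^esub>"
      by simp
    then have "germ X ?F y V \<rho> \<ominus>\<^bsub>?S\<^esub> germ X ?F y V \<one>\<^bsub>?R\<^esub> = \<zero>\<^bsub>?S\<^esub>"
      using mem underlying_closed(4) [OF LV, of "\<one>\<^bsub>?R\<^esub>"] by (simp add: a_minus_def)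
    then show "germ X ?F y V \<rho> = germ X ?F y V \<one>\<^bsub>?R\<^esub>"
      using G.S.eq_if_minus_zero [OF G.hom_closed [of \<rho>] G.hom_closed [of "\<one>\<^bsub>?R\<^esub>"]] mem by simp
  qed
  also have "\<dots> = \<one>\<^bsub>lring (ssec \<O> W) 0\<^esub>"
    by (rule rone [OF V(1) W(1,3)])
  finally have "rst ?F ?T W \<rho>' = \<one>\<^bsub>lring (ssec \<O> W) 0\<^esub>"
    using presheaf_rst_rst [OF Fp openin_topspace V(1) W(1,3) VT \<rho>'(1)] \<rho>'(2) by simp
  moreover have "U \<union> N = ?T"
    using cov V(3) openin_subset [OF U(1)] by blast
  ultimately show ?thesis
    using \<rho>' W N V(3) by (intro that [of \<rho>' W N]) simp_all
qed

section \<open>Gluing local solutions of affine problems\<close>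

abbreviation lerp :: "('a, 'm) ring_scheme \<Rightarrow> 'a \<Rightarrow> 'a \<Rightarrow> 'a \<Rightarrow> 'a"
  where "lerp R \<rho> s t \<equiv> (\<rho> \<otimes>\<^bsub>R\<^esub> s) \<oplus>\<^bsub>R\<^esub> ((\<one>\<^bsub>R\<^esub> \<ominus>\<^bsub>R\<^esub> \<rho>) \<otimes>\<^bsub>R\<^esub> t)"

lemma (in cring) glue_step_identity:
  assumes "T \<in> carrier R" "P \<in> carrier R" "e \<in> carrier R" "\<rho> \<in> carrier R" "s \<in> carrier R"
  shows "(T \<oplus> P \<otimes> e) \<oplus> (P \<otimes> (\<one> \<ominus> \<rho>)) \<otimes> s = T \<oplus> P \<otimes> (e \<oplus> (\<one> \<ominus> \<rho>) \<otimes> s)"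
  using assms by algebra

lemma (in cring) lerp_same:
  assumes "\<rho> \<in> carrier R" "s \<in> carrier R"
  shows "lerp R \<rho> s s = s"
  using assms by algebra

text \<open>
  The pairs \<open>(T\<^sub>n, Q\<^sub>n)\<close> of partial sums and remainders of a partition of unity made from the \<open>\<rho>\<^sub>n\<close>.
\<close>

primrec partial_glue :: "'a ring \<Rightarrow> (nat \<Rightarrow> 'a) \<Rightarrow> (nat \<Rightarrow> 'a) \<Rightarrow> nat \<Rightarrow> 'a \<times> 'a" where
  "partial_glue R \<rho> e 0 = (\<zero>\<^bsub>R\<^esub>, \<one>\<^bsub>R\<^esub>)"
| "partial_glue R \<rho> e (Suc n) =
     (fst (partial_glue R \<rho> e n) \<oplus>\<^bsub>R\<^esub> snd (partial_glue R \<rho> e n) \<otimes>\<^bsub>R\<^esub> e n,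
      snd (partial_glue R \<rho> e n) \<otimes>\<^bsub>R\<^esub> (\<one>\<^bsub>R\<^esub> \<ominus>\<^bsub>R\<^esub> \<rho> n))"

text \<open>
  Put \<open>\<theta>\<^sub>n = Q\<^sub>n \<rho>\<^sub>n\<close>.  Since \<open>Q\<^sub>n\<close> is the product of the \<open>1 - \<rho>\<^sub>j\<close> for \<open>j < n\<close>, the sum of
  \<open>\<theta>\<^sub>0, \<dots>, \<theta>\<^bsub>n-1\<^esub>\<close> is \<open>1 - Q\<^sub>n\<close>, so on the set where one of \<open>\<rho>\<^sub>0, \<dots>, \<rho>\<^bsub>n-1\<^esub>\<close> is \<open>1\<close> they form a partition of
  unity.  With \<open>e\<^sub>n\<close> the extension by zero of \<open>\<rho>\<^sub>n s\<^sub>n\<close>, for a solution \<open>s\<^sub>n\<close> over \<open>U\<^sub>n\<close>, the section \<open>T\<^sub>n\<close>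
  is the sum of the \<open>\<theta>\<^sub>j s\<^sub>j\<close> for \<open>j < n\<close>.

  The invariant is that \<open>T\<^sub>n + Q\<^sub>n a\<close> is a solution over \<open>A\<close> whenever \<open>a\<close> is a solution over \<open>A\<close>, for
  every open \<open>A\<close>: passing from \<open>n\<close> to \<open>n + 1\<close> amounts to replacing \<open>a\<close> by
  \<open>\<rho>\<^sub>n s\<^sub>n + (1 - \<rho>\<^sub>n) a\<close>.  As \<open>Q\<^sub>m\<close> vanishes on \<open>W\<^sub>n\<close> for \<open>m > n\<close>, the sections \<open>T\<^sub>m\<close> are constant there
  from then on and are solutions, and they glue to a global one.
\<close>

lemma glue_affine_solutions:
  assumes F: "Cinf_presheaf X F" and sh: "sheaf X F"
    and R: "\<And>U. R U = underlying_ring (sections_Cinf F U)"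
    and \<rho>: "\<And>n. \<rho> n \<in> sec F (topspace X)"
    and U: "\<And>n :: nat. openin X (U n)" and V: "\<And>n. openin X (V n)" and UV: "\<And>n. U n \<union> V n = topspace X"
    and W: "\<And>n. openin X (W n)" "\<And>n. W n \<subseteq> U n" "(\<Union>n. W n) = topspace X"
    and \<rho>W: "\<And>n. rst F (topspace X) (W n) (\<rho> n) = \<one>\<^bsub>R (W n)\<^esub>"
    and \<rho>V: "\<And>n. rst F (topspace X) (V n) (\<rho> n) = \<zero>\<^bsub>R (V n)\<^esub>"
    and s: "\<And>n. s n \<in> sec F (U n)" "\<And>n. Sol (U n) (s n)"
    and Sol_rst: "\<And>A B a. openin X A \<Longrightarrow> openin X B \<Longrightarrow> B \<subseteq> A \<Longrightarrow> a \<in> sec F A \<Longrightarrow> Sol A a \<Longrightarrow> Sol B (rst F A B a)"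
    and Sol_local: "\<And>\<U> a. (\<And>B. B \<in> \<U> \<Longrightarrow> openin X B) \<Longrightarrow> a \<in> sec F (\<Union>\<U>) \<Longrightarrow>
        (\<And>B. B \<in> \<U> \<Longrightarrow> Sol B (rst F (\<Union>\<U>) B a)) \<Longrightarrow> Sol (\<Union>\<U>) a"
    and Sol_affine: "\<And>n A a b. openin X A \<Longrightarrow> a \<in> sec F A \<Longrightarrow> b \<in> sec F A \<Longrightarrow> Sol A a \<Longrightarrow> Sol A b \<Longrightarrow>
        Sol A (lerp (R A) (rst F (topspace X) A (\<rho> n)) a b)"
  shows "\<exists>t\<in>sec F (topspace X). Sol (topspace X) t"
proof -
  let ?X = "topspace X"
  note P = Cinf_presheafD(1) [OF F]
  have cr: "cring (R A)" if "openin X A" for A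
    unfolding R by (rule cring_underlying [OF Cinf_presheafD(2) [OF F that]])
  have carR: "carrier (R A) = sec F A" for A
    by (simp add: R)
  have hom: "ring_hom_cring (R A) (R B) (rst F A B)" if "openin X A" "openin X B" "B \<subseteq> A" for A B
    unfolding R using that Cinf_presheafD [OF F] by (intro Cinf_hom_ring_hom) blast+
  have sub: "A \<subseteq> ?X" if "openin X A" for A
    using that by (rule openin_subset)
  have UVo: "openin X (U n \<inter> V n)" for n
    using U V by blast
  have "\<exists>e. e \<in> sec F ?X \<and> rst F ?X (U n) e = rst F ?X (U n) (\<rho> n) \<otimes>\<^bsub>R (U n)\<^esub> s n \<and>
      rst F ?X (V n) e = \<zero>\<^bsub>R (V n)\<^esub>" for n
  proof -
    interpret A: cring "R (U n)" by (rule cr [OF U])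
    interpret B: cring "R (V n)" by (rule cr [OF V])
    interpret h: ring_hom_cring "R (U n)" "R (U n \<inter> V n)" "rst F (U n) (U n \<inter> V n)"
      by (rule hom [OF U UVo]) blast
    interpret k: ring_hom_cring "R (V n)" "R (U n \<inter> V n)" "rst F (V n) (U n \<inter> V n)"
      by (rule hom [OF V UVo]) blast
    have r: "rst F ?X (U n) (\<rho> n) \<in> sec F (U n)"
      by (rule presheaf_rst_closed [OF P openin_topspace U sub [OF U] \<rho>])
    have prod: "rst F ?X (U n) (\<rho> n) \<otimes>\<^bsub>R (U n)\<^esub> s n \<in> sec F (U n)"
      using A.m_closed [of "rst F ?X (U n) (\<rho> n)" "s n"] r s(1) by (simp add: carR)
    have z: "\<zero>\<^bsub>R (V n)\<^esub> \<in> sec F (V n)"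
      using B.zero_closed by (simp add: carR)
    have "rst F (U n) (U n \<inter> V n) (rst F ?X (U n) (\<rho> n)) = rst F (V n) (U n \<inter> V n) (rst F ?X (V n) (\<rho> n))"
      using presheaf_rst_rst [OF P openin_topspace U UVo Int_lower1 sub [OF U] \<rho>]
        presheaf_rst_rst [OF P openin_topspace V UVo Int_lower2 sub [OF V] \<rho>] by simp
    also have "\<dots> = \<zero>\<^bsub>R (U n \<inter> V n)\<^esub>"
      unfolding \<rho>V by (rule k.hom_zero)
    finally have "rst F (U n) (U n \<inter> V n) (rst F ?X (U n) (\<rho> n) \<otimes>\<^bsub>R (U n)\<^esub> s n) = rst F (V n) (U n \<inter> V n) \<zero>\<^bsub>R (V n)\<^esub>"
      using h.hom_mult [of "rst F ?X (U n) (\<rho> n)" "s n"] h.hom_closed [of "s n"] r s(1) by (simp add: carR)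
    then obtain e where "e \<in> sec F (U n \<union> V n)" "rst F (U n \<union> V n) (U n) e = rst F ?X (U n) (\<rho> n) \<otimes>\<^bsub>R (U n)\<^esub> s n"
        "rst F (U n \<union> V n) (V n) e = \<zero>\<^bsub>R (V n)\<^esub>"
      using sheaf_glue2 [OF sh U prod V z] by metis
    then show ?thesis
      unfolding UV by blast
  qed
  then obtain e where e: "\<And>n. e n \<in> sec F ?X" "\<And>n. rst F ?X (U n) (e n) = rst F ?X (U n) (\<rho> n) \<otimes>\<^bsub>R (U n)\<^esub> s n"
      "\<And>n. rst F ?X (V n) (e n) = \<zero>\<^bsub>R (V n)\<^esub>"
    by metis
  define T where "T = (\<lambda>n. fst (partial_glue (R ?X) \<rho> e n))"
  define Q where "Q = (\<lambda>n. snd (partial_glue (R ?X) \<rho> e n))"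
  interpret X: cring "R ?X" by (rule cr [OF openin_topspace])
  have T0: "T 0 = \<zero>\<^bsub>R ?X\<^esub>" and Q0: "Q 0 = \<one>\<^bsub>R ?X\<^esub>"
    by (simp_all add: T_def Q_def)
  have TS: "T (Suc n) = T n \<oplus>\<^bsub>R ?X\<^esub> Q n \<otimes>\<^bsub>R ?X\<^esub> e n" and QS: "Q (Suc n) = Q n \<otimes>\<^bsub>R ?X\<^esub> (\<one>\<^bsub>R ?X\<^esub> \<ominus>\<^bsub>R ?X\<^esub> \<rho> n)" for n
    by (simp_all add: T_def Q_def)
  have \<rho>c: "\<rho> n \<in> carrier (R ?X)" and ec: "e n \<in> carrier (R ?X)" for n
    using \<rho> e by (simp_all add: carR)
  have TQ: "T n \<in> carrier (R ?X) \<and> Q n \<in> carrier (R ?X)" for n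
    by (induction n) (simp_all add: T0 Q0 TS QS \<rho>c ec)
  have rTS: "rst F ?X A (T (Suc n)) = rst F ?X A (T n) \<oplus>\<^bsub>R A\<^esub> rst F ?X A (Q n) \<otimes>\<^bsub>R A\<^esub> rst F ?X A (e n)"
    and rQS: "rst F ?X A (Q (Suc n)) = rst F ?X A (Q n) \<otimes>\<^bsub>R A\<^esub> (\<one>\<^bsub>R A\<^esub> \<ominus>\<^bsub>R A\<^esub> rst F ?X A (\<rho> n))"
    if A: "openin X A" for A n
  proof -
    interpret h: ring_hom_cring "R ?X" "R A" "rst F ?X A"
      by (rule hom [OF openin_topspace A sub [OF A]])
    show "rst F ?X A (T (Suc n)) = rst F ?X A (T n) \<oplus>\<^bsub>R A\<^esub> rst F ?X A (Q n) \<otimes>\<^bsub>R A\<^esub> rst F ?X A (e n)"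
      "rst F ?X A (Q (Suc n)) = rst F ?X A (Q n) \<otimes>\<^bsub>R A\<^esub> (\<one>\<^bsub>R A\<^esub> \<ominus>\<^bsub>R A\<^esub> rst F ?X A (\<rho> n))"
      using TQ \<rho>c ec by (simp_all add: TS QS a_minus_def)
  qed
  have rc: "rst F ?X A a \<in> carrier (R A)" if "openin X A" "a \<in> carrier (R ?X)" for A a
    using presheaf_rst_closed [OF P openin_topspace that(1) sub [OF that(1)]] that(2) by (simp add: carR)
  have step: "Sol A (rst F ?X A (e n) \<oplus>\<^bsub>R A\<^esub> (\<one>\<^bsub>R A\<^esub> \<ominus>\<^bsub>R A\<^esub> rst F ?X A (\<rho> n)) \<otimes>\<^bsub>R A\<^esub> a)"
    if A: "openin X A" and a: "a \<in> sec F A" "Sol A a" for A a n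
  proof -
    interpret A: cring "R A" by (rule cr [OF A])
    let ?c = "rst F ?X A (e n) \<oplus>\<^bsub>R A\<^esub> (\<one>\<^bsub>R A\<^esub> \<ominus>\<^bsub>R A\<^esub> rst F ?X A (\<rho> n)) \<otimes>\<^bsub>R A\<^esub> a"
    have ac: "a \<in> carrier (R A)" using a by (simp add: carR)
    have c: "?c \<in> sec F A"
      using rc [OF A] ec \<rho>c ac by (simp flip: carR)
    have cov: "\<Union>{A \<inter> U n, A \<inter> V n} = A"
      using UV [of n] sub [OF A] by blast
    have rs: "rst F A B ?c = rst F ?X B (e n) \<oplus>\<^bsub>R B\<^esub> (\<one>\<^bsub>R B\<^esub> \<ominus>\<^bsub>R B\<^esub> rst F ?X B (\<rho> n)) \<otimes>\<^bsub>R B\<^esub> rst F A B a"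
      if B: "openin X B" "B \<subseteq> A" for B
    proof -
      interpret h: ring_hom_cring "R A" "R B" "rst F A B"
        by (rule hom [OF A B])
      show ?thesis
        using rc [OF A ec] rc [OF A \<rho>c] ac presheaf_rst_rst [OF P openin_topspace A B sub [OF A]] \<rho> e(1)
        by (simp add: a_minus_def)
    qed
    have "Sol (\<Union>{A \<inter> U n, A \<inter> V n}) ?c"
    proof (rule Sol_local)
      show "openin X B" if "B \<in> {A \<inter> U n, A \<inter> V n}" for B
        using that A U V by blast
      show "?c \<in> sec F (\<Union>{A \<inter> U n, A \<inter> V n})"
        unfolding cov by (rule c)
      \<comment> \<open>Inside \<open>U\<^sub>n\<close> this is an affine combination of \<open>s\<^sub>n\<close> and \<open>a\<close>, and inside \<open>V\<^sub>n\<close> it is \<open>a\<close>.\<close>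
      have 1: "Sol (A \<inter> U n) (rst F A (A \<inter> U n) ?c)"
      proof -
        let ?B = "A \<inter> U n"
        have B: "openin X ?B" using A U by blast
        interpret h: ring_hom_cring "R (U n)" "R ?B" "rst F (U n) ?B"
          by (rule hom [OF U B]) blast
        have "rst F ?X ?B (e n) = rst F (U n) ?B (rst F ?X (U n) (e n))"
          using presheaf_rst_rst [OF P openin_topspace U B Int_lower2 sub [OF U] e(1)] by simp
        also have "\<dots> = rst F (U n) ?B (rst F ?X (U n) (\<rho> n)) \<otimes>\<^bsub>R ?B\<^esub> rst F (U n) ?B (s n)"
          unfolding e(2) using rc [OF U \<rho>c] s(1) by (intro h.hom_mult) (simp_all add: carR)
        also have "rst F (U n) ?B (rst F ?X (U n) (\<rho> n)) = rst F ?X ?B (\<rho> n)"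
          by (rule presheaf_rst_rst [OF P openin_topspace U B Int_lower2 sub [OF U] \<rho>])
        finally have eq: "rst F ?X ?B (e n) = rst F ?X ?B (\<rho> n) \<otimes>\<^bsub>R ?B\<^esub> rst F (U n) ?B (s n)" .
        show ?thesis
          unfolding rs [OF B Int_lower1] eq
          by (intro Sol_affine B presheaf_rst_closed [OF P U B Int_lower2 s(1)] presheaf_rst_closed [OF P A B Int_lower1 a(1)]
              Sol_rst [OF U B Int_lower2 s] Sol_rst [OF A B Int_lower1 a])
      qed
      have 2: "Sol (A \<inter> V n) (rst F A (A \<inter> V n) ?c)"
      proof -
        let ?B = "A \<inter> V n"
        have B: "openin X ?B" using A V by blast
        interpret h: ring_hom_cring "R (V n)" "R ?B" "rst F (V n) ?B"
          by (rule hom [OF V B]) blast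
        have r: "rst F ?X ?B b = rst F (V n) ?B (rst F ?X (V n) b)" if "b \<in> sec F ?X" for b
          by (rule presheaf_rst_rst [OF P openin_topspace V B Int_lower2 sub [OF V] that, symmetric])
        have "rst F ?X ?B (e n) = \<zero>\<^bsub>R ?B\<^esub>" "rst F ?X ?B (\<rho> n) = \<zero>\<^bsub>R ?B\<^esub>"
          unfolding r [OF e(1)] r [OF \<rho>] e(3) \<rho>V by (rule h.hom_zero)+
        moreover have "rst F A ?B a \<in> carrier (R ?B)"
          using presheaf_rst_closed [OF P A B Int_lower1 a(1)] by (simp add: carR)
        ultimately have "rst F A ?B ?c = rst F A ?B a"
          unfolding rs [OF B Int_lower1] by (simp add: a_minus_def)
        then show ?thesis
          using Sol_rst [OF A B Int_lower1 a] by simp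
      qed
      show "Sol B (rst F (\<Union>{A \<inter> U n, A \<inter> V n}) B ?c)" if "B \<in> {A \<inter> U n, A \<inter> V n}" for B
        using that 1 2 unfolding cov by blast
    qed
    then show ?thesis unfolding cov .
  qed
  have inv: "\<forall>a\<in>sec F A. Sol A a \<longrightarrow> Sol A (rst F ?X A (T n) \<oplus>\<^bsub>R A\<^esub> rst F ?X A (Q n) \<otimes>\<^bsub>R A\<^esub> a)" if A: "openin X A" for A n
  proof (induction n)
    interpret h: ring_hom_cring "R ?X" "R A" "rst F ?X A"
      by (rule hom [OF openin_topspace A sub [OF A]])
    case 0
    show ?case
      by (simp add: T0 Q0 flip: carR)
  next
    interpret A: cring "R A" by (rule cr [OF A])
    case (Suc n)
    show ?case
    proof (intro ballI impI)
      fix a assume a: "a \<in> sec F A" "Sol A a"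
      let ?c = "rst F ?X A (e n) \<oplus>\<^bsub>R A\<^esub> (\<one>\<^bsub>R A\<^esub> \<ominus>\<^bsub>R A\<^esub> rst F ?X A (\<rho> n)) \<otimes>\<^bsub>R A\<^esub> a"
      have ac: "a \<in> carrier (R A)" using a by (simp add: carR)
      have c: "?c \<in> sec F A"
        using rc [OF A] ec \<rho>c ac by (simp flip: carR)
      have "rst F ?X A (T (Suc n)) \<oplus>\<^bsub>R A\<^esub> rst F ?X A (Q (Suc n)) \<otimes>\<^bsub>R A\<^esub> a =
          rst F ?X A (T n) \<oplus>\<^bsub>R A\<^esub> rst F ?X A (Q n) \<otimes>\<^bsub>R A\<^esub> ?c"
        unfolding rTS [OF A] rQS [OF A] using rc [OF A] TQ ec \<rho>c ac by (intro A.glue_step_identity) blast+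
      then show "Sol A (rst F ?X A (T (Suc n)) \<oplus>\<^bsub>R A\<^esub> rst F ?X A (Q (Suc n)) \<otimes>\<^bsub>R A\<^esub> a)"
        using Suc.IH c step [OF A a] by simp
    qed
  qed
  have Qz: "rst F ?X (W n) (Q (Suc n + d)) = \<zero>\<^bsub>R (W n)\<^esub>" for n d
  proof (induction d)
    interpret A: cring "R (W n)" by (rule cr [OF W(1)])
    case 0
    show ?case
      using rc [OF W(1)] TQ [of n] by (simp add: rQS [OF W(1)] \<rho>W a_minus_def A.r_neg)
  next
    interpret A: cring "R (W n)" by (rule cr [OF W(1)])
    case (Suc d)
    show ?case
      using rc [OF W(1) \<rho>c] Suc by (simp add: rQS [OF W(1)])
  qed
  have Tc: "rst F ?X (W n) (T (Suc n + d)) = rst F ?X (W n) (T (Suc n))" for n d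
  proof (induction d)
    interpret A: cring "R (W n)" by (rule cr [OF W(1)])
    case (Suc d)
    have "rst F ?X (W n) (T (Suc (Suc n + d))) = rst F ?X (W n) (T (Suc n + d))"
      unfolding rTS [OF W(1)] Qz using rc [OF W(1)] ec TQ by simp
    with Suc show ?case by simp
  qed simp
  define t where "t = (\<lambda>n. rst F ?X (W n) (T (Suc n)))"
  have t: "t n \<in> sec F (W n)" for n
    using rc [OF W(1)] TQ by (simp add: t_def carR)
  have St: "Sol (W n) (t n)" for n
  proof -
    interpret A: cring "R (W n)" by (rule cr [OF W(1)])
    let ?a = "rst F (U n) (W n) (s n)"
    have a: "?a \<in> sec F (W n)" "Sol (W n) ?a"
      using presheaf_rst_closed [OF P U W(1,2) s(1)] Sol_rst [OF U W(1,2) s] by auto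
    have eq: "t n \<oplus>\<^bsub>R (W n)\<^esub> rst F ?X (W n) (Q (Suc n)) \<otimes>\<^bsub>R (W n)\<^esub> ?a = t n"
      using Qz [of n 0] a(1) t by (simp flip: carR)
    have "Sol (W n) (t n \<oplus>\<^bsub>R (W n)\<^esub> rst F ?X (W n) (Q (Suc n)) \<otimes>\<^bsub>R (W n)\<^esub> ?a)"
      unfolding t_def using inv [OF W(1), of n "Suc n"] a by blast
    then show ?thesis
      unfolding eq .
  qed
  have "rst F (W i) (W i \<inter> W j) (t i) = rst F (W j) (W i \<inter> W j) (t j)" for i j
  proof -
    have o: "openin X (W i \<inter> W j)" using W(1) by blast
    define m where "m = Suc i + Suc j"
    have m: "t i = rst F ?X (W i) (T m)" "t j = rst F ?X (W j) (T m)"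
      using Tc [of i "Suc j"] Tc [of j "Suc i"] by (simp_all add: t_def m_def add.commute)
    have "T m \<in> sec F ?X" using TQ by (simp add: carR)
    then show ?thesis
      unfolding m using presheaf_rst_rst [OF P openin_topspace W(1) o Int_lower1 sub [OF W(1)]]
        presheaf_rst_rst [OF P openin_topspace W(1) o Int_lower2 sub [OF W(1)]] by simp
  qed
  then obtain r where r: "r \<in> sec F (\<Union>(range W))" "\<And>n. rst F (\<Union>(range W)) (W n) r = t n"
    using sheaf_glue [OF sh, of UNIV W t] W(1) t by auto
  have "Sol (\<Union>(range W)) r"
    by (rule Sol_local [OF _ r(1)]) (use W(1) r(2) St in auto)
  with r(1) W(3) show ?thesis by auto
qed

text \<open>
  The form in which \<open>\<O>\<^sub>k\<close> behaves like a fine sheaf.  The bump functions live in \<open>\<O>\<^sub>0\<close>, which acts on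
  \<open>\<O>\<^sub>k\<close> through the degenerate simplices, and by the Lindelof property countably many of them suffice.
\<close>

lemma localized_space_global_solution:
  assumes L: "localized_space X \<O>"
    and Sol_rst: "\<And>A B a. openin X A \<Longrightarrow> openin X B \<Longrightarrow> B \<subseteq> A \<Longrightarrow> a \<in> spx (ssec \<O> A) k \<Longrightarrow> Sol A a \<Longrightarrow>
        Sol B (srst \<O> A B k a)"
    and Sol_local: "\<And>\<U> a. (\<And>B. B \<in> \<U> \<Longrightarrow> openin X B) \<Longrightarrow> a \<in> spx (ssec \<O> (\<Union>\<U>)) k \<Longrightarrow>
        (\<And>B. B \<in> \<U> \<Longrightarrow> Sol B (srst \<O> (\<Union>\<U>) B k a)) \<Longrightarrow> Sol (\<Union>\<U>) a"
    and Sol_affine: "\<And>A \<rho> a b. openin X A \<Longrightarrow> \<rho> \<in> spx (ssec \<O> A) 0 \<Longrightarrow> a \<in> spx (ssec \<O> A) k \<Longrightarrow>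
        b \<in> spx (ssec \<O> A) k \<Longrightarrow> Sol A a \<Longrightarrow> Sol A b \<Longrightarrow>
        Sol A (lerp (lring (ssec \<O> A) k) (base (ssec \<O> A) k \<rho>) a b)"
    and ex: "\<And>x. x \<in> topspace X \<Longrightarrow> \<exists>U a. openin X U \<and> x \<in> U \<and> a \<in> spx (ssec \<O> U) k \<and> Sol U a"
  shows "\<exists>a\<in>spx (ssec \<O> (topspace X)) k. Sol (topspace X) a"
proof (cases "topspace X = {}")
  case True
  have "\<zero>\<^bsub>lring (ssec \<O> (topspace X)) k\<^esub> \<in> spx (ssec \<O> (topspace X)) k"
    using underlying_zero_one_closed(1) [OF simplicial_CinfD(1) [OF simplicial_sheafD(1) [OF localized_spaceD(1) [OF L] openin_topspace]], of k]
    by simp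
  then show ?thesis
    using Sol_local [of "{}"] True by auto
next
  case False
  note S = localized_spaceD(1) [OF L]
  let ?X = "topspace X"
  have "\<forall>x\<in>?X. \<exists>U a \<rho> W V. openin X U \<and> a \<in> spx (ssec \<O> U) k \<and> Sol U a \<and> \<rho> \<in> spx (ssec \<O> ?X) 0 \<and>
      openin X W \<and> x \<in> W \<and> W \<subseteq> U \<and> openin X V \<and> U \<union> V = ?X \<and>
      srst \<O> ?X W 0 \<rho> = \<one>\<^bsub>lring (ssec \<O> W) 0\<^esub> \<and> srst \<O> ?X V 0 \<rho> = \<zero>\<^bsub>lring (ssec \<O> V) 0\<^esub>"
  proof
    fix x assume "x \<in> ?X"
    then obtain U a where U: "openin X U" "x \<in> U" "a \<in> spx (ssec \<O> U) k" "Sol U a"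
      using ex by blast
    obtain \<rho> W V where "\<rho> \<in> spx (ssec \<O> ?X) 0" "openin X W" "x \<in> W" "W \<subseteq> U" "openin X V" "U \<union> V = ?X"
      "srst \<O> ?X W 0 \<rho> = \<one>\<^bsub>lring (ssec \<O> W) 0\<^esub>" "srst \<O> ?X V 0 \<rho> = \<zero>\<^bsub>lring (ssec \<O> V) 0\<^esub>"
      by (rule bump_section [OF L U(1,2)])
    with U show "\<exists>U a \<rho> W V. openin X U \<and> a \<in> spx (ssec \<O> U) k \<and> Sol U a \<and> \<rho> \<in> spx (ssec \<O> ?X) 0 \<and>
      openin X W \<and> x \<in> W \<and> W \<subseteq> U \<and> openin X V \<and> U \<union> V = ?X \<and>
      srst \<O> ?X W 0 \<rho> = \<one>\<^bsub>lring (ssec \<O> W) 0\<^esub> \<and> srst \<O> ?X V 0 \<rho> = \<zero>\<^bsub>lring (ssec \<O> V) 0\<^esub>"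
      by blast
  qed
  then obtain U a \<rho> W V where *: "\<forall>x\<in>?X. openin X (U x) \<and> a x \<in> spx (ssec \<O> (U x)) k \<and> Sol (U x) (a x) \<and>
      \<rho> x \<in> spx (ssec \<O> ?X) 0 \<and> openin X (W x) \<and> x \<in> W x \<and> W x \<subseteq> U x \<and> openin X (V x) \<and> U x \<union> V x = ?X \<and>
      srst \<O> ?X (W x) 0 (\<rho> x) = \<one>\<^bsub>lring (ssec \<O> (W x)) 0\<^esub> \<and> srst \<O> ?X (V x) 0 (\<rho> x) = \<zero>\<^bsub>lring (ssec \<O> (V x)) 0\<^esub>"
    unfolding bchoice_iff by (elim exE)
  have "Lindelof_space X"
    by (rule second_countable_imp_Lindelof_space [OF localized_space_second_countable [OF L]])
  moreover have "\<forall>A\<in>W ` ?X. openin X A" "\<Union>(W ` ?X) = ?X"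
    using * openin_subset by fastforce+
  ultimately obtain \<V> where \<V>: "countable \<V>" "\<V> \<subseteq> W ` ?X" "\<Union>\<V> = ?X"
    unfolding Lindelof_space_def by metis
  have "\<V> \<noteq> {}" using \<V>(3) False by blast
  then have "\<forall>n. \<exists>x. x \<in> ?X \<and> from_nat_into \<V> n = W x"
    using from_nat_into [of \<V>] \<V>(2) by blast
  then obtain x where x: "\<And>n. x n \<in> ?X" "\<And>n. from_nat_into \<V> n = W (x n)"
    by metis
  have cov: "(\<Union>n. W (x n)) = ?X"
    using \<V>(3) range_from_nat_into [OF \<open>\<V> \<noteq> {}\<close> \<V>(1)] by (simp flip: x(2))
  have x': "openin X (U (x n))" "a (x n) \<in> spx (ssec \<O> (U (x n))) k" "Sol (U (x n)) (a (x n))"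
      "\<rho> (x n) \<in> spx (ssec \<O> ?X) 0" "openin X (W (x n))" "W (x n) \<subseteq> U (x n)" "openin X (V (x n))"
      "U (x n) \<union> V (x n) = ?X"
      "srst \<O> ?X (W (x n)) 0 (\<rho> (x n)) = \<one>\<^bsub>lring (ssec \<O> (W (x n))) 0\<^esub>"
      "srst \<O> ?X (V (x n)) 0 (\<rho> (x n)) = \<zero>\<^bsub>lring (ssec \<O> (V (x n))) 0\<^esub>" for n
    using * x(1) by auto
  have SX: "simplicial_Cinf (ssec \<O> A)" if "openin X A" for A
    by (rule simplicial_sheafD(1) [OF S that])
  have base: "srst \<O> ?X A k (base (ssec \<O> ?X) k r) = base (ssec \<O> A) k (srst \<O> ?X A 0 r)"
    if "openin X A" "r \<in> spx (ssec \<O> ?X) 0" for A r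
    by (rule scring_homD(5) [OF simplicial_sheafD(2) [OF S openin_topspace that(1) openin_subset [OF that(1)]] that(2)])
  have bc: "base (ssec \<O> A) k \<one>\<^bsub>lring (ssec \<O> A) 0\<^esub> = \<one>\<^bsub>lring (ssec \<O> A) k\<^esub>"
    "base (ssec \<O> A) k \<zero>\<^bsub>lring (ssec \<O> A) 0\<^esub> = \<zero>\<^bsub>lring (ssec \<O> A) k\<^esub>" if "openin X A" for A
    using Cinf_hom_const [OF base_hom [OF SX [OF that]]] by (simp_all add: zero_underlying one_underlying)
  have "\<exists>t\<in>sec (level_psh \<O> k) ?X. Sol ?X t"
  proof (rule glue_affine_solutions [where F = "level_psh \<O> k" and R = "\<lambda>A. lring (ssec \<O> A) k"
        and U = "\<lambda>n. U (x n)" and V = "\<lambda>n. V (x n)" and W = "\<lambda>n. W (x n)" and s = "\<lambda>n. a (x n)"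
        and \<rho> = "\<lambda>n. base (ssec \<O> ?X) k (\<rho> (x n))"])
    show "Cinf_presheaf X (level_psh \<O> k)" "sheaf X (level_psh \<O> k)"
      by (rule level_psh_Cinf_presheaf [OF S]) (rule simplicial_sheafD(3) [OF S])
    show "base (ssec \<O> ?X) k (\<rho> (x n)) \<in> sec (level_psh \<O> k) ?X" for n
      using base_closed [OF SX [OF openin_topspace] x'(4)] by simp
    show "rst (level_psh \<O> k) ?X (W (x n)) (base (ssec \<O> ?X) k (\<rho> (x n))) = \<one>\<^bsub>lring (ssec \<O> (W (x n))) k\<^esub>" for n
      using base [OF x'(5,4), of n n] x'(9) bc(1) [OF x'(5)] by simp
    show "rst (level_psh \<O> k) ?X (V (x n)) (base (ssec \<O> ?X) k (\<rho> (x n))) = \<zero>\<^bsub>lring (ssec \<O> (V (x n))) k\<^esub>" for n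
      using base [OF x'(7,4), of n n] x'(10) bc(2) [OF x'(7)] by simp
    show "Sol A (lerp (lring (ssec \<O> A) k) (rst (level_psh \<O> k) ?X A (base (ssec \<O> ?X) k (\<rho> (x n)))) c d)"
      if A: "openin X A" "c \<in> sec (level_psh \<O> k) A" "d \<in> sec (level_psh \<O> k) A" "Sol A c" "Sol A d" for n A c d
    proof -
      have "srst \<O> ?X A 0 (\<rho> (x n)) \<in> spx (ssec \<O> A) 0"
        by (rule scring_homD(2) [OF simplicial_sheafD(2) [OF S openin_topspace A(1) openin_subset [OF A(1)]] x'(4)])
      then show ?thesis
        using Sol_affine [OF A(1)] A base [OF A(1) x'(4)] by simp
    qed
  qed (use x' cov Sol_rst Sol_local in simp_all)
  then show ?thesis by simp
qed

section \<open>Homotopy groups of global sections\<close>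

lemma level_hom:
  assumes A: "simplicial_Cinf A" and B: "simplicial_Cinf B" and h: "h \<in> scring_hom A B"
  shows "ring_hom_cring (lring A k) (lring B k) (h k)"
  using Cinf_hom_ring_hom [OF simplicial_CinfD(1) [OF A] simplicial_CinfD(1) [OF B] scring_homD(1) [OF h]] .

lemma hom_lerp:
  assumes "ring_hom_cring R S h" "\<rho> \<in> carrier R" "s \<in> carrier R" "t \<in> carrier R"
  shows "h (lerp R \<rho> s t) = lerp S (h \<rho>) (h s) (h t)"
proof -
  interpret ring_hom_cring R S h by fact
  show ?thesis using assms by (simp add: a_minus_def)
qed

text \<open>
  The degenerate simplices of \<open>\<rho>\<close> form a sphere based at \<open>\<rho>\<close>, and \<open>\<rho> v + (1 - \<rho>) v = v\<close>, so the base
  point \<open>v\<close> is preserved.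
\<close>

lemma homot_lerp:
  assumes A: "simplicial_Cinf A" and v: "v \<in> spx A 0" and \<rho>: "\<rho> \<in> spx A 0"
    and st: "(s, s') \<in> homot A k v" "(t, t') \<in> homot A k v"
  shows "(lerp (lring A k) (base A k \<rho>) s t, lerp (lring A k) (base A k \<rho>) s' t') \<in> homot A k v"
proof -
  interpret Z: cring "lring A 0" by (rule cring_underlying [OF simplicial_CinfD(1) [OF A]])
  note L = simplicial_CinfD(1) [OF A]
  have o: "\<one>\<^bsub>lring A 0\<^esub> \<in> spx A 0"
    using underlying_zero_one_closed(2) [OF L, of 0] by simp
  have b1: "base A k \<one>\<^bsub>lring A 0\<^esub> = \<one>\<^bsub>lring A k\<^esub>"
    using Cinf_hom_const [OF base_hom [OF A]] by (simp add: one_underlying)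
  have refl: "(base A k r, base A k r) \<in> homot A k r" if "r \<in> spx A 0" for r
    by (rule homot_refl [OF A that base_sphere [OF A that]])
  have m: "\<one>\<^bsub>lring A 0\<^esub> \<ominus>\<^bsub>lring A 0\<^esub> \<rho> \<in> spx A 0"
    using underlying_closed(3) [OF L, of _ 0 \<rho>] o \<rho> by simp
  have mul: "a \<otimes>\<^bsub>lring A 0\<^esub> v \<in> spx A 0" if "a \<in> spx A 0" for a
    using underlying_closed(2) [OF L, of a 0 v] that v by simp
  have "(lerp (lring A k) (base A k \<rho>) s t, lerp (lring A k) (base A k \<rho>) s' t')
      \<in> homot A k (lerp (lring A 0) \<rho> v v)"
    unfolding b1 [symmetric]
    by (intro homot_binary(1) [OF A mul [OF \<rho>] mul [OF m]] homot_binary(2) [OF A \<rho> v] homot_binary(2) [OF A m v]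
        homot_binary(3) [OF A o \<rho>] refl o \<rho> st)
  then show ?thesis
    using Z.lerp_same [of \<rho> v] \<rho> v by simp
qed

text \<open>
  Two global spheres with equal germs are locally homotopic, and homotopies between given spheres
  form an affine problem: an affine combination of two homotopies is again one.
\<close>

lemma homotopy_class_determined_by_germs:
  assumes L: "localized_space X \<O>" and s: "s \<in> ssph \<O> k (topspace X)" and t: "t \<in> ssph \<O> k (topspace X)"
    and eq: "\<And>y. y \<in> topspace X \<Longrightarrow>
      germ X (pi_psh \<O> k) y (topspace X) (sclass \<O> k (topspace X) s) =
      germ X (pi_psh \<O> k) y (topspace X) (sclass \<O> k (topspace X) t)"
  shows "(s, t) \<in> homot (ssec \<O> (topspace X)) k (szero (ssec \<O> (topspace X)))"
proof -
  note S = localized_spaceD(1) [OF L]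
  let ?X = "topspace X"
  note sub = openin_subset
  define Sol where "Sol = (\<lambda>A w. (\<forall>i<k. face (ssec \<O> A) k i w = base (ssec \<O> A) k (szero (ssec \<O> A))) \<and>
    face (ssec \<O> A) k k w = srst \<O> ?X A k s \<and> face (ssec \<O> A) k (Suc k) w = srst \<O> ?X A k t)"
  have SA: "simplicial_Cinf (ssec \<O> A)" if "openin X A" for A
    by (rule simplicial_sheafD(1) [OF S that])
  have h: "srst \<O> A B \<in> scring_hom (ssec \<O> A) (ssec \<O> B)" if "openin X A" "openin X B" "B \<subseteq> A" for A B
    by (rule simplicial_sheafD(2) [OF S that])
  have rface: "face (ssec \<O> B) k i (srst \<O> A B (Suc k) w) = srst \<O> A B k (face (ssec \<O> A) k i w)"
    if "openin X A" "openin X B" "B \<subseteq> A" "w \<in> spx (ssec \<O> A) (Suc k)" for A B w i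
    by (rule scring_homD(4) [OF h [OF that(1-3)] that(4), symmetric])
  have rbase: "srst \<O> A B k (base (ssec \<O> A) k (szero (ssec \<O> A))) = base (ssec \<O> B) k (szero (ssec \<O> B))"
    if "openin X A" "openin X B" "B \<subseteq> A" for A B
    using scring_homD(5) [OF h [OF that] szero_closed [OF SA [OF that(1)]]] szero_hom [OF h [OF that]] by simp
  have rr: "srst \<O> A B k (srst \<O> ?X A k u) = srst \<O> ?X B k u"
    if "openin X A" "openin X B" "B \<subseteq> A" "u \<in> spx (ssec \<O> ?X) k" for A B u
    using presheaf_rst_rst [OF simplicial_sheafD(4) [OF S, of k] openin_topspace that(1-3) sub [OF that(1)], of u] that(4) by simp
  have stX: "s \<in> spx (ssec \<O> ?X) k" "t \<in> spx (ssec \<O> ?X) k"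
    using s t by (auto intro: spheres_spx)
  have rst_mem: "srst \<O> A B k u \<in> spx (ssec \<O> B) k" if "openin X A" "openin X B" "B \<subseteq> A" "u \<in> spx (ssec \<O> A) k" for A B u
    by (rule scring_homD(2) [OF h [OF that(1-3)] that(4)])
  have zb: "base (ssec \<O> A) k (szero (ssec \<O> A)) \<in> spx (ssec \<O> A) k" if "openin X A" for A
    by (rule base_closed [OF SA [OF that] szero_closed [OF SA [OF that]]])
  have "\<exists>w\<in>spx (ssec \<O> ?X) (Suc k). Sol ?X w"
  proof (rule localized_space_global_solution [OF L])
    show "Sol B (srst \<O> A B (Suc k) w)"
      if A: "openin X A" "openin X B" "B \<subseteq> A" "w \<in> spx (ssec \<O> A) (Suc k)" "Sol A w" for A B w
      using A(5) rr [OF A(1-3)] stX unfolding Sol_def rface [OF A(1-4)] by (simp add: rbase [OF A(1-3)])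
  next
    fix \<U> w
    assume \<U>: "\<And>B. B \<in> \<U> \<Longrightarrow> openin X B" and w: "w \<in> spx (ssec \<O> (\<Union>\<U>)) (Suc k)"
      and loc: "\<And>B. B \<in> \<U> \<Longrightarrow> Sol B (srst \<O> (\<Union>\<U>) B (Suc k) w)"
    have o: "openin X (\<Union>\<U>)" using \<U> by blast
    have u: "B \<subseteq> \<Union>\<U>" if "B \<in> \<U>" for B using that by blast
    have fw: "face (ssec \<O> (\<Union>\<U>)) k i w \<in> spx (ssec \<O> (\<Union>\<U>)) k" for i
      by (rule face_closed [OF SA [OF o] w])
    have uniq: "a = b" if ab: "a \<in> spx (ssec \<O> (\<Union>\<U>)) k" "b \<in> spx (ssec \<O> (\<Union>\<U>)) k"
      "\<And>B. B \<in> \<U> \<Longrightarrow> srst \<O> (\<Union>\<U>) B k a = srst \<O> (\<Union>\<U>) B k b" for a b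
    proof (rule sheaf_unique [OF simplicial_sheafD(3) [OF S, of k] \<U>])
    qed (use ab in simp_all)
    have fr: "srst \<O> (\<Union>\<U>) B k (face (ssec \<O> (\<Union>\<U>)) k i w) = face (ssec \<O> B) k i (srst \<O> (\<Union>\<U>) B (Suc k) w)"
      if "B \<in> \<U>" for B i
      by (rule rface [OF o \<U> [OF that] u [OF that] w, symmetric])
    show "Sol (\<Union>\<U>) w"
      unfolding Sol_def
    proof (intro conjI allI impI)
      show "face (ssec \<O> (\<Union>\<U>)) k i w = base (ssec \<O> (\<Union>\<U>)) k (szero (ssec \<O> (\<Union>\<U>)))" if "i < k" for i
        by (rule uniq [OF fw zb [OF o]]) (use loc that in \<open>simp add: fr Sol_def rbase [OF o \<U> u]\<close>)
      show "face (ssec \<O> (\<Union>\<U>)) k k w = srst \<O> ?X (\<Union>\<U>) k s"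
        by (rule uniq [OF fw rst_mem [OF openin_topspace o sub [OF o] stX(1)]])
          (use loc in \<open>simp add: fr Sol_def rr [OF o \<U> u stX(1)]\<close>)
      show "face (ssec \<O> (\<Union>\<U>)) k (Suc k) w = srst \<O> ?X (\<Union>\<U>) k t"
        by (rule uniq [OF fw rst_mem [OF openin_topspace o sub [OF o] stX(2)]])
          (use loc in \<open>simp add: fr Sol_def rr [OF o \<U> u stX(2)]\<close>)
    qed
  next
    fix A \<rho> a b
    assume A: "openin X A" and \<rho>: "\<rho> \<in> spx (ssec \<O> A) 0"
      and ab: "a \<in> spx (ssec \<O> A) (Suc k)" "b \<in> spx (ssec \<O> A) (Suc k)" "Sol A a" "Sol A b"
    let ?A = "ssec \<O> A"
    interpret cring "lring ?A k" by (rule cring_underlying [OF simplicial_CinfD(1) [OF SA [OF A]]])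
    have "face ?A k i (lerp (lring ?A (Suc k)) (base ?A (Suc k) \<rho>) a b) =
        lerp (lring ?A k) (base ?A k \<rho>) (face ?A k i a) (face ?A k i b)" for i
      using hom_lerp [OF Cinf_hom_ring_hom [OF simplicial_CinfD(1) simplicial_CinfD(1) face_hom], OF SA [OF A] SA [OF A] SA [OF A],
          of "base ?A (Suc k) \<rho>" k a b i] base_closed [OF SA [OF A] \<rho>] ab face_base [OF SA [OF A] \<rho>] by simp
    moreover have "lerp (lring ?A k) (base ?A k \<rho>) u u = u" if "u \<in> spx ?A k" for u
      using lerp_same [of "base ?A k \<rho>" u] base_closed [OF SA [OF A] \<rho>] that by simp
    ultimately show "Sol A (lerp (lring ?A (Suc k)) (base ?A (Suc k) \<rho>) a b)"
      using ab(3,4) zb [OF A] rst_mem [OF openin_topspace A sub [OF A]] stX unfolding Sol_def by simp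
  next
    fix y assume y: "y \<in> ?X"
    obtain W where W: "openin X W" "y \<in> W" "W \<subseteq> ?X"
      "rst (pi_psh \<O> k) ?X W (sclass \<O> k ?X s) = rst (pi_psh \<O> k) ?X W (sclass \<O> k ?X t)"
      using germ_eqE [OF pi_psh_presheaf [OF S] eq [OF y] openin_topspace y] hclass_in_pi [OF t] by (metis pi_psh_simps(1))
    have "sclass \<O> k W (srst \<O> ?X W k s) = sclass \<O> k W (srst \<O> ?X W k t)"
      using W(4) sclass_rst [OF S openin_topspace W(1,3)] s t by simp
    then have "(srst \<O> ?X W k s, srst \<O> ?X W k t) \<in> homot (ssec \<O> W) k (szero (ssec \<O> W))"
      using hclass_eq_iff [OF SA [OF W(1)] szero_closed [OF SA [OF W(1)]] ssph_rst [OF S openin_topspace W(1,3) s]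
          ssph_rst [OF S openin_topspace W(1,3) t]] by blast
    then show "\<exists>U w. openin X U \<and> y \<in> U \<and> w \<in> spx (ssec \<O> U) (Suc k) \<and> Sol U w"
      unfolding homot_iff Sol_def using W(1,2) by blast
  qed
  then obtain w where w: "w \<in> spx (ssec \<O> ?X) (Suc k)" "Sol ?X w" by blast
  have "srst \<O> ?X ?X k s = s" "srst \<O> ?X ?X k t = t"
    using presheaf_rst_id [OF simplicial_sheafD(4) [OF S, of k] openin_topspace] stX by simp_all
  then show ?thesis
    using w s t unfolding homot_iff Sol_def by auto
qed

text \<open>
  The spheres representing a given section of the homotopy sheaf form an affine problem as well: if
  \<open>s\<close> and \<open>t\<close> are homotopic near a point, then \<open>\<rho> s + (1 - \<rho>) t\<close> is homotopic to
  \<open>\<rho> t + (1 - \<rho>) t = t\<close>.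
\<close>

lemma global_sphere_exists:
  assumes L: "localized_space X \<O>" and \<sigma>: "\<sigma> \<in> germ_sections X (pi_psh \<O> k) (topspace X)"
  shows "\<exists>s\<in>ssph \<O> k (topspace X). \<forall>y\<in>topspace X. germ X (pi_psh \<O> k) y (topspace X) (sclass \<O> k (topspace X) s) = \<sigma> y"
proof -
  note S = localized_spaceD(1) [OF L]
  let ?X = "topspace X" and ?F = "pi_psh \<O> k"
  note P = pi_psh_presheaf [OF S, of k]
  define Sol where "Sol = (\<lambda>A s. s \<in> ssph \<O> k A \<and> (\<forall>y\<in>A. germ X ?F y A (sclass \<O> k A s) = \<sigma> y))"
  have SA: "simplicial_Cinf (ssec \<O> A)" if "openin X A" for A
    by (rule simplicial_sheafD(1) [OF S that])
  have h: "srst \<O> A B \<in> scring_hom (ssec \<O> A) (ssec \<O> B)" if "openin X A" "openin X B" "B \<subseteq> A" for A B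
    by (rule simplicial_sheafD(2) [OF S that])
  have clg: "germ X ?F y B (sclass \<O> k B (srst \<O> A B k s)) = germ X ?F y A (sclass \<O> k A s)"
    if "openin X A" "openin X B" "B \<subseteq> A" "s \<in> ssph \<O> k A" "y \<in> B" for A B s y
    using germ_rst [OF P that(1) _ that(2,3,5), of "sclass \<O> k A s"] hclass_in_pi [OF that(4)]
      sclass_rst [OF S that(1-4)] by simp
  have "\<exists>s\<in>spx (ssec \<O> ?X) k. Sol ?X s"
  proof (rule localized_space_global_solution [OF L])
    show "Sol B (srst \<O> A B k s)" if A: "openin X A" "openin X B" "B \<subseteq> A" "s \<in> spx (ssec \<O> A) k" "Sol A s" for A B s
      using A(5) clg [OF A(1-3)] ssph_rst [OF S A(1-3)] A(3) unfolding Sol_def by (simp add: subset_iff)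
  next
    fix \<U> s
    assume \<U>: "\<And>B. B \<in> \<U> \<Longrightarrow> openin X B" and s: "s \<in> spx (ssec \<O> (\<Union>\<U>)) k"
      and loc: "\<And>B. B \<in> \<U> \<Longrightarrow> Sol B (srst \<O> (\<Union>\<U>) B k s)"
    have o: "openin X (\<Union>\<U>)" using \<U> by blast
    have u: "B \<subseteq> \<Union>\<U>" if "B \<in> \<U>" for B using that by blast
    have sp: "s \<in> ssph \<O> k (\<Union>\<U>)"
      unfolding spheres_iff
    proof (intro conjI allI impI s)
      fix j i assume k: "k = Suc j" "i \<le> k"
      have s': "s \<in> spx (ssec \<O> (\<Union>\<U>)) (Suc j)" using s k by simp
      have "rst (level_psh \<O> j) (\<Union>\<U>) B (face (ssec \<O> (\<Union>\<U>)) j i s) =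
          rst (level_psh \<O> j) (\<Union>\<U>) B (base (ssec \<O> (\<Union>\<U>)) j (szero (ssec \<O> (\<Union>\<U>))))" if B: "B \<in> \<U>" for B
      proof -
        note hB = h [OF o \<U> [OF B] u [OF B]]
        have "srst \<O> (\<Union>\<U>) B k s \<in> ssph \<O> k B"
          using loc [OF B] by (simp add: Sol_def)
        then have "face (ssec \<O> B) j i (srst \<O> (\<Union>\<U>) B k s) = base (ssec \<O> B) j (szero (ssec \<O> B))"
          using k by (simp add: spheres_iff)
        then show ?thesis
          using scring_homD(4) [OF hB s', of i] scring_homD(5) [OF hB szero_closed [OF SA [OF o]], of j] szero_hom [OF hB] k
          by simp
      qed
      then show "face (ssec \<O> (\<Union>\<U>)) j i s = base (ssec \<O> (\<Union>\<U>)) j (szero (ssec \<O> (\<Union>\<U>)))"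
        using face_closed [OF SA [OF o] s'] base_closed [OF SA [OF o] szero_closed [OF SA [OF o]]]
          sheaf_unique [OF simplicial_sheafD(3) [OF S, of j] \<U>] by simp
    qed
    have ge: "germ X ?F y (\<Union>\<U>) (sclass \<O> k (\<Union>\<U>) s) = \<sigma> y" if y: "y \<in> \<Union>\<U>" for y
    proof -
      obtain B where B: "B \<in> \<U>" "y \<in> B" using y by blast
      then show ?thesis
        using clg [OF o \<U> [OF B(1)] u [OF B(1)] sp B(2)] loc [OF B(1)] by (simp add: Sol_def)
    qed
    show "Sol (\<Union>\<U>) s"
      unfolding Sol_def by (intro conjI ballI sp ge)
  next
    fix A \<rho> a b
    assume A: "openin X A" and \<rho>: "\<rho> \<in> spx (ssec \<O> A) 0"
      and ab: "a \<in> spx (ssec \<O> A) k" "b \<in> spx (ssec \<O> A) k" "Sol A a" "Sol A b"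
    let ?l = "\<lambda>A \<rho> a b. lerp (lring (ssec \<O> A) k) (base (ssec \<O> A) k \<rho>) a b"
    have sp: "a \<in> ssph \<O> k A" "b \<in> ssph \<O> k A" using ab by (simp_all add: Sol_def)
    note z = szero_closed [OF SA [OF A]]
    have l: "?l A \<rho> a b \<in> ssph \<O> k A"
      using homot_lerp [OF SA [OF A] z \<rho> homot_refl [OF SA [OF A] z sp(1)] homot_refl [OF SA [OF A] z sp(2)]]
      by (rule homot_spheres)
    have "germ X ?F y A (sclass \<O> k A (?l A \<rho> a b)) = germ X ?F y A (sclass \<O> k A b)" if y: "y \<in> A" for y
    proof -
      have "germ X ?F y A (sclass \<O> k A a) = germ X ?F y A (sclass \<O> k A b)"
        using ab(3,4) y by (simp add: Sol_def)
      then obtain W where W: "openin X W" "y \<in> W" "W \<subseteq> A"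
        "rst ?F A W (sclass \<O> k A a) = rst ?F A W (sclass \<O> k A b)"
        using germ_eqE [OF P _ A y] hclass_in_pi [OF sp(2)] by (metis pi_psh_simps(1))
      let ?r = "srst \<O> A W k"
      note SW = SA [OF W(1)]
      note zW = szero_closed [OF SW]
      have spW: "?r a \<in> ssph \<O> k W" "?r b \<in> ssph \<O> k W"
        using ssph_rst [OF S A W(1,3)] sp by simp_all
      have "(?r a, ?r b) \<in> homot (ssec \<O> W) k (szero (ssec \<O> W))"
        using W(4) sclass_rst [OF S A W(1,3)] sp hclass_eq_iff [OF SW zW spW] by simp
      moreover have \<rho>W: "srst \<O> A W 0 \<rho> \<in> spx (ssec \<O> W) 0"
        by (rule scring_homD(2) [OF h [OF A W(1,3)] \<rho>])
      ultimately have "(?l W (srst \<O> A W 0 \<rho>) (?r a) (?r b), ?l W (srst \<O> A W 0 \<rho>) (?r b) (?r b))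
          \<in> homot (ssec \<O> W) k (szero (ssec \<O> W))"
        by (intro homot_lerp SW zW homot_refl spW)
      moreover have "?l W (srst \<O> A W 0 \<rho>) (?r b) (?r b) = ?r b"
        using cring.lerp_same [OF cring_underlying [OF simplicial_CinfD(1) [OF SW, of k]], of "base (ssec \<O> W) k (srst \<O> A W 0 \<rho>)" "?r b"]
          base_closed [OF SW \<rho>W] spheres_spx [OF spW(2)] by simp
      moreover have "?r (?l A \<rho> a b) = ?l W (srst \<O> A W 0 \<rho>) (?r a) (?r b)"
        using hom_lerp [OF level_hom [OF SA [OF A] SW h [OF A W(1,3)]], of "base (ssec \<O> A) k \<rho>" k a b]
          base_closed [OF SA [OF A] \<rho>] ab scring_homD(5) [OF h [OF A W(1,3)] \<rho>] by simp
      ultimately have "sclass \<O> k W (?r (?l A \<rho> a b)) = sclass \<O> k W (?r b)"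
        using hclass_eq_iff [OF SW zW ssph_rst [OF S A W(1,3) l] spW(2)] by simp
      then show ?thesis
        using clg [OF A W(1,3) l W(2)] clg [OF A W(1,3) sp(2) W(2)] by simp
    qed
    with l ab(4) show "Sol A (?l A \<rho> a b)"
      by (simp add: Sol_def)
  next
    fix y assume y: "y \<in> ?X"
    obtain V c where V: "openin X V" "y \<in> V" "c \<in> sec ?F V" "\<forall>z\<in>?X \<inter> V. \<sigma> z = germ X ?F z V c"
      using germ_sections_local [OF \<sigma> y] by metis
    obtain s where s: "s \<in> ssph \<O> k V" "c = sclass \<O> k V s"
      using V(3) unfolding pi_psh_simps by (elim pi_setE)
    have "Sol V s"
      using s V(4) openin_subset [OF V(1)] by (simp add: Sol_def subset_iff)
    with V spheres_spx [OF s(1)] show "\<exists>U a. openin X U \<and> y \<in> U \<and> a \<in> spx (ssec \<O> U) k \<and> Sol U a"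
      by blast
  qed
  then show ?thesis
    unfolding Sol_def by blast
qed

text \<open>
  The two preceding lemmas are injectivity and surjectivity, on representatives.
\<close>

theorem pi_global_sections:
  assumes L: "localized_space X \<O>"
  shows "bij_betw (to_sheaf X (pi_psh \<O> k) (topspace X)) (pi_ring (global_sections X \<O>) k)
    (germ_sections X (pi_psh \<O> k) (topspace X))"
proof -
  let ?X = "topspace X" and ?F = "pi_psh \<O> k"
  note S = localized_spaceD(1) [OF L]
  note SX = simplicial_sheafD(1) [OF S openin_topspace]
  have inj: "c = d" if c: "c \<in> pi_ring (ssec \<O> ?X) k" and d: "d \<in> pi_ring (ssec \<O> ?X) k"
    and eq: "to_sheaf X ?F ?X c = to_sheaf X ?F ?X d" for c d
  proof -
    obtain s where s: "s \<in> ssph \<O> k ?X" "c = sclass \<O> k ?X s" using c by (rule pi_setE)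
    obtain t where t: "t \<in> ssph \<O> k ?X" "d = sclass \<O> k ?X t" using d by (rule pi_setE)
    have "germ X ?F y ?X c = germ X ?F y ?X d" if "y \<in> ?X" for y
      using fun_cong [OF eq, of y] that by (simp add: to_sheaf_def)
    then have "(s, t) \<in> homot (ssec \<O> ?X) k (szero (ssec \<O> ?X))"
      unfolding s(2) t(2) by (rule homotopy_class_determined_by_germs [OF L s(1) t(1)])
    then show ?thesis
      unfolding s(2) t(2) using hclass_eq_iff [OF SX szero_closed [OF SX] s(1) t(1)] by blast
  qed
  have mem: "to_sheaf X ?F ?X c \<in> germ_sections X ?F ?X" if "c \<in> pi_ring (ssec \<O> ?X) k" for c
    using that by (intro to_sheaf_closed openin_topspace) simp
  have surj: "\<exists>c\<in>pi_ring (ssec \<O> ?X) k. to_sheaf X ?F ?X c = \<sigma>" if \<sigma>: "\<sigma> \<in> germ_sections X ?F ?X" for \<sigma>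
  proof -
    obtain s where s: "s \<in> ssph \<O> k ?X" "\<And>y. y \<in> ?X \<Longrightarrow> germ X ?F y ?X (sclass \<O> k ?X s) = \<sigma> y"
      using global_sphere_exists [OF L \<sigma>] by (elim bexE) simp
    have "to_sheaf X ?F ?X (sclass \<O> k ?X s) = restrict \<sigma> ?X"
      unfolding to_sheaf_def by (rule restrict_ext) (rule s(2))
    then show ?thesis
      using germ_sections_extensional [OF \<sigma>] hclass_in_pi [OF s(1)] by (intro bexI [of _ "sclass \<O> k ?X s"]) simp_all
  qed
  show ?thesis
    unfolding global_sections_def
  proof (rule bij_betwI')
    show "(to_sheaf X ?F ?X c = to_sheaf X ?F ?X d) = (c = d)"
      if "c \<in> pi_ring (ssec \<O> ?X) k" "d \<in> pi_ring (ssec \<O> ?X) k" for c d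
      using inj [OF that] by auto
    show "\<exists>c\<in>pi_ring (ssec \<O> ?X) k. \<sigma> = to_sheaf X ?F ?X c" if "\<sigma> \<in> germ_sections X ?F ?X" for \<sigma>
      using surj [OF that] by (elim bexE) (intro bexI, rule sym)
  qed (rule mem)
qed

lemma finitely_generated_bij:
  assumes A: "Cinf_ring A" and h: "h \<in> Cinf_hom A B" and bij: "bij_betw h (carrier A) (carrier B)"
    and fg: "finitely_generated B"
  shows "finitely_generated A"
proof -
  obtain n H where H: "H \<in> Cinf_hom (free_Cinf n) B" "H ` Cinf n = carrier B"
    using fg unfolding finitely_generated_def by blast
  define g where "g = the_inv_into (carrier A) h"
  have inj: "inj_on h (carrier A)" and im: "h ` carrier A = carrier B"
    using bij by (simp_all add: bij_betw_def)
  have g: "g b \<in> carrier A" "h (g b) = b" if "b \<in> carrier B" for b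
    using the_inv_into_into [OF inj, of b "carrier A"] f_the_inv_into_f [OF inj, of b] that im by (simp_all add: g_def)
  have free: "carrier (free_Cinf n) = Cinf n"
    by (simp add: free_Cinf_def)
  have Hc: "H a \<in> carrier B" if "a \<in> Cinf n" for a
    using Cinf_hom_closed [OF H(1), of a] that by (simp add: free)
  have "g \<circ> H \<in> Cinf_hom (free_Cinf n) A"
  proof (rule Cinf_homI)
    show "(g \<circ> H) a \<in> carrier A" if "a \<in> carrier (free_Cinf n)" for a
      using that g Hc by (simp add: free)
    fix m f a assume f: "f \<in> Cinf m" and a: "a \<in> {..<m} \<rightarrow>\<^sub>E carrier (free_Cinf n)"
    have ai: "a i \<in> Cinf n" if "i < m" for i
      using a that by (auto simp: free)
    let ?Ha = "\<lambda>i\<in>{..<m}. H (a i)" and ?ga = "\<lambda>i\<in>{..<m}. (g \<circ> H) (a i)"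
    have ga: "?ga \<in> {..<m} \<rightarrow>\<^sub>E carrier A"
      using ai Hc g by simp
    have eq: "H (cop (free_Cinf n) m f a) = cop B m f ?Ha"
      by (rule Cinf_hom_cop [OF H(1) f a])
    have "h (cop A m f ?ga) = cop B m f (\<lambda>i\<in>{..<m}. h (?ga i))"
      by (rule Cinf_hom_cop [OF h f ga])
    also have "(\<lambda>i\<in>{..<m}. h (?ga i)) = ?Ha"
      using ai Hc g by (intro restrict_ext) simp
    finally have "h (cop A m f ?ga) = H (cop (free_Cinf n) m f a)"
      unfolding eq .
    moreover have "g (h (cop A m f ?ga)) = cop A m f ?ga"
      unfolding g_def by (rule the_inv_into_f_f [OF inj cop_closed [OF A f]]) (rule ga [unfolded g_def])
    ultimately show "(g \<circ> H) (cop (free_Cinf n) m f a) = cop A m f (\<lambda>i\<in>{..<m}. (g \<circ> H) (a i))"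
      by simp
  qed
  moreover have "(g \<circ> H) ` Cinf n = carrier A"
  proof -
    have "g ` carrier B = carrier A"
      unfolding im [symmetric] g_def using the_inv_into_onto [OF inj] by simp
    then show ?thesis
      by (simp only: image_comp [symmetric] H(2))
  qed
  ultimately show ?thesis
    unfolding finitely_generated_def by blast
qed

lemma germ_cong: "sec F = sec G \<Longrightarrow> rst F = rst G \<Longrightarrow> germ X F = germ X G"
  by (simp add: germ_def fun_eq_iff)

lemma germ_sections_cong:
  assumes "sec F = sec G" "rst F = rst G"
  shows "germ_sections X F = germ_sections X G"
  unfolding germ_sections_def stalk_def germ_cong [OF assms, of X] assms(1) ..

lemma global_sections_in_sL:
  assumes L: "localized_space X \<O>"
  shows "in_sL (global_sections X \<O>)"
proof -
  let ?X = "topspace X"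
  note D = localized_spaceD [OF L]
  note SX = simplicial_sheafD(1) [OF D(1) openin_topspace]
  have e: "sec (pi0_psh \<O>) = sec (pi_psh \<O> 0)" "rst (pi0_psh \<O>) = rst (pi_psh \<O> 0)"
    by simp_all
  have "to_sheaf X (pi0_psh \<O>) ?X \<in> Cinf_hom (pi0_Cinf (ssec \<O> ?X)) (sections_Cinf (pi0_sheaf X \<O>) ?X)"
    unfolding pi0_sheaf_def
    using to_sheaf_Cinf_hom [OF pi0_psh_Cinf_presheaf [OF D(1)] openin_topspace] unfolding pi0_psh_simps .
  moreover have "bij_betw (to_sheaf X (pi0_psh \<O>) ?X) (carrier (pi0_Cinf (ssec \<O> ?X))) (carrier (sections_Cinf (pi0_sheaf X \<O>) ?X))"
    unfolding pi0_Cinf_simps sections_Cinf_simps pi0_sheaf_def sheafify_Cinf_simps(1) germ_sections_cong [OF e]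
      to_sheaf_def [abs_def] germ_cong [OF e]
    using pi_global_sections [OF L, of 0] unfolding to_sheaf_def [abs_def] global_sections_def .
  ultimately have "finitely_generated (pi0_Cinf (ssec \<O> ?X))"
    by (rule finitely_generated_bij [OF pi0_Cinf_ring [OF SX] _ _ D(4)])
  then show ?thesis
    using SX by (simp add: in_sL_def global_sections_def)
qed

section \<open>Naturality and change of base point\<close>

lemma germ_map_germ:
  assumes P: "presheaf X P" and Q: "presheaf Y Q" and \<phi>: "continuous_map X Y \<phi>"
    and \<psi>: "\<And>V t. openin Y V \<Longrightarrow> t \<in> sec Q V \<Longrightarrow> \<psi> V t \<in> sec P (preim X \<phi> V)"
    and nat: "\<And>V W t. openin Y V \<Longrightarrow> openin Y W \<Longrightarrow> W \<subseteq> V \<Longrightarrow> t \<in> sec Q V \<Longrightarrow>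
      \<psi> W (rst Q V W t) = rst P (preim X \<phi> V) (preim X \<phi> W) (\<psi> V t)"
    and V: "openin Y V" "c \<in> sec Q V" and x: "x \<in> topspace X" "\<phi> x \<in> V"
  shows "germ_map X P \<phi> \<psi> x (germ Y Q (\<phi> x) V c) = germ X P x (preim X \<phi> V) (\<psi> V c)"
proof -
  have pre: "openin X (preim X \<phi> W)" if "openin Y W" for W
    using \<phi> that by (simp add: preim_def continuous_map_def)
  have "germ X P x (preim X \<phi> V') (\<psi> V' t) = germ X P x (preim X \<phi> V) (\<psi> V c)"
    if "(V', t) \<in> germ Y Q (\<phi> x) V c" for V' t
  proof -
    obtain W where V': "openin Y V'" "t \<in> sec Q V'"
      and W: "openin Y W" "\<phi> x \<in> W" "W \<subseteq> V" "W \<subseteq> V'" "rst Q V W c = rst Q V' W t"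
      using \<open>(V', t) \<in> germ Y Q (\<phi> x) V c\<close> by (auto simp: germ_def)
    show ?thesis
    proof (rule germ_eqI [OF P pre [OF V'(1)] \<psi> [OF V'] pre [OF V(1)] \<psi> [OF V] pre [OF W(1)]])
      show "x \<in> preim X \<phi> W" "preim X \<phi> W \<subseteq> preim X \<phi> V'" "preim X \<phi> W \<subseteq> preim X \<phi> V"
        using x W by (auto simp: preim_def)
      show "rst P (preim X \<phi> V') (preim X \<phi> W) (\<psi> V' t) = rst P (preim X \<phi> V) (preim X \<phi> W) (\<psi> V c)"
        using nat [OF V'(1) W(1,4) V'(2)] nat [OF V(1) W(1,3) V(2)] W(5) by simp
    qed
  qed
  moreover have "(V, c) \<in> germ Y Q (\<phi> x) V c"
    by (rule germ_self [OF Q V(1) x(2) V(2)])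
  ultimately show ?thesis
    unfolding germ_map_def by blast
qed

lemma pi_sheaf_map_to_sheaf:
  assumes SX: "simplicial_sheaf X \<O>X" and SY: "simplicial_sheaf Y \<O>Y"
    and m: "space_morphism X \<O>X Y \<O>Y \<phi> \<phi>s" and c: "c \<in> pi_ring (ssec \<O>Y (topspace Y)) k"
  shows "pi_sheaf_map X \<O>X \<phi> \<phi>s k (topspace Y) (to_sheaf Y (pi_psh \<O>Y k) (topspace Y) c) =
    to_sheaf X (pi_psh \<O>X k) (topspace X)
      (pi_map (ssec \<O>X (topspace X)) k (szero (ssec \<O>X (topspace X))) (\<phi>s (topspace Y)) c)"
proof -
  let ?\<psi> = "\<lambda>V. pi_map (ssec \<O>X (preim X \<phi> V)) k (szero (ssec \<O>X (preim X \<phi> V))) (\<phi>s V)"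
  have \<phi>: "continuous_map X Y \<phi>" and h: "\<And>V. openin Y V \<Longrightarrow> \<phi>s V \<in> scring_hom (ssec \<O>Y V) (ssec \<O>X (preim X \<phi> V))"
    and nat: "\<And>V W s. openin Y V \<Longrightarrow> openin Y W \<Longrightarrow> W \<subseteq> V \<Longrightarrow> s \<in> spx (ssec \<O>Y V) k \<Longrightarrow>
        \<phi>s W k (srst \<O>Y V W k s) = srst \<O>X (preim X \<phi> V) (preim X \<phi> W) k (\<phi>s V k s)"
    using m unfolding space_morphism_def by blast+
  have pre: "openin X (preim X \<phi> W)" if "openin Y W" for W
    using \<phi> that by (simp add: preim_def continuous_map_def)
  have preT: "preim X \<phi> (topspace Y) = topspace X"
    by (rule preim_topspace [OF \<phi>])
  have A: "simplicial_Cinf (ssec \<O>Y V)" and B: "simplicial_Cinf (ssec \<O>X (preim X \<phi> V))" if "openin Y V" for V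
    using simplicial_sheafD(1) [OF SY that] simplicial_sheafD(1) [OF SX pre [OF that]] .
  have cl: "?\<psi> V (sclass \<O>Y k V s) = sclass \<O>X k (preim X \<phi> V) (\<phi>s V k s)"
    and sp: "\<phi>s V k s \<in> ssph \<O>X k (preim X \<phi> V)" if "openin Y V" "s \<in> ssph \<O>Y k V" for V s
    using pi_map_hclass [OF A [OF that(1)] B [OF that(1)] h [OF that(1)] szero_closed [OF A [OF that(1)]] that(2)]
      spheres_hom [OF h [OF that(1)] szero_closed [OF A [OF that(1)]] that(2)] szero_hom [OF h [OF that(1)]] by simp_all
  have g: "germ_map X (pi_psh \<O>X k) \<phi> ?\<psi> x (germ Y (pi_psh \<O>Y k) (\<phi> x) (topspace Y) c) =
      germ X (pi_psh \<O>X k) x (preim X \<phi> (topspace Y)) (?\<psi> (topspace Y) c)" if x: "x \<in> topspace X" for x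
  proof (rule germ_map_germ [OF pi_psh_presheaf [OF SX] pi_psh_presheaf [OF SY] \<phi> _ _ openin_topspace _ x])
    show "?\<psi> V t \<in> sec (pi_psh \<O>X k) (preim X \<phi> V)" if V: "openin Y V" "t \<in> sec (pi_psh \<O>Y k) V" for V t
    proof -
      obtain s where s: "s \<in> ssph \<O>Y k V" "t = sclass \<O>Y k V s"
        using V(2) unfolding pi_psh_simps by (elim pi_setE)
      show ?thesis
        unfolding s(2) cl [OF V(1) s(1)] pi_psh_simps by (rule hclass_in_pi [OF sp [OF V(1) s(1)]])
    qed
    show "?\<psi> W (rst (pi_psh \<O>Y k) V W t) = rst (pi_psh \<O>X k) (preim X \<phi> V) (preim X \<phi> W) (?\<psi> V t)"
      if V: "openin Y V" "openin Y W" "W \<subseteq> V" "t \<in> sec (pi_psh \<O>Y k) V" for V W t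
    proof -
      obtain s where s: "s \<in> ssph \<O>Y k V" "t = sclass \<O>Y k V s"
        using V(4) unfolding pi_psh_simps by (elim pi_setE)
      have pVW: "preim X \<phi> W \<subseteq> preim X \<phi> V"
        using V(3) by (auto simp: preim_def)
      show ?thesis
        unfolding s(2) sclass_rst [OF SY V(1-3) s(1)] cl [OF V(2) ssph_rst [OF SY V(1-3) s(1)]] cl [OF V(1) s(1)]
          sclass_rst [OF SX pre [OF V(1)] pre [OF V(2)] pVW sp [OF V(1) s(1)]] nat [OF V(1-3) spheres_spx [OF s(1)]] ..
    qed
    show "c \<in> sec (pi_psh \<O>Y k) (topspace Y)" using c by simp
    show "\<phi> x \<in> topspace Y"
      using \<phi> x by (auto simp: continuous_map_def)
  qed
  have \<phi>x: "\<phi> x \<in> topspace Y" if "x \<in> topspace X" for x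
    using \<phi> that by (auto simp: continuous_map_def)
  show ?thesis
    unfolding pi_sheaf_map_def sheafify_map_def preT to_sheaf_def [of X]
  proof (rule restrict_ext)
    fix x assume x: "x \<in> topspace X"
    have "to_sheaf Y (pi_psh \<O>Y k) (topspace Y) c (\<phi> x) = germ Y (pi_psh \<O>Y k) (\<phi> x) (topspace Y) c"
      using \<phi>x [OF x] by (simp add: to_sheaf_def)
    then show "germ_map X (pi_psh \<O>X k) \<phi> ?\<psi> x (to_sheaf Y (pi_psh \<O>Y k) (topspace Y) c (\<phi> x)) =
        germ X (pi_psh \<O>X k) x (topspace X)
          (pi_map (ssec \<O>X (topspace X)) k (szero (ssec \<O>X (topspace X))) (\<phi>s (topspace Y)) c)"
      using g [OF x] unfolding preT by simp
  qed
qed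

lemma pi_map_bij_iff:
  assumes A: "simplicial_Cinf A" and B: "simplicial_Cinf B" and h: "h \<in> scring_hom A B" and v: "v \<in> spx A 0"
  shows "bij_betw (pi_map B k (h 0 v) h) (pi_set A k v) (pi_set B k (h 0 v)) \<longleftrightarrow>
    (\<forall>s\<in>spheres A k v. \<forall>t\<in>spheres A k v. (h k s, h k t) \<in> homot B k (h 0 v) \<longrightarrow> (s, t) \<in> homot A k v) \<and>
    (\<forall>u\<in>spheres B k (h 0 v). \<exists>s\<in>spheres A k v. (h k s, u) \<in> homot B k (h 0 v))"
    (is "?bij \<longleftrightarrow> ?inj \<and> ?surj")
proof -
  have w: "h 0 v \<in> spx B 0" by (rule scring_homD(2) [OF h v])
  note cl = pi_map_hclass [OF A B h v] and sp = spheres_hom [OF h v]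
  note eqA = hclass_eq_iff [OF A v] and eqB = hclass_eq_iff [OF B w]
  have pi: "pi_set S l u = (\<lambda>s. hclass S l u s) ` spheres S l u" for S :: "('z, 'y) sset_scheme" and l u
    by (auto simp: pi_set_def quotient_def)
  have "inj_on (pi_map B k (h 0 v) h) (pi_set A k v) \<longleftrightarrow> ?inj"
    unfolding inj_on_def pi by (simp add: cl eqB sp eqA)
  moreover have "pi_map B k (h 0 v) h ` pi_set A k v = pi_set B k (h 0 v) \<longleftrightarrow> ?surj"
  proof
    assume eq: "pi_map B k (h 0 v) h ` pi_set A k v = pi_set B k (h 0 v)"
    show ?surj
    proof
      fix u assume u: "u \<in> spheres B k (h 0 v)"
      then have "hclass B k (h 0 v) u \<in> pi_map B k (h 0 v) h ` pi_set A k v"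
        unfolding eq by (rule hclass_in_pi)
      then obtain c where "c \<in> pi_set A k v" "hclass B k (h 0 v) u = pi_map B k (h 0 v) h c" by blast
      moreover from this(1) obtain s where "s \<in> spheres A k v" "c = hclass A k v s" by (rule pi_setE)
      ultimately show "\<exists>s\<in>spheres A k v. (h k s, u) \<in> homot B k (h 0 v)"
        using cl eqB [OF sp u] by metis
    qed
  next
    assume sj: ?surj
    show "pi_map B k (h 0 v) h ` pi_set A k v = pi_set B k (h 0 v)"
    proof (intro equalityI subsetI)
      fix d assume "d \<in> pi_map B k (h 0 v) h ` pi_set A k v"
      then obtain s where "s \<in> spheres A k v" "d = pi_map B k (h 0 v) h (hclass A k v s)"
        by (auto simp: pi)
      then show "d \<in> pi_set B k (h 0 v)"
        using cl hclass_in_pi [OF sp] by simp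
    next
      fix d assume "d \<in> pi_set B k (h 0 v)"
      then obtain u where u: "u \<in> spheres B k (h 0 v)" "d = hclass B k (h 0 v) u" by (rule pi_setE)
      then obtain s where s: "s \<in> spheres A k v" "(h k s, u) \<in> homot B k (h 0 v)" using sj by blast
      then have "d = pi_map B k (h 0 v) h (hclass A k v s)"
        using cl [OF s(1)] eqB [OF sp [OF s(1)] u(1)] u(2) by simp
      then show "d \<in> pi_map B k (h 0 v) h ` pi_set A k v"
        using hclass_in_pi [OF s(1)] by blast
    qed
  qed
  ultimately show ?thesis
    by (simp add: bij_betw_def)
qed

lemma homot_translate:
  assumes A: "simplicial_Cinf A" and v: "v \<in> spx A 0"
  shows "(s, t) \<in> homot A k v \<Longrightarrow>
      (s \<ominus>\<^bsub>lring A k\<^esub> base A k v, t \<ominus>\<^bsub>lring A k\<^esub> base A k v) \<in> homot A k (szero A)"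
    and "(s, t) \<in> homot A k (szero A) \<Longrightarrow>
      (s \<oplus>\<^bsub>lring A k\<^esub> base A k v, t \<oplus>\<^bsub>lring A k\<^esub> base A k v) \<in> homot A k v"
proof -
  interpret Z: cring "lring A 0" by (rule cring_underlying [OF simplicial_CinfD(1) [OF A]])
  have b: "(base A k v, base A k v) \<in> homot A k v"
    by (rule homot_refl [OF A v base_sphere [OF A v]])
  have z: "v \<ominus>\<^bsub>lring A 0\<^esub> v = szero A" "szero A \<oplus>\<^bsub>lring A 0\<^esub> v = v"
    using v by (simp_all add: szero_def a_minus_def Z.r_neg)
  show "(s \<ominus>\<^bsub>lring A k\<^esub> base A k v, t \<ominus>\<^bsub>lring A k\<^esub> base A k v) \<in> homot A k (szero A)"
    if "(s, t) \<in> homot A k v"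
    using homot_binary(3) [OF A v v that b] unfolding z .
  show "(s \<oplus>\<^bsub>lring A k\<^esub> base A k v, t \<oplus>\<^bsub>lring A k\<^esub> base A k v) \<in> homot A k v"
    if "(s, t) \<in> homot A k (szero A)"
    using homot_binary(1) [OF A szero_closed [OF A] v that b] unfolding z .
qed

text \<open>
  Translation by the degenerate simplices of a vertex \<open>v\<close> identifies the homotopy groups based at
  \<open>0\<close> and at \<open>v\<close>, so it is enough to consider the base point \<open>0\<close>.
\<close>

lemma pi_map_bij_base_change:
  assumes A: "simplicial_Cinf A" and B: "simplicial_Cinf B" and h: "h \<in> scring_hom A B" and v: "v \<in> spx A 0"
    and bij: "bij_betw (pi_map B k (szero B) h) (pi_ring A k) (pi_ring B k)"
  shows "bij_betw (pi_map B k (h 0 v) h) (pi_set A k v) (pi_set B k (h 0 v))"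
proof -
  note zA = szero_closed [OF A]
  have w: "h 0 v \<in> spx B 0" by (rule scring_homD(2) [OF h v])
  interpret RA: cring "lring A k" by (rule cring_underlying [OF simplicial_CinfD(1) [OF A]])
  interpret RB: cring "lring B k" by (rule cring_underlying [OF simplicial_CinfD(1) [OF B]])
  interpret H: ring_hom_cring "lring A k" "lring B k" "h k" by (rule level_hom [OF A B h])
  have inj0: "(s, t) \<in> homot A k (szero A)"
    if "s \<in> spheres A k (szero A)" "t \<in> spheres A k (szero A)" "(h k s, h k t) \<in> homot B k (szero B)" for s t
    using pi_map_bij_iff [OF A B h zA, of k] bij that unfolding szero_hom [OF h] by blast
  have surj0: "\<exists>s\<in>spheres A k (szero A). (h k s, u) \<in> homot B k (szero B)" if "u \<in> spheres B k (szero B)" for u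
    using pi_map_bij_iff [OF A B h zA, of k] bij that unfolding szero_hom [OF h] by blast
  let ?a = "base A k v" and ?b = "base B k (h 0 v)"
  have a: "?a \<in> carrier (lring A k)" and b: "?b \<in> carrier (lring B k)" and hab: "h k ?a = ?b"
    using base_closed [OF A v] base_closed [OF B w] scring_homD(5) [OF h v] by simp_all
  have minus: "h k (s \<ominus>\<^bsub>lring A k\<^esub> ?a) = h k s \<ominus>\<^bsub>lring B k\<^esub> ?b"
    and plus: "h k (s \<oplus>\<^bsub>lring A k\<^esub> ?a) = h k s \<oplus>\<^bsub>lring B k\<^esub> ?b" if "s \<in> spx A k" for s
    using that a hab RA.a_inv_closed [OF a] by (simp_all add: a_minus_def)
  have "(s, t) \<in> homot A k v"
    if s: "s \<in> spheres A k v" and t: "t \<in> spheres A k v" and st: "(h k s, h k t) \<in> homot B k (h 0 v)" for s t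
  proof -
    have sc: "s \<in> spx A k" "t \<in> spx A k" using s t by (auto intro: spheres_spx)
    have sp: "u \<ominus>\<^bsub>lring A k\<^esub> ?a \<in> spheres A k (szero A)" if "u \<in> spheres A k v" for u
      by (rule homot_spheres(1) [OF homot_translate(1) [OF A v homot_refl [OF A v that]]])
    have "(s \<ominus>\<^bsub>lring A k\<^esub> ?a, t \<ominus>\<^bsub>lring A k\<^esub> ?a) \<in> homot A k (szero A)"
      using homot_translate(1) [OF B w st] by (intro inj0 sp s t) (simp add: minus sc)
    then have "((s \<ominus>\<^bsub>lring A k\<^esub> ?a) \<oplus>\<^bsub>lring A k\<^esub> ?a, (t \<ominus>\<^bsub>lring A k\<^esub> ?a) \<oplus>\<^bsub>lring A k\<^esub> ?a) \<in> homot A k v"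
      by (rule homot_translate(2) [OF A v])
    then show ?thesis
      using RA.maltsev_laws(1) [of s ?a] RA.maltsev_laws(1) [of t ?a] sc a by simp
  qed
  moreover have "\<exists>s\<in>spheres A k v. (h k s, u) \<in> homot B k (h 0 v)" if u: "u \<in> spheres B k (h 0 v)" for u
  proof -
    have "u \<ominus>\<^bsub>lring B k\<^esub> ?b \<in> spheres B k (szero B)"
      by (rule homot_spheres(1) [OF homot_translate(1) [OF B w homot_refl [OF B w u]]])
    then obtain s where s: "s \<in> spheres A k (szero A)" "(h k s, u \<ominus>\<^bsub>lring B k\<^esub> ?b) \<in> homot B k (szero B)"
      using surj0 by blast
    have "(h k s \<oplus>\<^bsub>lring B k\<^esub> ?b, (u \<ominus>\<^bsub>lring B k\<^esub> ?b) \<oplus>\<^bsub>lring B k\<^esub> ?b) \<in> homot B k (h 0 v)"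
      by (rule homot_translate(2) [OF B w s(2)])
    moreover have "(u \<ominus>\<^bsub>lring B k\<^esub> ?b) \<oplus>\<^bsub>lring B k\<^esub> ?b = u"
      using RB.maltsev_laws(1) [of u ?b] spheres_spx [OF u] b by simp
    ultimately have "(h k (s \<oplus>\<^bsub>lring A k\<^esub> ?a), u) \<in> homot B k (h 0 v)"
      by (simp add: plus spheres_spx [OF s(1)])
    moreover have "s \<oplus>\<^bsub>lring A k\<^esub> ?a \<in> spheres A k v"
      by (rule homot_spheres(1) [OF homot_translate(2) [OF A v homot_refl [OF A zA s(1)]]])
    ultimately show ?thesis by blast
  qed
  ultimately show ?thesis
    unfolding pi_map_bij_iff [OF A B h v] by blast
qed

lemma bij_betw_commuting_square:
  assumes f: "bij_betw f A C" and g: "bij_betw g B D" and k: "bij_betw k C D"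
    and p: "\<And>a. a \<in> A \<Longrightarrow> p a \<in> B" "\<And>a. a \<in> A \<Longrightarrow> k (f a) = g (p a)"
  shows "bij_betw p A B"
proof -
  have "bij_betw (the_inv_into B g \<circ> (k \<circ> f)) A B"
    by (rule bij_betw_trans [OF bij_betw_trans [OF f k] bij_betw_the_inv_into [OF g]])
  moreover have "(the_inv_into B g \<circ> (k \<circ> f)) a = p a" if "a \<in> A" for a
    using the_inv_into_f_f [OF bij_betw_imp_inj_on [OF g] p(1) [OF that]] p(2) [OF that] by simp
  ultimately show ?thesis
    using bij_betw_cong [of A _ p B] by blast
qed

theorem proposition5:
  fixes X :: "'x topology" and \<O>X :: "('x, 'a) ssheaf"
    and Y :: "'y topology" and \<O>Y :: "('y, 'b) ssheaf"
    and \<phi> :: "'x \<Rightarrow> 'y" and \<phi>s :: "'y set \<Rightarrow> nat \<Rightarrow> 'b \<Rightarrow> 'a"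
  assumes "localized_space X \<O>X"
    and "localized_space Y \<O>Y"
    and "local_weak_equivalence X \<O>X Y \<O>Y \<phi> \<phi>s"
  shows "in_sL (global_sections X \<O>X) \<and> in_sL (global_sections Y \<O>Y) \<and>
    weak_equivalence (global_sections Y \<O>Y) (global_sections X \<O>X) (global_sections_map Y \<phi>s)"
proof (intro conjI global_sections_in_sL assms(1,2))
  note SX = localized_spaceD(1) [OF assms(1)] and SY = localized_spaceD(1) [OF assms(2)]
  let ?A = "global_sections Y \<O>Y" and ?B = "global_sections X \<O>X" and ?h = "global_sections_map Y \<phi>s"
  have m: "space_morphism X \<O>X Y \<O>Y \<phi> \<phi>s"
    and lwe: "\<And>k. bij_betw (pi_sheaf_map X \<O>X \<phi> \<phi>s k (topspace Y))
      (sec (pi_sheaf Y \<O>Y k) (topspace Y)) (sec (pi_sheaf X \<O>X k) (preim X \<phi> (topspace Y)))"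
    using assms(3) unfolding local_weak_equivalence_def by auto
  have preT: "preim X \<phi> (topspace Y) = topspace X"
    using m by (simp add: space_morphism_def preim_topspace)
  have A: "simplicial_Cinf ?A" and B: "simplicial_Cinf ?B"
    unfolding global_sections_def
    by (rule simplicial_sheafD(1) [OF SY openin_topspace], rule simplicial_sheafD(1) [OF SX openin_topspace])
  have h: "?h \<in> scring_hom ?A ?B"
    by (rule global_sections_map_hom [OF m])
  \<comment> \<open>The homotopy groups of global sections are the global sections of the homotopy sheaves, and
    there the hypothesis applies.\<close>
  have "bij_betw (pi_map ?B k (szero ?B) ?h) (pi_ring ?A k) (pi_ring ?B k)" for k
  proof (rule bij_betw_commuting_square [OF pi_global_sections [OF assms(2)] pi_global_sections [OF assms(1)]])
    show "bij_betw (pi_sheaf_map X \<O>X \<phi> \<phi>s k (topspace Y))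
        (germ_sections Y (pi_psh \<O>Y k) (topspace Y)) (germ_sections X (pi_psh \<O>X k) (topspace X))"
      using lwe [of k] by (simp add: pi_sheaf_def sheafify_def preT)
    fix c assume c: "c \<in> pi_ring ?A k"
    then obtain s where s: "s \<in> spheres ?A k (szero ?A)" "c = hclass ?A k (szero ?A) s"
      by (rule pi_setE)
    show "pi_map ?B k (szero ?B) ?h c \<in> pi_ring ?B k"
      using pi_map_hclass [OF A B h szero_closed [OF A] s(1)] hclass_in_pi [OF spheres_hom [OF h szero_closed [OF A] s(1)]]
      by (simp add: s(2) szero_hom [OF h])
    show "pi_sheaf_map X \<O>X \<phi> \<phi>s k (topspace Y) (to_sheaf Y (pi_psh \<O>Y k) (topspace Y) c) =
        to_sheaf X (pi_psh \<O>X k) (topspace X) (pi_map ?B k (szero ?B) ?h c)"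
      using pi_sheaf_map_to_sheaf [OF SX SY m] c by (simp add: global_sections_def global_sections_map_def)
  qed
  then have "bij_betw (pi_map ?B k (?h 0 v) ?h) (pi_set ?A k v) (pi_set ?B k (?h 0 v))" if "v \<in> spx ?A 0" for v k
    using pi_map_bij_base_change [OF A B h that] by blast
  moreover have "spx ?A 0 \<noteq> {}"
    using szero_closed [OF A] by blast
  ultimately show "weak_equivalence ?A ?B ?h"
    unfolding weak_equivalence_def kan_weak_equivalence_def using h by blast
qed

end
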